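(* Let $G$ be a finite soluble group, and let $A$ [respectively $B$] be a set of representatives (up to $G$-isomorphism) for the irreducible $G$-modules which are $G$-isomorphic to a non-central [respectively central] complemented chief factor of $G$. Then $$C(G)\le \sum_{V\in A} \min\left\{(\delta_{V}\cdot\theta_{V}+c_{V})|V|,\ \left(\left\lceil\frac{\delta_{V}\cdot\theta_{V}}{n_{V}}\right\rceil+\frac{q_{V}^{n_V}}{q_{V}^{n_V}-1}\right)|H_{V}|\right\}+\max_{V\in B}\delta_{V}+\sigma,$$ where $c_{V}:=q_{V}/(q_{V}-1)\le 2$.
   Context: A tuple $g_1,\dots,g_d$ of elements of a finite group $G$ invariably generates $G$ if $\{g_1^{x_1},\dots,g_d^{x_d}\}$ generates $G$ for every $(x_1,\dots,x_d)\in G^d$. The Chebotarev invariant $C(G)$ is the expected value of the minimal $n$ such that $n$ independent uniformly random elements of $G$ invariably generate $G$; equivalently $C(G)=\sum_{k\ge 0}(1-P_I(G,k))$, where $P_I(G,k)$ is the probability that $k$ independent uniformly random elements of $G$ invariably generate $G$. A complement to a chief factor $X/Y$ of $G$ is a subgroup $K$ of $G$ with $KX=G$ and $K\cap X=Y$; the chief factor is complemented if it has a complement. For an irreducible $G$-module $V$ which is $G$-isomorphic to a complemented chief factor of $G$: $\delta_V=\delta_V(G)$ is the number of complemented factors in a chief series of $G$ which are $G$-isomorphic to $V$ (independent of the series); $\theta_V=0$ if $\delta_V=1$ and $\theta_V=1$ otherwise; $q_V=|\mathrm{End}_G(V)|$; $n_V=\dim_{\mathrm{End}_G(V)}V$;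 $H_V=G/C_G(V)$. A chief factor is central if $G$ acts trivially on it. The number $\sigma=2.118456563\ldots$ is the constant of Pomerance's theorem on the expected number of random elements generating a finite abelian group, namely $\sigma=1+\sum_{j\ge 1}\bigl(1-\prod_{i\ge j+1}\zeta(i)^{-1}\bigr)$ with $\zeta$ the Riemann zeta function. It has the property that for every finite abelian group $X$ the expected number of independent uniformly random elements needed to generate $X$ is at most $d(X)+\sigma$, where $d(X)$ is the minimal number of generators of $X$. The maximum over the empty set is taken to be $0$. *)

theory Defs
  imports "HOL-Algebra.Solvable_Groups" "HOL-Algebra.Bij" "HOL-Algebra.FiniteProduct"
    "HOL-Probability.Probability"
begin

section \<open>Invariable generation and the Chebotarev invariant\<close>

text \<open>An \<open>n\<close>-tuple is given by the values \<open>g 0, \<dots>, g (n - 1)\<close>.\<close>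

definition invariably_generates ::
    "('a, 'm) monoid_scheme \<Rightarrow> nat \<Rightarrow> (nat \<Rightarrow> 'a) \<Rightarrow> bool" where
  "invariably_generates G n g \<longleftrightarrow>
     (\<forall>x \<in> {..<n} \<rightarrow> carrier G.
        generate G ((\<lambda>i. inv\<^bsub>G\<^esub> (x i) \<otimes>\<^bsub>G\<^esub> g i \<otimes>\<^bsub>G\<^esub> x i) ` {..<n}) = carrier G)"

definition random_sequence :: "('a, 'm) monoid_scheme \<Rightarrow> (nat \<Rightarrow> 'a) measure" where
  "random_sequence G = PiM UNIV (\<lambda>_. uniform_count_measure (carrier G))"

text \<open>The waiting time is \<open>\<infinity>\<close> (the infimum of the empty set) if no initial segment of the sequence
  invariably generates.\<close>

definition waiting_time :: "('a, 'm) monoid_scheme \<Rightarrow> (nat \<Rightarrow> 'a) \<Rightarrow> ennreal" where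
  "waiting_time G g = (INF n \<in> {n. invariably_generates G n g}. of_nat n)"

definition chebotarev_invariant :: "('a, 'm) monoid_scheme \<Rightarrow> ennreal" where
  "chebotarev_invariant G = (\<integral>\<^sup>+ g. waiting_time G g \<partial>random_sequence G)"


section \<open>G-modules\<close>

text \<open>A \<open>G\<close>-module is an abelian group \<open>V\<close>, written multiplicatively, together with a homomorphism
  \<open>\<phi>\<close> from \<open>G\<close> to the automorphism group of \<open>V\<close>; the (left) action is \<open>g \<cdot> v = \<phi> g v\<close>.\<close>

definition G_module ::
    "('a, 'm) monoid_scheme \<Rightarrow> ('v, 'n) monoid_scheme \<Rightarrow> ('a \<Rightarrow> 'v \<Rightarrow> 'v) \<Rightarrow> bool" where
  "G_module G V \<phi> \<longleftrightarrow> comm_group V \<and> group_hom G (AutoGroup V) \<phi>"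

definition irreducible_G_module ::
    "('a, 'm) monoid_scheme \<Rightarrow> ('v, 'n) monoid_scheme \<Rightarrow> ('a \<Rightarrow> 'v \<Rightarrow> 'v) \<Rightarrow> bool" where
  "irreducible_G_module G V \<phi> \<longleftrightarrow>
     G_module G V \<phi> \<and> carrier V \<noteq> {\<one>\<^bsub>V\<^esub>} \<and>
     (\<forall>W. subgroup W V \<and> (\<forall>g \<in> carrier G. \<phi> g ` W \<subseteq> W) \<longrightarrow> W = {\<one>\<^bsub>V\<^esub>} \<or> W = carrier V)"

definition G_isomorphic ::
    "('a, 'm) monoid_scheme \<Rightarrow> ('v, 'n) monoid_scheme \<Rightarrow> ('a \<Rightarrow> 'v \<Rightarrow> 'v) \<Rightarrow>
     ('w, 'k) monoid_scheme \<Rightarrow> ('a \<Rightarrow> 'w \<Rightarrow> 'w) \<Rightarrow> bool" where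
  "G_isomorphic G V \<phi> W \<psi> \<longleftrightarrow>
     (\<exists>f \<in> iso V W. \<forall>g \<in> carrier G. \<forall>v \<in> carrier V. f (\<phi> g v) = \<psi> g (f v))"

definition trivial_action ::
    "('a, 'm) monoid_scheme \<Rightarrow> ('v, 'n) monoid_scheme \<Rightarrow> ('a \<Rightarrow> 'v \<Rightarrow> 'v) \<Rightarrow> bool" where
  "trivial_action G V \<phi> \<longleftrightarrow> (\<forall>g \<in> carrier G. \<forall>v \<in> carrier V. \<phi> g v = v)"

text \<open>The elements of \<open>End\<^sub>G(V)\<close>, made extensional so that they can be counted.\<close>

definition End_G ::
    "('a, 'm) monoid_scheme \<Rightarrow> ('v, 'n) monoid_scheme \<Rightarrow> ('a \<Rightarrow> 'v \<Rightarrow> 'v) \<Rightarrow> ('v \<Rightarrow> 'v) set" where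
  "End_G G V \<phi> =
     {f \<in> hom V V \<inter> extensional (carrier V).
        \<forall>g \<in> carrier G. \<forall>v \<in> carrier V. f (\<phi> g v) = \<phi> g (f v)}"

definition q_mod ::
    "('a, 'm) monoid_scheme \<Rightarrow> ('v, 'n) monoid_scheme \<Rightarrow> ('a \<Rightarrow> 'v \<Rightarrow> 'v) \<Rightarrow> nat" where
  "q_mod G V \<phi> = card (End_G G V \<phi>)"

text \<open>A finite basis of \<open>V\<close> over \<open>End\<^sub>G(V)\<close>: as \<open>V\<close> is written multiplicatively, the linear
  combination of the \<open>s \<in> S\<close> with coefficients \<open>f s\<close> is the product of the elements \<open>f s s\<close>.\<close>

definition is_End_basis ::
    "('a, 'm) monoid_scheme \<Rightarrow> ('v, 'n) monoid_scheme \<Rightarrow> ('a \<Rightarrow> 'v \<Rightarrow> 'v) \<Rightarrow> 'v set \<Rightarrow> bool" where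
  "is_End_basis G V \<phi> S \<longleftrightarrow>
     finite S \<and> S \<subseteq> carrier V \<and>
     (\<forall>v \<in> carrier V. \<exists>!f. f \<in> (S \<rightarrow>\<^sub>E End_G G V \<phi>) \<and> finprod V (\<lambda>s. f s s) S = v)"

definition n_mod ::
    "('a, 'm) monoid_scheme \<Rightarrow> ('v, 'n) monoid_scheme \<Rightarrow> ('a \<Rightarrow> 'v \<Rightarrow> 'v) \<Rightarrow> nat" where
  "n_mod G V \<phi> = (THE n. \<exists>S. is_End_basis G V \<phi> S \<and> card S = n)"

definition H_mod ::
    "('a, 'm) monoid_scheme \<Rightarrow> ('v, 'n) monoid_scheme \<Rightarrow> ('a \<Rightarrow> 'v \<Rightarrow> 'v) \<Rightarrow> 'a set monoid" where
  "H_mod G V \<phi> = G Mod {g \<in> carrier G. \<forall>v \<in> carrier V. \<phi> g v = v}"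

definition c_mod ::
    "('a, 'm) monoid_scheme \<Rightarrow> ('v, 'n) monoid_scheme \<Rightarrow> ('a \<Rightarrow> 'v \<Rightarrow> 'v) \<Rightarrow> real" where
  "c_mod G V \<phi> = real (q_mod G V \<phi>) / (real (q_mod G V \<phi>) - 1)"


section \<open>Chief factors\<close>

definition chief_factor :: "('a, 'm) monoid_scheme \<Rightarrow> 'a set \<Rightarrow> 'a set \<Rightarrow> bool" where
  "chief_factor G X Y \<longleftrightarrow>
     X \<lhd> G \<and> Y \<lhd> G \<and> Y \<subset> X \<and> (\<forall>N. N \<lhd> G \<and> Y \<subseteq> N \<and> N \<subseteq> X \<longrightarrow> N = Y \<or> N = X)"

definition complemented :: "('a, 'm) monoid_scheme \<Rightarrow> 'a set \<Rightarrow> 'a set \<Rightarrow> bool" where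
  "complemented G X Y \<longleftrightarrow> (\<exists>K. subgroup K G \<and> K <#>\<^bsub>G\<^esub> X = carrier G \<and> K \<inter> X = Y)"

abbreviation section_group :: "('a, 'm) monoid_scheme \<Rightarrow> 'a set \<Rightarrow> 'a set \<Rightarrow> 'a set monoid" where
  "section_group G X Y \<equiv> G\<lparr>carrier := X\<rparr> Mod Y"

text \<open>\<open>G\<close> acts on \<open>X/Y\<close> by conjugation.  Automorphisms in \<^const>\<open>AutoGroup\<close> are extensional, hence the
  restriction to the carrier.\<close>

definition section_action ::
    "('a, 'm) monoid_scheme \<Rightarrow> 'a set \<Rightarrow> 'a set \<Rightarrow> 'a \<Rightarrow> 'a set \<Rightarrow> 'a set" where
  "section_action G X Y g =
     (\<lambda>C \<in> carrier (section_group G X Y). (\<lambda>x. g \<otimes>\<^bsub>G\<^esub> x \<otimes>\<^bsub>G\<^esub> inv\<^bsub>G\<^esub> g) ` C)"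

definition G_isomorphic_to_section ::
    "('a, 'm) monoid_scheme \<Rightarrow> ('v, 'n) monoid_scheme \<Rightarrow> ('a \<Rightarrow> 'v \<Rightarrow> 'v) \<Rightarrow>
     'a set \<Rightarrow> 'a set \<Rightarrow> bool" where
  "G_isomorphic_to_section G V \<phi> X Y \<longleftrightarrow>
     G_isomorphic G V \<phi> (section_group G X Y) (section_action G X Y)"

definition central_factor :: "('a, 'm) monoid_scheme \<Rightarrow> 'a set \<Rightarrow> 'a set \<Rightarrow> bool" where
  "central_factor G X Y \<longleftrightarrow> trivial_action G (section_group G X Y) (section_action G X Y)"

text \<open>A chief series is listed from the trivial subgroup upwards.\<close>

definition chief_series :: "('a, 'm) monoid_scheme \<Rightarrow> 'a set list \<Rightarrow> bool" where
  "chief_series G Ns \<longleftrightarrow>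
     Ns \<noteq> [] \<and> hd Ns = {\<one>\<^bsub>G\<^esub>} \<and> last Ns = carrier G \<and>
     (\<forall>i. Suc i < length Ns \<longrightarrow> chief_factor G (Ns ! Suc i) (Ns ! i))"

text \<open>The number of complemented factors \<open>G\<close>-isomorphic to \<open>V\<close> is the same for every chief series
  \<open>Ns\<close>; as this is a theorem and not part of the definition, the series is kept as a parameter.\<close>

definition delta_mod ::
    "('a, 'm) monoid_scheme \<Rightarrow> 'a set list \<Rightarrow> ('v, 'n) monoid_scheme \<Rightarrow> ('a \<Rightarrow> 'v \<Rightarrow> 'v) \<Rightarrow> nat" where
  "delta_mod G Ns V \<phi> =
     card {i. Suc i < length Ns \<and> complemented G (Ns ! Suc i) (Ns ! i) \<and>
              G_isomorphic_to_section G V \<phi> (Ns ! Suc i) (Ns ! i)}"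

definition theta_mod ::
    "('a, 'm) monoid_scheme \<Rightarrow> 'a set list \<Rightarrow> ('v, 'n) monoid_scheme \<Rightarrow> ('a \<Rightarrow> 'v \<Rightarrow> 'v) \<Rightarrow> nat" where
  "theta_mod G Ns V \<phi> = (if delta_mod G Ns V \<phi> = 1 then 0 else 1)"

text \<open>\<open>A\<close> is a set of representatives, up to \<open>G\<close>-isomorphism, for the irreducible \<open>G\<close>-modules
  \<open>G\<close>-isomorphic to some complemented chief factor \<open>X/Y\<close> of \<open>G\<close> satisfying \<open>P X Y\<close>.\<close>

definition module_representatives ::
    "('a, 'm) monoid_scheme \<Rightarrow> ('a set \<Rightarrow> 'a set \<Rightarrow> bool) \<Rightarrow>
     ('v monoid \<times> ('a \<Rightarrow> 'v \<Rightarrow> 'v)) set \<Rightarrow> bool" where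
  "module_representatives G P A \<longleftrightarrow>
     (\<forall>(V, \<phi>) \<in> A. irreducible_G_module G V \<phi> \<and>
        (\<exists>X Y. chief_factor G X Y \<and> complemented G X Y \<and> P X Y \<and>
               G_isomorphic_to_section G V \<phi> X Y)) \<and>
     (\<forall>X Y. chief_factor G X Y \<and> complemented G X Y \<and> P X Y \<longrightarrow>
        (\<exists>(V, \<phi>) \<in> A. G_isomorphic_to_section G V \<phi> X Y)) \<and>
     (\<forall>(V, \<phi>) \<in> A. \<forall>(W, \<psi>) \<in> A. G_isomorphic G V \<phi> W \<psi> \<longrightarrow> (V, \<phi>) = (W, \<psi>))"


section \<open>The constant of Pomerance's theorem\<close>

definition zeta_nat :: "nat \<Rightarrow> real" where
  "zeta_nat i = (\<Sum>k. 1 / real (Suc k) ^ i)"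

text \<open>The indices \<open>j \<ge> 1\<close> and \<open>i \<ge> j + 1\<close> are shifted to start at 0: here \<open>j\<close> stands for \<open>j + 1\<close>,
  and \<open>i = j + 2 + k\<close>.\<close>

definition pomerance_sigma :: real where
  "pomerance_sigma = 1 + (\<Sum>j. 1 - (\<Prod>k. inverse (zeta_nat (j + 2 + k))))"

end

theory Submission
  imports Defs "HOL-Number_Theory.Cong" "HOL-Algebra.Multiplicative_Group"
    "HOL-Algebra.Zassenhaus"
begin

text \<open>If a tuple \<open>g\<close> does not invariably generate \<open>G\<close>, then conjugates of its entries lie in a complement of a
  complemented chief factor \<open>V\<close>.  Such a complement is the kernel of an outer derivation \<open>d\<close> of \<open>G\<close> into \<open>V\<close>, so
  that \<open>d (g i) \<in> [V, g i]\<close> for all \<open>i\<close>.  Descending along the chief series one sees that the derivations modulo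
  the inner ones form a space of size at most \<open>q ^ \<delta>\<close>, and that \<open>C = C\<^sub>G(V)\<close> is mapped onto \<open>V\<close> by each outer
  one.  Given the cosets of the \<open>g i\<close> modulo \<open>C\<close>, a union bound over the outer derivations, counted up to
  scalars and inner derivations, bounds the probability of failure by \<open>(q ^ \<delta> - 1) / (q - 1)\<close> times the product
  of the \<open>1 / |C\<^sub>V(g i)|\<close>.  A random element has a nonzero fixed point in \<open>V\<close> with probability at least \<open>1 / |V|\<close>,
  which contributes a factor \<open>1 / q\<close>, and it centralises \<open>V\<close> with probability \<open>1 / |H|\<close>, which contributes a factor
  \<open>1 / q ^ n\<close>; summing over the length of the tuple gives the two terms of the minimum.  The central chief factors
  are treated together: their failure means failure to generate an abelian quotient of \<open>G\<close>, the conditional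
  probabilities along the chief series multiply to \<open>\<Prod> (1 - p ^ j / p ^ k)\<close>, and Euler products compare this with
  Pomerance's constant.\<close>

section \<open>Homomorphisms and fixed points\<close>

lemma (in group_hom) card_surj_hom_preimage:
  assumes fin: "finite (carrier G)" and surj: "h ` carrier G = carrier H" and S: "S \<subseteq> carrier H"
  shows "card {x \<in> carrier G. h x \<in> S} * card (carrier H) = card (carrier G) * card S"
proof -
  define K where "K = kernel G H h"
  have finH: "finite (carrier H)" using fin surj by (metis finite_imageI)
  have fib: "card {x \<in> carrier G. h x = y} = card K" if y: "y \<in> carrier H" for y
  proof -
    obtain a where a: "a \<in> carrier G" "h a = y" using y surj by (metis imageE)
    have "bij_betw (\<lambda>x. a \<otimes> x) K {x \<in> carrier G. h x = y}"
    proof (rule bij_betw_byWitness[where f' = "\<lambda>x. inv a \<otimes> x"])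
    qed (use a y in \<open>auto simp: K_def kernel_def G.m_assoc[symmetric]\<close>)
    then show ?thesis by (simp add: bij_betw_same_card)
  qed
  have cnt: "card {x \<in> carrier G. h x \<in> T} = card K * card T" if T: "T \<subseteq> carrier H" for T
  proof -
    have "finite T" using T finH finite_subset by blast
    have "{x \<in> carrier G. h x \<in> T} = (\<Union>y\<in>T. {x \<in> carrier G. h x = y})" by auto
    also have "card \<dots> = (\<Sum>y\<in>T. card {x \<in> carrier G. h x = y})"
      by (rule card_UN_disjoint) (use \<open>finite T\<close> fin in auto)
    also have "\<dots> = (\<Sum>y\<in>T. card K)" using fib T by (intro sum.cong) auto
    finally show ?thesis by simp
  qed
  have "{x \<in> carrier G. h x \<in> carrier H} = carrier G" by auto
  then show ?thesis using cnt[OF S] cnt[of "carrier H"] by simp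
qed

text \<open>The iterates of \<open>f\<close> behave like a cyclic group of order \<open>p\<close>,
  so orbits have 1 or \<open>p\<close> elements; the induction removes one orbit of size
  \<open>p\<close> at a time.\<close>

lemma fixed_points_prime_power_map:
  fixes f :: "'b \<Rightarrow> 'b" and p :: nat
  assumes "prime p" "finite S" "f \<in> S \<rightarrow> S" "\<And>x. x \<in> S \<Longrightarrow> (f ^^ p) x = x"
  shows "[card S = card {x \<in> S. f x = x}] (mod p)"
  using assms(2-4)
proof (induction "card S" arbitrary: S rule: less_induct)
  case less
  have p0: "p > 0" using \<open>prime p\<close> prime_gt_0_nat by blast
  have iter: "(f ^^ i) x \<in> S" if "x \<in> S" for i x
    by (induction i) (use that less.prems(2) in auto)
  have modp: "(f ^^ i) x = (f ^^ (i mod p)) x" if x: "x \<in> S" for i x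
  proof -
    have "(f ^^ (p * j)) y = y" if "y \<in> S" for j y
      by (induction j) (use that less.prems(3) in \<open>auto simp: funpow_add\<close>)
    then show ?thesis using iter[OF x]
      by (metis (no_types, lifting) comp_apply funpow_add mult_div_mod_eq)
  qed
  show ?case
  proof (cases "\<exists>x\<in>S. f x \<noteq> x")
    case False
    then have "{x \<in> S. f x = x} = S" by auto
    then show ?thesis by simp
  next
    case True
    then obtain x where x: "x \<in> S" "f x \<noteq> x" by auto
    define O' where "O' = (\<lambda>i. (f ^^ i) x) ` {..<p}"
    have inj: "inj_on (\<lambda>i. (f ^^ i) x) {..<p}"
    proof (rule inj_onI, rule ccontr)
      fix i j assume ij: "i \<in> {..<p}" "j \<in> {..<p}" "(f ^^ i) x = (f ^^ j) x" "i \<noteq> j"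
      have *: False if ij: "i < j" "j < p" "(f ^^ i) x = (f ^^ j) x" for i j
      proof -
        define k where "k = j - i"
        have k: "0 < k" "k < p" using ij by (auto simp: k_def)
        have "(f ^^ (p - i)) ((f ^^ i) x) = (f ^^ (p - i)) ((f ^^ j) x)" using ij by simp
        then have "(f ^^ (p - i + i)) x = (f ^^ (p - i + j)) x" by (simp only: funpow_add comp_apply)
        moreover have "p - i + i = p" "p - i + j = k + p" using ij by (auto simp: k_def)
        ultimately have fk: "(f ^^ k) x = x"
          using less.prems(3) x by (simp add: funpow_add)
        have fkj: "(f ^^ (k * j)) x = x" for j
          by (induction j) (use fk in \<open>auto simp: funpow_add\<close>)
        \<comment> \<open>A return after \<open>k < p\<close> steps would make \<open>x\<close> a
          fixed point, because \<open>k\<close> is invertible modulo \<open>p\<close>.\<close>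
        have "coprime k p" using k \<open>prime p\<close>
          by (metis coprime_commute nat_dvd_not_less prime_imp_coprime)
        then obtain j where "[k * j = 1] (mod p)"
          using cong_solve_coprime_nat[of k p] by auto
        then have "(k * j) mod p = 1" using k by (simp add: cong_def)
        then have "f x = x" using fkj[of j] modp[OF x(1), of "k * j"] by simp
        then show False using x by simp
      qed
      show False using *[of i j] *[of j i] ij by (cases "i < j") auto
    qed
    have cardO: "card O' = p" by (simp add: O'_def card_image inj)
    have OS: "O' \<subseteq> S" using iter x by (auto simp: O'_def)
    have mem: "(f ^^ i) x \<in> O'" for i
      using modp[OF x(1), of i] p0 by (auto simp: O'_def)
    have shift: "f ((f ^^ i) x) = (f ^^ (Suc i)) x" for i by simp
    \<comment> \<open>Invariance in both directions lets \<open>f\<close> restrict to the complement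
      of the orbit; \<open>f ^^ (p - 1)\<close> serves as the inverse of \<open>f\<close>.\<close>
    have closed: "y \<in> O' \<longleftrightarrow> f y \<in> O'" if "y \<in> S" for y
    proof
      assume "y \<in> O'"
      then obtain i where "y = (f ^^ i) x" by (auto simp: O'_def)
      then show "f y \<in> O'" using mem[of "Suc i"] by simp
    next
      assume "f y \<in> O'"
      then obtain i where i: "f y = (f ^^ i) x" by (auto simp: O'_def)
      have "y = (f ^^ p) y" using less.prems(3) that by simp
      also have "\<dots> = (f ^^ (p - 1)) (f y)" using p0
        by (metis One_nat_def Suc_pred comp_apply funpow_Suc_right)
      also have "\<dots> = (f ^^ (p - 1 + i)) x" using i by (simp only: funpow_add comp_apply)
      finally show "y \<in> O'" using mem by simp
    qed
    have nofix: "f y \<noteq> y" if yO: "y \<in> O'" for y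
    proof
      assume fy: "f y = y"
      obtain i where i: "y = (f ^^ i) x" "i < p" using yO by (auto simp: O'_def)
      have fyn: "(f ^^ n) y = y" for n by (induction n) (simp_all add: fy)
      have "x = (f ^^ (p - i + i)) x" using i(2) less.prems(3)[OF x(1)] by simp
      also have "\<dots> = (f ^^ (p - i)) y" by (simp only: i(1) funpow_add comp_apply)
      also have "\<dots> = y" by (rule fyn)
      finally have "x = y" .
      then show False using fy x(2) by metis
    qed
    have fO: "finite O'" by (simp add: O'_def)
    have c1: "card (S - O') = card S - p" using cardO OS fO by (simp add: card_Diff_subset)
    have ple: "p \<le> card S" using cardO card_mono[OF less.prems(1) OS] by simp
    have "[card (S - O') = card {x \<in> S - O'. f x = x}] (mod p)"
    proof (rule less.hyps)
      show "card (S - O') < card S" using c1 ple p0 by linarith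
    qed (use less.prems closed in auto)
    moreover have "{x \<in> S - O'. f x = x} = {x \<in> S. f x = x}" using nofix by auto
    moreover have "[card S = card (S - O')] (mod p)"
      using c1 ple by (simp add: cong_def le_mod_geq)
    ultimately show ?thesis by (metis cong_trans)
  qed
qed

text \<open>Commuting maps preserve each other's fixed points, so the congruence can be iterated
  over \<open>L\<close>. This is the fixed point congruence for elementary abelian
  \<open>p\<close>-groups, phrased for a family of maps because the index set of the later
  application has exponent \<open>p\<close> only modulo a subgroup that acts trivially.\<close>

lemma common_fixed_points_prime_power_maps:
  fixes f :: "'c \<Rightarrow> 'b \<Rightarrow> 'b" and p :: nat
  assumes p: "prime p" and "finite S" and "finite L"
    and "\<And>l. l \<in> L \<Longrightarrow> f l \<in> S \<rightarrow> S" and "\<And>l x. \<lbrakk>l \<in> L; x \<in> S\<rbrakk> \<Longrightarrow> (f l ^^ p) x = x"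
    and "\<And>l m x. \<lbrakk>l \<in> L; m \<in> L; x \<in> S\<rbrakk> \<Longrightarrow> f l (f m x) = f m (f l x)"
  shows "[card S = card {x \<in> S. \<forall>l\<in>L. f l x = x}] (mod p)"
  using assms(3-)
proof (induction L)
  case empty
  then show ?case by simp
next
  case (insert l L)
  let ?T = "{x \<in> S. \<forall>l\<in>L. f l x = x}"
  have "[card S = card ?T] (mod p)" using insert by auto
  also have "[card ?T = card {x \<in> ?T. f l x = x}] (mod p)"
  proof (rule fixed_points_prime_power_map[OF p])
    show "finite ?T" using \<open>finite S\<close> by simp
    show "f l \<in> ?T \<rightarrow> ?T"
    proof
      fix x assume x: "x \<in> ?T"
      have "f m (f l x) = f l x" if "m \<in> L" for m
        using insert.prems(3)[of m l x] x that by auto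
      moreover have "f l x \<in> S" using insert.prems(1)[of l] x by auto
      ultimately show "f l x \<in> ?T" by auto
    qed
    show "(f l ^^ p) x = x" if "x \<in> ?T" for x using insert.prems(2) that by auto
  qed
  also have "{x \<in> ?T. f l x = x} = {x \<in> S. \<forall>l'\<in>insert l L. f l' x = x}" by auto
  finally show ?case .
qed

section \<open>Irreducible modules\<close>

text \<open>Pointwise laws replace the homomorphism into \<open>AutoGroup V\<close>, so that the
  action can be evaluated by rewriting. \<open>finite_irreducible_moduleI\<close> provides the
  instances.\<close>

locale finite_irreducible_module = G: group G + V: comm_group V
  for G :: "('a, 'm) monoid_scheme" (structure) and V :: "('v, 'n) monoid_scheme"
    and \<phi> :: "'a \<Rightarrow> 'v \<Rightarrow> 'v" +
  assumes finite_G: "finite (carrier G)" and finite_V: "finite (carrier V)"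
    and act_closed [simp]: "\<lbrakk>g \<in> carrier G; v \<in> carrier V\<rbrakk> \<Longrightarrow> \<phi> g v \<in> carrier V"
    and act_add: "\<lbrakk>g \<in> carrier G; v \<in> carrier V; w \<in> carrier V\<rbrakk>
      \<Longrightarrow> \<phi> g (v \<otimes>\<^bsub>V\<^esub> w) = \<phi> g v \<otimes>\<^bsub>V\<^esub> \<phi> g w"
    and act_mult: "\<lbrakk>g \<in> carrier G; h \<in> carrier G; v \<in> carrier V\<rbrakk> \<Longrightarrow> \<phi> (g \<otimes> h) v = \<phi> g (\<phi> h v)"
    and act_one [simp]: "v \<in> carrier V \<Longrightarrow> \<phi> \<one> v = v"
    and nontrivial: "carrier V \<noteq> {\<one>\<^bsub>V\<^esub>}"
    and irreducible: "\<lbrakk>subgroup W V; \<And>g. g \<in> carrier G \<Longrightarrow> \<phi> g ` W \<subseteq> W\<rbrakk>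
      \<Longrightarrow> W = {\<one>\<^bsub>V\<^esub>} \<or> W = carrier V"
begin

abbreviation vadd (infixl "+\<^sub>V" 65) where "u +\<^sub>V v \<equiv> u \<otimes>\<^bsub>V\<^esub> v"
abbreviation vdiff (infixl "-\<^sub>V" 65) where "u -\<^sub>V v \<equiv> u \<otimes>\<^bsub>V\<^esub> inv\<^bsub>V\<^esub> v"
abbreviation vzero ("0\<^sub>V") where "0\<^sub>V \<equiv> \<one>\<^bsub>V\<^esub>"

text \<open>In cohomological terms \<open>Der\<close> is Z^1(G, V), \<open>Inn\<close> is B^1(G, V),
  and \<open>Van N\<close>, for N normal and acting trivially, is Z^1(G / N, V) inflated to G.
  \<open>Comm g\<close> is [V, g], the image of 1 - g, and \<open>Ker\<close> is C_G(V). Derivations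
  are extensional, so that they can be counted.\<close>

definition Fix where "Fix g = {v \<in> carrier V. \<phi> g v = v}"
definition Comm where "Comm g = (\<lambda>v. v -\<^sub>V \<phi> g v) ` carrier V"
definition Ker where "Ker = {g \<in> carrier G. \<forall>v\<in>carrier V. \<phi> g v = v}"
definition Der where "Der = {d \<in> carrier G \<rightarrow>\<^sub>E carrier V.
  \<forall>g\<in>carrier G. \<forall>h\<in>carrier G. d (g \<otimes> h) = d g +\<^sub>V \<phi> g (d h)}"
definition inner where "inner v = (\<lambda>g\<in>carrier G. v -\<^sub>V \<phi> g v)"
definition Inn where "Inn = inner ` carrier V"
definition Van where "Van N = {d \<in> Der. \<forall>x\<in>N. d x = 0\<^sub>V}"

definition dadd where "dadd d e = (\<lambda>g\<in>carrier G. d g +\<^sub>V e g)"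
definition dsub where "dsub d e = (\<lambda>g\<in>carrier G. d g -\<^sub>V e g)"
definition dscale where "dscale \<alpha> d = (\<lambda>g\<in>carrier G. \<alpha> (d g))"

abbreviation F where "F \<equiv> End_G G V \<phi>"
abbreviation q where "q \<equiv> q_mod G V \<phi>"

lemma act_zero [simp]: "g \<in> carrier G \<Longrightarrow> \<phi> g 0\<^sub>V = 0\<^sub>V"
  using act_add[of g "0\<^sub>V" "0\<^sub>V"] V.l_cancel_one[of "\<phi> g 0\<^sub>V" "\<phi> g 0\<^sub>V"] by simp

lemma act_minus: "\<lbrakk>g \<in> carrier G; v \<in> carrier V\<rbrakk> \<Longrightarrow> \<phi> g (inv\<^bsub>V\<^esub> v) = inv\<^bsub>V\<^esub> (\<phi> g v)"
  using act_add[of g "inv\<^bsub>V\<^esub> v" v] by (intro V.inv_equality[symmetric]) auto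

lemma act_inv_act [simp]: "\<lbrakk>g \<in> carrier G; v \<in> carrier V\<rbrakk> \<Longrightarrow> \<phi> (inv g) (\<phi> g v) = v"
  using act_mult[of "inv g" g v] by simp

lemma act_act_inv [simp]: "\<lbrakk>g \<in> carrier G; v \<in> carrier V\<rbrakk> \<Longrightarrow> \<phi> g (\<phi> (inv g) v) = v"
  using act_mult[of g "inv g" v] by simp

lemma vdiff_eq_iff:
  "\<lbrakk>u \<in> carrier V; v \<in> carrier V; w \<in> carrier V\<rbrakk> \<Longrightarrow> u -\<^sub>V v = w \<longleftrightarrow> u = w +\<^sub>V v"
  using V.inv_solve_right' by auto

lemma vdiff_zero_iff: "\<lbrakk>u \<in> carrier V; v \<in> carrier V\<rbrakk> \<Longrightarrow> u -\<^sub>V v = 0\<^sub>V \<longleftrightarrow> u = v"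
  by (simp add: vdiff_eq_iff)

lemma vadd_swap: "\<lbrakk>a \<in> carrier V; b \<in> carrier V; c \<in> carrier V; d \<in> carrier V\<rbrakk>
  \<Longrightarrow> (a +\<^sub>V b) +\<^sub>V (c +\<^sub>V d) = (a +\<^sub>V c) +\<^sub>V (b +\<^sub>V d)"
  by (simp add: V.m_ac)

lemma vdiff_swap: "\<lbrakk>a \<in> carrier V; b \<in> carrier V; c \<in> carrier V; d \<in> carrier V\<rbrakk>
  \<Longrightarrow> (a +\<^sub>V b) -\<^sub>V (c +\<^sub>V d) = (a -\<^sub>V c) +\<^sub>V (b -\<^sub>V d)"
  by (simp add: V.m_ac V.inv_mult)

lemma act_vdiff: "\<lbrakk>g \<in> carrier G; v \<in> carrier V; w \<in> carrier V\<rbrakk>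
  \<Longrightarrow> \<phi> g (v -\<^sub>V w) = \<phi> g v -\<^sub>V \<phi> g w"
  by (simp add: act_add act_minus)

lemma Ker_subset: "Ker \<subseteq> carrier G" by (auto simp: Ker_def)

lemma Ker_act: "\<lbrakk>g \<in> Ker; v \<in> carrier V\<rbrakk> \<Longrightarrow> \<phi> g v = v" by (auto simp: Ker_def)

lemma Ker_normal: "Ker \<lhd> G"
proof -
  have inv_act: "\<phi> (inv g) v = v" if g: "g \<in> Ker" "v \<in> carrier V" for g v
    using act_inv_act[of g v] g Ker_subset by (auto simp: Ker_act)
  have "subgroup Ker G"
  proof (rule G.subgroupI)
    show "Ker \<noteq> {}" using Ker_def by auto
  qed (use inv_act Ker_subset in \<open>auto simp: Ker_def act_mult\<close>)
  moreover have "x \<otimes> h \<otimes> inv x \<in> Ker" if "x \<in> carrier G" "h \<in> Ker" for x h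
    using that by (auto simp: Ker_def act_mult)
  ultimately show ?thesis by (simp add: G.normal_inv_iff)
qed

section \<open>Derivations and inner derivations\<close>

lemma DerD [simp]: "d \<in> Der \<Longrightarrow> g \<in> carrier G \<Longrightarrow> d g \<in> carrier V"
  by (auto simp: Der_def)

lemma Der_mult: "\<lbrakk>d \<in> Der; g \<in> carrier G; h \<in> carrier G\<rbrakk> \<Longrightarrow> d (g \<otimes> h) = d g +\<^sub>V \<phi> g (d h)"
  by (auto simp: Der_def)

lemma Der_ext: "\<lbrakk>d \<in> Der; e \<in> Der; \<And>g. g \<in> carrier G \<Longrightarrow> d g = e g\<rbrakk> \<Longrightarrow> d = e"
  unfolding Der_def by (auto intro: PiE_ext)

lemma DerI: "\<lbrakk>d \<in> extensional (carrier G); \<And>g. g \<in> carrier G \<Longrightarrow> d g \<in> carrier V;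
    \<And>g h. \<lbrakk>g \<in> carrier G; h \<in> carrier G\<rbrakk> \<Longrightarrow> d (g \<otimes> h) = d g +\<^sub>V \<phi> g (d h)\<rbrakk> \<Longrightarrow> d \<in> Der"
  unfolding Der_def PiE_def by (intro CollectI conjI ballI IntI Pi_I)

lemma finite_Der: "finite Der"
  by (rule finite_subset[of _ "carrier G \<rightarrow>\<^sub>E carrier V"])
    (auto simp: Der_def intro: finite_PiE finite_G finite_V)

lemma Der_one [simp]: "d \<in> Der \<Longrightarrow> d \<one> = 0\<^sub>V"
  using Der_mult[of d \<one> \<one>] V.l_cancel_one[of "d \<one>" "d \<one>"] by simp

lemma Der_inv: "\<lbrakk>d \<in> Der; g \<in> carrier G\<rbrakk> \<Longrightarrow> d (inv g) = inv\<^bsub>V\<^esub> (\<phi> (inv g) (d g))"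
  using Der_mult[of d "inv g" g] by (intro V.inv_equality[symmetric]) auto

lemma Der_mult_inv: "\<lbrakk>d \<in> Der; g \<in> carrier G; h \<in> carrier G\<rbrakk>
  \<Longrightarrow> d (g \<otimes> h \<otimes> inv g) = d g +\<^sub>V \<phi> g (d h) -\<^sub>V \<phi> (g \<otimes> h \<otimes> inv g) (d g)"
  by (simp add: Der_mult Der_inv act_mult act_minus)

text \<open>\<open>Ker\<close> acts trivially, so a derivation restricts there to a homomorphism;
  this identity makes the restriction compatible with conjugation by G, which is how chief factors
  below \<open>Ker\<close> get compared with V.\<close>

lemma Der_conj_Ker: 
  assumes "d \<in> Der" "g \<in> carrier G" "c \<in> Ker"
  shows "d (g \<otimes> c \<otimes> inv g) = \<phi> g (d c)"
proof -
  have c: "c \<in> carrier G" using assms Ker_subset by auto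
  have "g \<otimes> c \<otimes> inv g \<in> Ker" using Ker_normal assms by (simp add: G.normal_inv_iff)
  then show ?thesis using assms c by (simp add: Der_mult_inv Ker_act vdiff_eq_iff) (simp add: V.m_comm)
qed

text \<open>Vanishing of the right-hand side reads d g = d x - g (d x): a derivation that is zero at
  some conjugate of \<open>g\<close> takes a value in [V, g] at \<open>g\<close>.\<close>

lemma Der_conj:
  assumes "d \<in> Der" "g \<in> carrier G" "x \<in> carrier G"
  shows "d (inv x \<otimes> g \<otimes> x) = \<phi> (inv x) (d g +\<^sub>V \<phi> g (d x) -\<^sub>V d x)"
  using assms by (simp add: Der_mult Der_inv act_mult act_add act_minus V.m_ac)

lemma vdiff_telescope:
  assumes "a \<in> carrier V" "b \<in> carrier V" "c \<in> carrier V"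
  shows "(a -\<^sub>V b) +\<^sub>V (b -\<^sub>V c) = a -\<^sub>V c"
proof -
  have "(a -\<^sub>V b) +\<^sub>V (b -\<^sub>V c) = a +\<^sub>V ((inv\<^bsub>V\<^esub> b +\<^sub>V b) -\<^sub>V c)"
    using assms by (simp only: V.m_assoc V.inv_closed V.m_closed)
  then show ?thesis using assms by simp
qed

lemma inner_Der: "v \<in> carrier V \<Longrightarrow> inner v \<in> Der"
  by (rule DerI) (auto simp: inner_def act_mult act_vdiff vdiff_telescope)

lemma Inn_subset: "Inn \<subseteq> Der" using inner_Der by (auto simp: Inn_def)

lemma Inn_Ker: "\<lbrakk>b \<in> Inn; c \<in> Ker\<rbrakk> \<Longrightarrow> b c = 0\<^sub>V"
  using Ker_subset by (auto simp: Inn_def inner_def Ker_act)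

lemma Inn_Comm: "\<lbrakk>b \<in> Inn; g \<in> carrier G\<rbrakk> \<Longrightarrow> b g \<in> Comm g"
  by (auto simp: Inn_def inner_def Comm_def)

lemma zero_Inn: "(\<lambda>g\<in>carrier G. 0\<^sub>V) \<in> Inn"
  unfolding Inn_def by (rule image_eqI[of _ _ "0\<^sub>V"]) (auto simp: inner_def)

lemma card_Inn_pos: "card Inn > 0"
  using zero_Inn finite_V by (auto simp: card_gt_0_iff Inn_def)

lemma dadd_Der: "\<lbrakk>d \<in> Der; e \<in> Der\<rbrakk> \<Longrightarrow> dadd d e \<in> Der"
  by (rule DerI) (auto simp: dadd_def Der_mult act_add vadd_swap)

lemma dsub_Der: "\<lbrakk>d \<in> Der; e \<in> Der\<rbrakk> \<Longrightarrow> dsub d e \<in> Der"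
  by (rule DerI) (auto simp: dsub_def Der_mult act_vdiff vdiff_swap)

lemma dsub_inner: "\<lbrakk>v \<in> carrier V; w \<in> carrier V\<rbrakk> \<Longrightarrow> dsub (inner v) (inner w) = inner (v -\<^sub>V w)"
  by (auto simp: dsub_def inner_def act_vdiff V.inv_mult V.m_ac)

lemma dsub_Inn: "\<lbrakk>d \<in> Inn; e \<in> Inn\<rbrakk> \<Longrightarrow> dsub d e \<in> Inn"
  by (auto simp: Inn_def dsub_inner)

lemma dadd_dsub: "\<lbrakk>d \<in> Der; e \<in> Der\<rbrakk> \<Longrightarrow> dadd (dsub d e) e = d"
  by (rule Der_ext) (auto simp: dadd_Der dsub_Der, auto simp: dadd_def dsub_def V.m_assoc)

lemma dsub_dadd: "\<lbrakk>d \<in> Der; e \<in> Der\<rbrakk> \<Longrightarrow> dsub (dadd d e) e = d"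
  by (rule Der_ext) (auto simp: dadd_Der dsub_Der, auto simp: dadd_def dsub_def V.m_assoc)

lemma dsub_inj: "e \<in> Der \<Longrightarrow> inj_on (\<lambda>d. dsub d e) Der"
  by (rule inj_on_inverseI[of _ "\<lambda>d. dadd d e"]) (simp add: dadd_dsub)

section \<open>Schur's lemma\<close>

lemma End_hom: "\<alpha> \<in> F \<Longrightarrow> group_hom V V \<alpha>"
  by (intro group_hom.intro group_hom_axioms.intro V.is_group) (auto simp: End_G_def)

lemma End_closed [simp]: "\<lbrakk>\<alpha> \<in> F; v \<in> carrier V\<rbrakk> \<Longrightarrow> \<alpha> v \<in> carrier V"
  unfolding End_G_def hom_def by blast

lemma End_add: "\<lbrakk>\<alpha> \<in> F; v \<in> carrier V; w \<in> carrier V\<rbrakk> \<Longrightarrow> \<alpha> (v +\<^sub>V w) = \<alpha> v +\<^sub>V \<alpha> w"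
  unfolding End_G_def hom_def by blast

lemma End_act: "\<lbrakk>\<alpha> \<in> F; g \<in> carrier G; v \<in> carrier V\<rbrakk> \<Longrightarrow> \<alpha> (\<phi> g v) = \<phi> g (\<alpha> v)"
  unfolding End_G_def by blast

lemma EndI:
  assumes "\<alpha> \<in> extensional (carrier V)" and cl: "\<And>v. v \<in> carrier V \<Longrightarrow> \<alpha> v \<in> carrier V"
    and add: "\<And>v w. \<lbrakk>v \<in> carrier V; w \<in> carrier V\<rbrakk> \<Longrightarrow> \<alpha> (v +\<^sub>V w) = \<alpha> v +\<^sub>V \<alpha> w"
    and act: "\<And>g v. \<lbrakk>g \<in> carrier G; v \<in> carrier V\<rbrakk> \<Longrightarrow> \<alpha> (\<phi> g v) = \<phi> g (\<alpha> v)"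
  shows "\<alpha> \<in> F"
proof -
  have "\<alpha> \<in> hom V V" by (rule homI) (fact cl add)+
  then show ?thesis unfolding End_G_def using assms(1) act by blast
qed

lemma End_zero [simp]: "\<alpha> \<in> F \<Longrightarrow> \<alpha> 0\<^sub>V = 0\<^sub>V"
  using group_hom.hom_one[OF End_hom] by auto

lemma End_minus: "\<lbrakk>\<alpha> \<in> F; v \<in> carrier V\<rbrakk> \<Longrightarrow> \<alpha> (inv\<^bsub>V\<^esub> v) = inv\<^bsub>V\<^esub> (\<alpha> v)"
  using group_hom.hom_inv[OF End_hom] by auto

lemma End_ext: "\<lbrakk>\<alpha> \<in> F; \<beta> \<in> F; \<And>v. v \<in> carrier V \<Longrightarrow> \<alpha> v = \<beta> v\<rbrakk> \<Longrightarrow> \<alpha> = \<beta>"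
  by (auto simp: End_G_def intro: extensionalityI)

lemma finite_F: "finite F"
proof -
  have "F \<subseteq> carrier V \<rightarrow>\<^sub>E carrier V" unfolding End_G_def hom_def PiE_def by blast
  then show ?thesis using finite_PiE[OF finite_V, of "\<lambda>_. carrier V"] finite_V finite_subset by blast
qed

lemma End_diff: "\<lbrakk>\<alpha> \<in> F; \<beta> \<in> F\<rbrakk> \<Longrightarrow> (\<lambda>v\<in>carrier V. \<alpha> v -\<^sub>V \<beta> v) \<in> F"
  by (rule EndI) (auto simp: End_add End_act vdiff_swap act_vdiff)

lemma zero_End: "(\<lambda>v\<in>carrier V. 0\<^sub>V) \<in> F" by (rule EndI) auto

lemma id_End: "(\<lambda>v\<in>carrier V. v) \<in> F" by (rule EndI) auto

lemma two_le_q: "q \<ge> 2"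
proof -
  obtain v where v: "v \<in> carrier V" "v \<noteq> 0\<^sub>V" using nontrivial by auto
  then have "(\<lambda>v\<in>carrier V. 0\<^sub>V) \<noteq> (\<lambda>v\<in>carrier V. v)" by (metis restrict_apply')
  then have "card {(\<lambda>v\<in>carrier V. 0\<^sub>V), (\<lambda>v\<in>carrier V. v)} = 2" by simp
  moreover have "{(\<lambda>v\<in>carrier V. 0\<^sub>V), (\<lambda>v\<in>carrier V. v)} \<subseteq> F" using zero_End id_End by blast
  ultimately show ?thesis using card_mono[OF finite_F] unfolding q_mod_def by metis
qed

text \<open>The kernel of an endomorphism is a submodule; containing a nonzero vector, it is all of
  V.\<close>

lemma End_eq_zero:
  assumes "\<alpha> \<in> F" "v \<in> carrier V" "v \<noteq> 0\<^sub>V" "\<alpha> v = 0\<^sub>V" "w \<in> carrier V"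
  shows "\<alpha> w = 0\<^sub>V"
proof -
  define W where "W = {v \<in> carrier V. \<alpha> v = 0\<^sub>V}"
  have "subgroup W V" by (rule V.subgroupI) (use assms in \<open>auto simp: W_def End_add End_minus\<close>)
  moreover have "\<phi> g ` W \<subseteq> W" if "g \<in> carrier G" for g
    using that assms by (auto simp: W_def End_act)
  ultimately have "W = carrier V" using irreducible[of W] assms by (auto simp: W_def)
  then show ?thesis using assms by (auto simp: W_def)
qed

text \<open>Evaluation at one nonzero vector separates the elements of \<open>F\<close>. This counts
  scalar multiples in \<open>card_vanishing_multiples\<close> and underlies
  \<open>q_le_card_subspace\<close>.\<close>

lemma End_inj:
  assumes "\<alpha> \<in> F" "\<beta> \<in> F" "v \<in> carrier V" "v \<noteq> 0\<^sub>V" "\<alpha> v = \<beta> v"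
  shows "\<alpha> = \<beta>"
proof (rule End_ext[OF assms(1,2)])
  fix w assume w: "w \<in> carrier V"
  have "(\<lambda>v\<in>carrier V. \<alpha> v -\<^sub>V \<beta> v) w = 0\<^sub>V"
    by (rule End_eq_zero[OF End_diff]) (use assms w in auto)
  then show "\<alpha> w = \<beta> w" using w assms by (simp add: vdiff_zero_iff)
qed

text \<open>Injectivity by Schur's lemma gives surjectivity because V is finite; the inverse
  commutes with the action because the endomorphism does.\<close>

lemma End_inverse:
  assumes "\<alpha> \<in> F" "v \<in> carrier V" "\<alpha> v \<noteq> 0\<^sub>V"
  obtains \<beta> where "\<beta> \<in> F" "\<And>w. w \<in> carrier V \<Longrightarrow> \<beta> (\<alpha> w) = w"
proof -
  have "inj_on \<alpha> (carrier V)"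
  proof (rule group_hom.inj_iff_trivial_ker[OF End_hom, THEN iffD2])
    show "kernel V V \<alpha> = {0\<^sub>V}"
      using End_eq_zero[OF assms(1) _ _ _ assms(2)] assms by (auto simp: kernel_def)
  qed (use assms in auto)
  moreover from this have "\<alpha> ` carrier V = carrier V"
    by (rule endo_inj_surj[OF finite_V, rotated]) (use assms in auto)
  ultimately have bij: "bij_betw \<alpha> (carrier V) (carrier V)" by (auto simp: bij_betw_def)
  define \<beta> where "\<beta> = (\<lambda>v\<in>carrier V. inv_into (carrier V) \<alpha> v)"
  have b: "\<beta> (\<alpha> w) = w" if "w \<in> carrier V" for w
    using bij that assms by (simp add: \<beta>_def bij_betw_inv_into_left)
  have "\<beta> \<in> F"
  proof (rule EndI)
    have sur: "\<exists>w\<in>carrier V. v = \<alpha> w" if "v \<in> carrier V" for v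
      using that bij by (auto simp: bij_betw_def)
    show "\<beta> v \<in> carrier V" if "v \<in> carrier V" for v using sur[OF that] b by auto
    show "\<beta> (v +\<^sub>V w) = \<beta> v +\<^sub>V \<beta> w" if v: "v \<in> carrier V" "w \<in> carrier V" for v w
    proof -
      obtain v' w' where "v' \<in> carrier V" "w' \<in> carrier V" "v = \<alpha> v'" "w = \<alpha> w'" using sur v by metis
      then show ?thesis using b b[of "v' +\<^sub>V w'"] End_add[OF assms(1)] by auto
    qed
    show "\<beta> (\<phi> g v) = \<phi> g (\<beta> v)" if v: "g \<in> carrier G" "v \<in> carrier V" for g v
    proof -
      obtain v' where "v' \<in> carrier V" "v = \<alpha> v'" using sur v by metis
      then show ?thesis using b b[of "\<phi> g v'"] End_act[OF assms(1)] v by auto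
    qed
  qed (simp add: \<beta>_def)
  then show ?thesis using b that by blast
qed

lemma dscale_Der: "\<lbrakk>\<alpha> \<in> F; d \<in> Der\<rbrakk> \<Longrightarrow> dscale \<alpha> d \<in> Der"
  by (rule DerI) (auto simp: dscale_def Der_mult End_add End_act)

lemma dscale_inner: "\<lbrakk>\<alpha> \<in> F; v \<in> carrier V\<rbrakk> \<Longrightarrow> dscale \<alpha> (inner v) = inner (\<alpha> v)"
  by (auto simp: dscale_def inner_def End_add End_act End_minus)

lemma dscale_Inn: "\<lbrakk>\<alpha> \<in> F; b \<in> Inn\<rbrakk> \<Longrightarrow> dscale \<alpha> b \<in> Inn"
  by (auto simp: Inn_def dscale_inner)

end

lemma finite_irreducible_moduleI:
  fixes G :: "('a, 'm) monoid_scheme" and V :: "('v, 'n) monoid_scheme"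
  assumes "group G" "finite (carrier G)" "finite (carrier V)" "irreducible_G_module G V \<phi>"
  shows "finite_irreducible_module G V \<phi>"
proof -
  have 1: "comm_group V" "group_hom G (AutoGroup V) \<phi>" "carrier V \<noteq> {\<one>\<^bsub>V\<^esub>}"
    and irr: "\<And>W. \<lbrakk>subgroup W V; \<And>g. g \<in> carrier G \<Longrightarrow> \<phi> g ` W \<subseteq> W\<rbrakk> \<Longrightarrow> W = {\<one>\<^bsub>V\<^esub>} \<or> W = carrier V"
    using assms(4) by (auto simp: irreducible_G_module_def G_module_def)
  interpret V: comm_group V by fact
  interpret h: group_hom G "AutoGroup V" \<phi> by fact
  have aut: "\<phi> g \<in> auto V" if "g \<in> carrier G" for g
    using h.hom_closed[OF that] by (simp add: AutoGroup_def)
  have Bij: "\<phi> g \<in> Bij (carrier V)" "\<phi> g \<in> hom V V" if "g \<in> carrier G" for g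
    using aut[OF that] by (auto simp: auto_def)
  have cl: "\<phi> g v \<in> carrier V" if "g \<in> carrier G" "v \<in> carrier V" for g v
    using Bij(2)[OF that(1)] that(2) by (auto simp: hom_def)
  have m: "\<phi> (g \<otimes>\<^bsub>G\<^esub> h) v = \<phi> g (\<phi> h v)" if "g \<in> carrier G" "h \<in> carrier G" "v \<in> carrier V" for g h v
    using h.hom_mult[OF that(1,2)] that Bij[OF that(1)] Bij[OF that(2)]
    by (simp add: AutoGroup_def BijGroup_def compose_eq)
  have o: "\<phi> \<one>\<^bsub>G\<^esub> v = v" if "v \<in> carrier V" for v
    using h.hom_one that by (simp add: AutoGroup_def BijGroup_def)
  have a: "\<phi> g (v \<otimes>\<^bsub>V\<^esub> w) = \<phi> g v \<otimes>\<^bsub>V\<^esub> \<phi> g w" if "g \<in> carrier G" "v \<in> carrier V" "w \<in> carrier V" for g v w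
    using Bij(2)[OF that(1)] that by (auto simp: hom_def)
  show ?thesis
    by (intro finite_irreducible_module.intro finite_irreducible_module_axioms.intro)
      (fact assms 1 cl m o a irr)+
qed

section \<open>Sections\<close>

text \<open>L / N is abelian; commutators keep the statement at the level of elements, where
  derivations are evaluated.\<close>

definition abelian_section where
  "abelian_section G L N \<longleftrightarrow> (\<forall>x\<in>L. \<forall>y\<in>L. x \<otimes>\<^bsub>G\<^esub> y \<otimes>\<^bsub>G\<^esub> inv\<^bsub>G\<^esub> x \<otimes>\<^bsub>G\<^esub> inv\<^bsub>G\<^esub> y \<in> N)"

lemma (in group) carrier_section_group: "carrier (section_group G L N) = (\<lambda>x. N #> x) ` L"
  by (simp add: carrier_FactGroup)

lemma (in group) section_action_coset:
  assumes "N \<lhd> G" "L \<subseteq> carrier G" "g \<in> carrier G" "x \<in> L"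
  shows "section_action G L N g (N #> x) = N #> (g \<otimes> x \<otimes> inv g)"
proof -
  interpret N: normal N G by fact
  have x: "x \<in> carrier G" using assms by auto
  have "(\<lambda>y. g \<otimes> y \<otimes> inv g) ` (N #> x) = N #> (g \<otimes> x \<otimes> inv g)"
  proof (intro equalityI subsetI)
    fix z assume "z \<in> (\<lambda>y. g \<otimes> y \<otimes> inv g) ` (N #> x)"
    then obtain n where n: "n \<in> N" "z = g \<otimes> (n \<otimes> x) \<otimes> inv g" by (auto simp: r_coset_def)
    have "z = (g \<otimes> n \<otimes> inv g) \<otimes> (g \<otimes> x \<otimes> inv g)"
      using n assms x N.mem_carrier by (simp add: m_assoc inv_solve_left)
    moreover have "g \<otimes> n \<otimes> inv g \<in> N" using n assms N.inv_op_closed2 by blast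
    ultimately show "z \<in> N #> (g \<otimes> x \<otimes> inv g)" by (auto simp: r_coset_def)
  next
    fix z assume "z \<in> N #> (g \<otimes> x \<otimes> inv g)"
    then obtain n where n: "n \<in> N" "z = n \<otimes> (g \<otimes> x \<otimes> inv g)" by (auto simp: r_coset_def)
    have "z = g \<otimes> ((inv g \<otimes> n \<otimes> g) \<otimes> x) \<otimes> inv g"
      using n assms x N.mem_carrier by (simp add: m_assoc[symmetric])
    moreover have "inv g \<otimes> n \<otimes> g \<in> N" using n assms N.inv_op_closed1 by blast
    ultimately show "z \<in> (\<lambda>y. g \<otimes> y \<otimes> inv g) ` (N #> x)" by (auto simp: r_coset_def)
  qed
  then show ?thesis using assms by (simp add: section_action_def carrier_section_group)
qed

lemma (in group) normal_conj: "\<lbrakk>N \<lhd> G; g \<in> carrier G; x \<in> N\<rbrakk> \<Longrightarrow> g \<otimes> x \<otimes> inv g \<in> N"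
  by (simp add: normal_inv_iff)

lemma (in group) section_action_closed:
  assumes "N \<lhd> G" "L \<lhd> G" "g \<in> carrier G" "X \<in> carrier (section_group G L N)"
  shows "section_action G L N g X \<in> carrier (section_group G L N)"
proof -
  have L: "L \<subseteq> carrier G" using assms(2) normal_imp_subgroup subgroup.subset by blast
  obtain x where "x \<in> L" "X = N #> x" using assms(4) by (auto simp: carrier_section_group)
  then show ?thesis using section_action_coset[OF assms(1) L assms(3)] normal_conj[OF assms(2,3)]
    by (simp add: carrier_section_group)
qed

lemma G_isomorphic_sym:
  assumes "G_isomorphic G V \<phi> W \<psi>" "group V"
    and "\<And>g v. \<lbrakk>g \<in> carrier G; v \<in> carrier V\<rbrakk> \<Longrightarrow> \<phi> g v \<in> carrier V"
  shows "G_isomorphic G W \<psi> V \<phi>"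
proof -
  interpret V: group V by fact
  obtain f where f: "f \<in> iso V W" "\<And>g v. \<lbrakk>g \<in> carrier G; v \<in> carrier V\<rbrakk> \<Longrightarrow> f (\<phi> g v) = \<psi> g (f v)"
    using assms(1) unfolding G_isomorphic_def by blast
  let ?h = "inv_into (carrier V) f"
  have bij: "bij_betw f (carrier V) (carrier W)" using f(1) by (simp add: iso_def)
  have "?h (\<psi> g w) = \<phi> g (?h w)" if g: "g \<in> carrier G" and w: "w \<in> carrier W" for g w
  proof -
    have h: "?h w \<in> carrier V" "f (?h w) = w" using bij w
      by (auto simp: bij_betw_def inv_into_into f_inv_into_f)
    then have "\<psi> g w = f (\<phi> g (?h w))" using f(2)[OF g h(1)] by simp
    then show ?thesis using bij assms(3)[OF g h(1)] by (simp add: bij_betw_inv_into_left)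
  qed
  then show ?thesis using V.iso_set_sym[OF f(1)] unfolding G_isomorphic_def by blast
qed

lemma G_isomorphic_trans:
  assumes "G_isomorphic G U \<phi> V \<psi>" "G_isomorphic G V \<psi> W \<eta>"
  shows "G_isomorphic G U \<phi> W \<eta>"
proof -
  obtain f where f: "f \<in> iso U V" "\<forall>g\<in>carrier G. \<forall>v\<in>carrier U. f (\<phi> g v) = \<psi> g (f v)"
    using assms(1) unfolding G_isomorphic_def by blast
  obtain h where h: "h \<in> iso V W" "\<forall>g\<in>carrier G. \<forall>v\<in>carrier V. h (\<psi> g v) = \<eta> g (h v)"
    using assms(2) unfolding G_isomorphic_def by blast
  have "f v \<in> carrier V" if "v \<in> carrier U" for v using f(1) that by (auto simp: iso_def hom_def)
  then show ?thesis unfolding G_isomorphic_def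
    using iso_set_trans[OF f(1) h(1)] f(2) h(2) by (intro bexI[of _ "h \<circ> f"]) auto
qed

lemma chief_factorD:
  assumes "chief_factor G L N"
  shows "L \<lhd> G" "N \<lhd> G" "N \<subseteq> L" "N \<noteq> L" "\<And>K. \<lbrakk>K \<lhd> G; N \<subseteq> K; K \<subseteq> L\<rbrakk> \<Longrightarrow> K = N \<or> K = L"
  using assms unfolding chief_factor_def by auto

lemma (in group) subgroup_nat_pow_closed: "\<lbrakk>subgroup H G; x \<in> H\<rbrakk> \<Longrightarrow> x [^] (n::nat) \<in> H"
  by (induction n) (auto simp: subgroup.one_closed subgroup.m_closed)

lemma (in group) conj_nat_pow:
  "\<lbrakk>g \<in> carrier G; x \<in> carrier G\<rbrakk> \<Longrightarrow> (g \<otimes> x \<otimes> inv g) [^] (n::nat) = g \<otimes> x [^] n \<otimes> inv g"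
proof (induction n)
  case (Suc n)
  then have "(g \<otimes> x [^] n \<otimes> inv g) \<otimes> (g \<otimes> x \<otimes> inv g) = g \<otimes> (x [^] n \<otimes> x) \<otimes> inv g"
    by (simp add: m_assoc inv_solve_left) (simp add: m_assoc[symmetric])
  then show ?case using Suc by simp
qed simp

text \<open>Since L / N is abelian, the elements of L with p-th power in N form a normal subgroup of
  G between N and L. It is larger than N as soon as \<open>p\<close> is the order of some element of
  L / N, and then chiefness makes it all of L.\<close>

lemma (in group) abelian_chief_factor_exponent:
  assumes fin: "finite (carrier G)" and ch: "chief_factor G L N" and ab: "abelian_section G L N"
  obtains p :: nat where "prime p" "\<And>l. l \<in> L \<Longrightarrow> l [^] p \<in> N"
proof -
  note ch = chief_factorD[OF ch]
  interpret N: normal N G by fact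
  have L: "subgroup L G" using ch normal_imp_subgroup by blast
  then have Lc: "L \<subseteq> carrier G" by (rule subgroup.subset)
  interpret h: group_hom G "G Mod N" "\<lambda>x. N #> x"
    by (intro group_hom.intro group_hom_axioms.intro N.r_coset_hom_Mod is_group N.factorgroup_is_group)
  have mem: "N #> x = N \<longleftrightarrow> x \<in> N" if "x \<in> carrier G" for x
    using that coset_join1[of N x] coset_join2[of x N] N.is_subgroup N.subset by blast
  have pow: "x [^] n \<in> N \<longleftrightarrow> (N #> x) [^]\<^bsub>G Mod N\<^esub> n = \<one>\<^bsub>G Mod N\<^esub>" if "x \<in> carrier G" for x and n :: nat
    using h.hom_nat_pow[OF that, of n] mem[of "x [^] n"] that by simp
  obtain l0 where l0: "l0 \<in> L" "l0 \<notin> N" using ch by auto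
  have l0c: "l0 \<in> carrier G" using l0 Lc by auto
  \<comment> \<open>\<open>m\<close> is the order of \<open>l0\<close> modulo N, and the power
    \<open>l1\<close> below has order \<open>p\<close> modulo N.\<close>
  define m where "m = (LEAST m::nat. m > 0 \<and> l0 [^] m \<in> N)"
  have ex: "Coset.order G > 0 \<and> l0 [^] Coset.order G \<in> N"
    using fin l0c pow_order_eq_1[OF l0c] order_gt_0_iff_finite N.one_closed by simp
  have m: "m > 0" "l0 [^] m \<in> N" using LeastI[of "\<lambda>m. m > 0 \<and> l0 [^] m \<in> N", OF ex] by (auto simp: m_def)
  have least: "l0 [^] k \<notin> N" if "0 < k" "k < m" for k
    using not_less_Least[of k "\<lambda>m. m > 0 \<and> l0 [^] m \<in> N"] that by (auto simp: m_def)
  have "m \<noteq> 1" using m l0 l0c by auto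
  then obtain p where p: "prime p" "p dvd m" using prime_factor_nat by blast
  have pm: "0 < m div p" "m div p < m" "m div p * p = m"
    using p m prime_gt_1_nat[OF p(1)] by (auto simp: dvd_imp_le div_greater_zero_iff)
  define l1 where "l1 = l0 [^] (m div p)"
  have l1: "l1 \<in> L" "l1 \<notin> N" "l1 [^] p \<in> N" "l1 \<in> carrier G"
    using least[OF pm(1,2)] pm(3) m(2) l0c nat_pow_pow[OF l0c, of "m div p" p]
      subgroup_nat_pow_closed[OF L l0(1)]
    by (auto simp: l1_def)
  define T where "T = {l \<in> L. l [^] p \<in> N}"
  have comm: "(N #> x) \<otimes>\<^bsub>G Mod N\<^esub> (N #> y) = (N #> y) \<otimes>\<^bsub>G Mod N\<^esub> (N #> x)" if xy: "x \<in> L" "y \<in> L" for x y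
  proof -
    have c: "x \<in> carrier G" "y \<in> carrier G" using xy Lc by auto
    have "x \<otimes> y \<otimes> inv (y \<otimes> x) \<in> N" using ab xy c by (simp add: abelian_section_def inv_mult_group m_assoc[symmetric])
    then have "N #> (x \<otimes> y) = N #> (y \<otimes> x)" using c
      by (metis N.is_subgroup inv_closed m_closed N.rcos_module_rev repr_independence is_group)
    then show ?thesis using h.hom_mult[OF c] h.hom_mult[OF c(2,1)] by simp
  qed
  have "T \<lhd> G" unfolding normal_inv_iff
  proof (intro conjI ballI)
    show "subgroup T G"
    proof (rule subgroupI)
      show "T \<subseteq> carrier G" using Lc by (auto simp: T_def)
      show "T \<noteq> {}" using l1 by (auto simp: T_def)
      fix a assume a: "a \<in> T"
      then have ac: "a \<in> carrier G" using Lc by (auto simp: T_def)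
      show "inv a \<in> T" using a ac L by (auto simp: T_def nat_pow_inv subgroup.m_inv_closed)
      fix b assume b: "b \<in> T"
      then have bc: "b \<in> carrier G" using Lc by (auto simp: T_def)
      have "(N #> (a \<otimes> b)) [^]\<^bsub>G Mod N\<^esub> p = \<one>\<^bsub>G Mod N\<^esub>"
        using h.H.pow_mult_distrib[OF comm[of a b], of p] a b ac bc h.hom_mult[OF ac bc]
          pow[OF ac, of p] pow[OF bc, of p] subgroup_mult_id[OF N.is_subgroup]
        by (auto simp: T_def)
      then show "a \<otimes> b \<in> T" using a b ac bc pow[of "a \<otimes> b" p] L by (auto simp: T_def subgroup.m_closed)
    qed
    fix x h assume "x \<in> carrier G" "h \<in> T"
    then show "x \<otimes> h \<otimes> inv x \<in> T" using Lc normal_conj[OF ch(1)] normal_conj[OF ch(2)]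
      by (auto simp: T_def conj_nat_pow subsetD)
  qed
  moreover have "N \<subseteq> T" using ch(3) N.is_subgroup
    by (auto simp: T_def subgroup_nat_pow_closed)
  moreover have "T \<subseteq> L" by (auto simp: T_def)
  ultimately have "T = L" using ch(5)[of T] l1 by (auto simp: T_def)
  then show ?thesis using that[OF p(1)] by (auto simp: T_def)
qed

section \<open>Derivations along a chief series\<close>

context finite_irreducible_module
begin

lemma Van_Der: "d \<in> Van N \<Longrightarrow> d \<in> Der" by (simp add: Van_def)

lemma Van_zero: "\<lbrakk>d \<in> Van N; x \<in> N\<rbrakk> \<Longrightarrow> d x = 0\<^sub>V" by (simp add: Van_def)

text \<open>On a normal subgroup inside \<open>Ker\<close> a derivation is a homomorphism compatible
  with conjugation, so its image is a submodule. Applied both to single chief factors and to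
  \<open>Ker\<close> itself.\<close>

lemma Der_surj_on:
  assumes L: "L \<lhd> G" "L \<subseteq> Ker" and d: "d \<in> Der" "d \<notin> Van L"
  shows "d ` L = carrier V"
proof -
  interpret L: normal L G by fact
  have Lc: "x \<in> carrier G" if "x \<in> L" for x using that L.mem_carrier by blast
  have "subgroup (d ` L) V"
  proof (rule V.subgroupI)
    show "d ` L \<subseteq> carrier V" using d Lc by auto
    show "d ` L \<noteq> {}" using subgroup.one_closed[OF L.is_subgroup] by blast
    show "inv\<^bsub>V\<^esub> a \<in> d ` L" if a: "a \<in> d ` L" for a
    proof -
      obtain x where x: "x \<in> L" "a = d x" using a by blast
      then have "inv\<^bsub>V\<^esub> a = d (inv x)"
        using d(1) Lc subsetD[OF L(2) L.m_inv_closed[OF x(1)]] by (simp add: Der_inv Ker_act)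
      then show ?thesis using x L.m_inv_closed by blast
    qed
    show "a +\<^sub>V b \<in> d ` L" if ab: "a \<in> d ` L" "b \<in> d ` L" for a b
    proof -
      obtain x y where x: "x \<in> L" "a = d x" "y \<in> L" "b = d y" using ab by blast
      then have "a +\<^sub>V b = d (x \<otimes> y)"
        using d(1) Lc subsetD[OF L(2) x(1)] by (simp add: Der_mult Ker_act)
      then show ?thesis using x L.m_closed by blast
    qed
  qed
  moreover have "\<phi> g ` d ` L \<subseteq> d ` L" if g: "g \<in> carrier G" for g
    using Der_conj_Ker[OF d(1) g, symmetric] G.normal_conj[OF L(1) g] L(2) by auto
  ultimately have "d ` L = {0\<^sub>V} \<or> d ` L = carrier V" by (rule irreducible)
  moreover have "d ` L \<noteq> {0\<^sub>V}" using d by (auto simp: Van_def)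
  ultimately show ?thesis by blast
qed

text \<open>The zeros of \<open>d\<close> in L form a normal subgroup of G between N and L, hence
  are N; so \<open>d\<close> induces L / N \<cong> V. The zeros of \<open>d\<close> in all of G form
  the complement.\<close>

lemma chief_step:
  assumes ch: "chief_factor G L N" and LK: "L \<subseteq> Ker" and d: "d \<in> Van N" "d \<notin> Van L"
  shows "d ` L = carrier V" and "{x \<in> L. d x = 0\<^sub>V} = N"
    and "complemented G L N" and "G_isomorphic_to_section G V \<phi> L N"
proof -
  note ch = chief_factorD[OF ch]
  have Der: "d \<in> Der" using d by (simp add: Van_Der)
  interpret L: normal L G by fact
  interpret N: normal N G by fact
  have Lc: "x \<in> carrier G" if "x \<in> L" for x using that L.mem_carrier by blast
  have dmult: "d (x \<otimes> y) = d x +\<^sub>V d y" if "x \<in> L" "y \<in> carrier G" for x y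
    using that Der LK by (auto simp: Der_mult Ker_act Lc)
  have dinv: "d (inv x) = inv\<^bsub>V\<^esub> (d x)" if "x \<in> L" for x
    using that Der LK L.m_inv_closed by (auto simp: Der_inv Ker_act Lc)
  have dconj: "d (g \<otimes> x \<otimes> inv g) = \<phi> g (d x)" if "x \<in> L" "g \<in> carrier G" for x g
    using that Der LK by (auto simp: Der_conj_Ker)
  define K0 where "K0 = {x \<in> L. d x = 0\<^sub>V}"
  have "K0 \<lhd> G" unfolding G.normal_inv_iff
  proof (intro conjI ballI)
    show "subgroup K0 G"
      by (rule G.subgroupI) (use Lc dmult dinv Der subgroup.one_closed[OF L.is_subgroup] in \<open>auto simp: K0_def intro!: exI[of _ \<one>]\<close>)
    show "x \<otimes> h \<otimes> inv x \<in> K0" if "x \<in> carrier G" "h \<in> K0" for x h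
      using that dconj G.normal_conj[OF ch(1)] by (auto simp: K0_def)
  qed
  then have "K0 = N \<or> K0 = L" using ch(3) d(1) by (intro ch(5)) (auto simp: K0_def Van_zero)
  moreover have "K0 \<noteq> L" using d by (auto simp: K0_def Van_def)
  ultimately show ker: "{x \<in> L. d x = 0\<^sub>V} = N" by (simp add: K0_def)
  show surj: "d ` L = carrier V" by (rule Der_surj_on[OF ch(1) LK Der d(2)])
  show "complemented G L N"
    unfolding complemented_def
  proof (intro exI conjI)
    let ?K = "{g \<in> carrier G. d g = 0\<^sub>V}"
    show K: "subgroup ?K G"
      by (rule G.subgroupI) (use Der in \<open>auto simp: Der_mult Der_inv intro!: exI[of _ \<one>]\<close>)
    show "?K <#> L = carrier G"
    proof (intro equalityI subsetI)
      fix g assume g: "g \<in> carrier G"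
      then have "inv\<^bsub>V\<^esub> (\<phi> (inv g) (d g)) \<in> d ` L" using surj Der by simp
      \<comment> \<open>\<open>y\<close> is chosen so that g (d y) cancels d g in d (g y).\<close>
      then obtain y where y: "y \<in> L" "d y = inv\<^bsub>V\<^esub> (\<phi> (inv g) (d g))" by (metis imageE)
      have "d (g \<otimes> y) = 0\<^sub>V" using g y Der Lc by (simp add: Der_mult act_minus)
      then have "g \<otimes> y \<in> ?K" using g y Lc by auto
      moreover have "g = (g \<otimes> y) \<otimes> inv y" using g y Lc by (simp add: G.m_assoc)
      ultimately show "g \<in> ?K <#> L" using y L.m_inv_closed by (auto simp: set_mult_def)
    qed (auto simp: set_mult_def Lc)
    show "?K \<inter> L = N" using ker Lc by auto
  qed
  show "G_isomorphic_to_section G V \<phi> L N"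
    unfolding G_isomorphic_to_section_def
  proof (rule G_isomorphic_sym)
    interpret h: group_hom "G\<lparr>carrier := L\<rparr>" V d
      by (intro group_hom.intro group_hom_axioms.intro homI V.is_group L.subgroup_is_group[OF G.is_group])
        (use Der Lc dmult in auto)
    have "kernel (G\<lparr>carrier := L\<rparr>) V d = N" using ker by (simp add: kernel_def)
    then have iso: "(\<lambda>X. the_elem (d ` X)) \<in> iso (section_group G L N) V"
      using h.FactGroup_iso_set surj by simp
    have el: "the_elem (d ` (N #> x)) = d x" if "x \<in> L" for x
    proof -
      have nx: "d (n \<otimes> x) = d x" if n: "n \<in> N" for n
        using dmult[OF subsetD[OF ch(3) n] Lc[OF \<open>x \<in> L\<close>]] Van_zero[OF d(1) n] DerD[OF Der Lc[OF \<open>x \<in> L\<close>]]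
        by simp
      have "d ` (N #> x) = (\<lambda>n. d (n \<otimes> x)) ` N" by (auto simp: r_coset_def)
      also have "\<dots> = (\<lambda>n. d x) ` N" using nx by (intro image_cong) auto
      also have "\<dots> = {d x}" using subgroup.one_closed[OF N.is_subgroup] by blast
      finally have "d ` (N #> x) = {d x}" .
      then show ?thesis by simp
    qed
    show "G_isomorphic G (section_group G L N) (section_action G L N) V \<phi>"
      unfolding G_isomorphic_def
    proof (intro bexI[OF _ iso] ballI)
      fix g X assume g: "g \<in> carrier G" and X: "X \<in> carrier (section_group G L N)"
      then obtain x where x: "x \<in> L" "X = N #> x" by (auto simp: G.carrier_section_group)
      then show "the_elem (d ` section_action G L N g X) = \<phi> g (the_elem (d ` X))"
        using G.section_action_coset[OF ch(2) L.subset g x(1)] G.normal_conj[OF ch(1) g x(1)] el dconj[OF x(1) g]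
        by simp
    qed
    show "group (section_group G L N)"
      by (rule normal.factorgroup_is_group[OF G.normal_restrict_supergroup]) (use ch L.is_subgroup in auto)
    show "section_action G L N g v \<in> carrier (section_group G L N)"
      if "g \<in> carrier G" "v \<in> carrier (section_group G L N)" for g v
      using G.section_action_closed ch that by blast
  qed
qed

text \<open>The fixed points in \<open>V\<close> of an elementary abelian \<open>p\<close>-section form a submodule, hence vanish, and so
  \<open>card V\<close> is congruent to 1 modulo \<open>p\<close>; therefore the affine action \<open>v \<mapsto> l v + d l\<close> also has a fixed point,
  which shows that \<open>d\<close> is inner.\<close>

lemma noncentral_step:
  assumes ch: "chief_factor G L N" and ab: "abelian_section G L N"
    and NK: "N \<subseteq> Ker" and LK: "\<not> L \<subseteq> Ker" and d: "d \<in> Van N"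
  shows "d \<in> Inn"
proof -
  obtain p :: nat where p: "prime p" "\<And>l. l \<in> L \<Longrightarrow> l [^] p \<in> N"
    using G.abelian_chief_factor_exponent[OF finite_G ch ab] by blast
  note ch = chief_factorD[OF ch]
  have Der: "d \<in> Der" using d by (simp add: Van_Der)
  interpret L: normal L G by fact
  interpret N: normal N G by fact
  have Lc: "x \<in> carrier G" if "x \<in> L" for x using that L.mem_carrier by blast
  have Nc: "x \<in> carrier G" if "x \<in> N" for x using that N.mem_carrier by blast
  have comm: "\<exists>c\<in>N. x \<otimes> y = c \<otimes> (y \<otimes> x)" if "x \<in> L" "y \<in> L" for x y
  proof (rule bexI)
    show "x \<otimes> y \<otimes> inv x \<otimes> inv y \<in> N" using ab that by (auto simp: abelian_section_def)
    show "x \<otimes> y = (x \<otimes> y \<otimes> inv x \<otimes> inv y) \<otimes> (y \<otimes> x)"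
      using that by (simp add: Lc G.m_assoc) (simp add: Lc G.m_assoc[symmetric])
  qed
  have finL: "finite L" using finite_subset[OF L.subset finite_G] .
  define W where "W = {v \<in> carrier V. \<forall>l\<in>L. \<phi> l v = v}"
  have "subgroup W V"
    by (rule V.subgroupI) (use Lc in \<open>auto simp: W_def act_add act_minus intro!: exI[of _ "0\<^sub>V"]\<close>)
  moreover have "\<phi> g ` W \<subseteq> W" if g: "g \<in> carrier G" for g
  proof -
    have "\<phi> l (\<phi> g v) = \<phi> g v" if "l \<in> L" "v \<in> W" for l v
    proof -
      have "l \<otimes> g = g \<otimes> (inv g \<otimes> l \<otimes> g)" using g that Lc by (simp add: G.m_assoc[symmetric])
      moreover have "inv g \<otimes> l \<otimes> g \<in> L" using G.normal_conj[OF ch(1), of "inv g"] g that by simp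
      ultimately have "\<phi> (l \<otimes> g) v = \<phi> g v"
        using that g Lc act_mult[of g "inv g \<otimes> l \<otimes> g" v] by (simp add: W_def)
      then show ?thesis using that g Lc by (simp add: W_def act_mult)
    qed
    then show ?thesis using g by (auto simp: W_def)
  qed
  ultimately have "W = {0\<^sub>V} \<or> W = carrier V" by (rule irreducible)
  moreover have "W \<noteq> carrier V"
  proof
    assume "W = carrier V"
    then have "L \<subseteq> Ker" using Lc by (auto simp: W_def Ker_def)
    then show False using LK by simp
  qed
  ultimately have W0: "W = {0\<^sub>V}" by simp
  have Nact: "\<phi> c v = v" if "c \<in> N" "v \<in> carrier V" for c v using NK that Ker_act by auto
  have fixed_points: "[card (carrier V) = card {v \<in> carrier V. \<forall>l\<in>L. \<phi> l v +\<^sub>V e l = v}] (mod p)"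
    if e: "e \<in> Van N" for e
  proof (rule common_fixed_points_prime_power_maps[OF p(1) finite_V finL])
    have D: "e \<in> Der" using e by (simp add: Van_Der)
    \<comment> \<open>The cocycle identity turns these affine maps into an action of L, and N acts
      trivially because \<open>e\<close> vanishes on it and N lies in \<open>Ker\<close>. Hence the
      action factors through the elementary abelian L / N.\<close>
    define f where "f l v = \<phi> l v +\<^sub>V e l" for l v
    have fmult: "f l (f m v) = \<phi> (l \<otimes> m) v +\<^sub>V e (l \<otimes> m)" if "l \<in> L" "m \<in> carrier G" "v \<in> carrier V" for l m v
      using that D by (simp add: f_def Lc act_mult act_add Der_mult V.m_ac)
    have pow: "(f l ^^ n) v = \<phi> (l [^] n) v +\<^sub>V e (l [^] n)" if "l \<in> L" "v \<in> carrier V" for l v n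
    proof (induction n)
      case (Suc n)
      have "(f l ^^ Suc n) v = f l (f (l [^] n) v)" by (simp only: funpow.simps comp_apply Suc f_def[of "l [^] n" v])
      also have "\<dots> = \<phi> (l \<otimes> l [^] n) v +\<^sub>V e (l \<otimes> l [^] n)" using that by (simp add: fmult Lc)
      finally show ?case using G.nat_pow_Suc2[OF Lc[OF that(1)]] by simp
    qed (use that D in simp)
    show "(\<lambda>v. \<phi> l v +\<^sub>V e l) \<in> carrier V \<rightarrow> carrier V" if "l \<in> L" for l
      using that D by (auto simp: Lc)
    show "((\<lambda>v. \<phi> l v +\<^sub>V e l) ^^ p) v = v" if "l \<in> L" "v \<in> carrier V" for l v
      using pow[OF that, of p] Nact[OF p(2)[OF that(1)] that(2)] Van_zero[OF e p(2)[OF that(1)]] that(2)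
      by (simp add: f_def[abs_def])
    show "\<phi> l (\<phi> m v +\<^sub>V e m) +\<^sub>V e l = \<phi> m (\<phi> l v +\<^sub>V e l) +\<^sub>V e m"
      if lm: "l \<in> L" "m \<in> L" "v \<in> carrier V" for l m v
    proof -
      obtain c where c: "c \<in> N" "l \<otimes> m = c \<otimes> (m \<otimes> l)" using comm lm by blast
      then have "\<phi> (l \<otimes> m) v = \<phi> (m \<otimes> l) v" using lm by (simp add: Lc Nc act_mult Nact)
      moreover have "e (l \<otimes> m) = e (m \<otimes> l)"
        using c lm D Der_mult[OF D, of c "m \<otimes> l"] Nact[OF c(1)] Van_zero[OF e c(1)] by (simp add: Lc Nc)
      ultimately have "f l (f m v) = f m (f l v)" using lm by (simp add: fmult Lc)
      then show ?thesis by (simp only: f_def)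
    qed
  qed
  have zero: "(\<lambda>g\<in>carrier G. 0\<^sub>V) \<in> Van N" using zero_Inn Inn_subset Nc by (auto simp: Van_def)
  have "{v \<in> carrier V. \<forall>l\<in>L. \<phi> l v +\<^sub>V (\<lambda>g\<in>carrier G. 0\<^sub>V) l = v} = W"
    using Lc by (auto simp: W_def)
  then have V1: "[card (carrier V) = 1] (mod p)" using fixed_points[OF zero] W0 by simp
  define U where "U = {v \<in> carrier V. \<forall>l\<in>L. \<phi> l v +\<^sub>V d l = v}"
  have "[card (carrier V) = card U] (mod p)" unfolding U_def by (rule fixed_points[OF d])
  then have "[card U = 1] (mod p)" using V1 by (metis cong_sym cong_trans)
  then have "card U \<noteq> 0" using prime_gt_1_nat[OF p(1)] by (intro notI) (simp add: cong_def)
  then obtain v where v: "v \<in> carrier V" "\<And>l. l \<in> L \<Longrightarrow> \<phi> l v +\<^sub>V d l = v" by (auto simp: U_def card_eq_0_iff)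
  have dl: "d l = inner v l" if l: "l \<in> L" for l
  proof -
    have "\<phi> l v +\<^sub>V d l = v" by (rule v(2)[OF l])
    then have "v = d l +\<^sub>V \<phi> l v" using l v Der by (simp add: Lc V.m_comm)
    then have "v -\<^sub>V \<phi> l v = d l" using l v Der by (simp add: vdiff_eq_iff Lc)
    then show ?thesis using l by (simp add: inner_def Lc)
  qed
  \<comment> \<open>The difference vanishes on L. Comparing its values at l g = g l', with l' a
    conjugate of l, shows that all its values are fixed by L, and only zero is.\<close>
  define e where "e = dsub d (inner v)"
  have e: "e \<in> Der" using Der v by (simp add: e_def dsub_Der inner_Der)
  have eL: "e l = 0\<^sub>V" if "l \<in> L" for l
    using that dl Lc DerD[OF inner_Der[OF v(1)]] by (simp add: e_def dsub_def)
  have e0: "e g = 0\<^sub>V" if g: "g \<in> carrier G" for g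
  proof -
    have "\<phi> l (e g) = e g" if l: "l \<in> L" for l
    proof -
      have "l \<otimes> g = g \<otimes> (inv g \<otimes> l \<otimes> g)" using g l Lc by (simp add: G.m_assoc[symmetric])
      moreover have i: "inv g \<otimes> l \<otimes> g \<in> L" using G.normal_conj[OF ch(1), of "inv g"] g l by simp
      moreover have "e (g \<otimes> (inv g \<otimes> l \<otimes> g)) = e g" using Der_mult[OF e g Lc[OF i]] eL[OF i] g e by simp
      moreover have "e (l \<otimes> g) = \<phi> l (e g)" using Der_mult[OF e Lc[OF l] g] eL[OF l] g e l Lc by simp
      ultimately show ?thesis by metis
    qed
    then have "e g \<in> W" using e g by (simp add: W_def)
    then show ?thesis using W0 by simp
  qed
  have "d = inner v"
  proof (rule Der_ext[OF Der inner_Der[OF v(1)]])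
    fix g assume "g \<in> carrier G"
    then show "d g = inner v g" using e0[of g] Der inner_Der[OF v(1)]
      by (simp add: e_def dsub_def vdiff_zero_iff)
  qed
  then show ?thesis using v by (simp add: Inn_def)
qed

text \<open>On L every \<open>e\<close> in \<open>Van N\<close> factors through \<open>d\<close>,
  since \<open>d\<close> maps L onto V with kernel N: it is \<alpha> composed with \<open>d\<close>
  for some \<alpha> in \<open>F\<close>. Derivations with the same \<alpha> differ by an element of
  \<open>Van L\<close>.\<close>

lemma card_Van_step:
  assumes ch: "chief_factor G L N" and LK: "L \<subseteq> Ker" and d: "d \<in> Van N" "d \<notin> Van L"
  shows "card (Van N) \<le> q * card (Van L)"
proof -
  have surj: "d ` L = carrier V" and ker: "{x \<in> L. d x = 0\<^sub>V} = N" using chief_step[OF assms] by auto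
  note ch = chief_factorD[OF ch]
  interpret L: normal L G by fact
  have Lc: "x \<in> carrier G" if "x \<in> L" for x using that L.mem_carrier by blast
  have dmult: "e (x \<otimes> y) = e x +\<^sub>V e y" if "e \<in> Der" "x \<in> L" "y \<in> L" for e x y
    using that subsetD[OF LK that(2)] by (simp add: Der_mult Ker_act Lc)
  have dinv: "e (inv x) = inv\<^bsub>V\<^esub> (e x)" if "e \<in> Der" "x \<in> L" for e x
    using that subsetD[OF LK L.m_inv_closed[OF that(2)]] by (simp add: Der_inv Ker_act Lc)
  have dconj: "e (g \<otimes> x \<otimes> inv g) = \<phi> g (e x)" if "e \<in> Der" "x \<in> L" "g \<in> carrier G" for e x g
    using that subsetD[OF LK that(2)] by (simp add: Der_conj_Ker)
  define lift where "lift v = (SOME x. x \<in> L \<and> d x = v)" for v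
  have lift: "lift v \<in> L" "d (lift v) = v" if "v \<in> carrier V" for v
  proof -
    have "\<exists>x. x \<in> L \<and> d x = v" using that surj by (metis imageE)
    from someI_ex[OF this] show "lift v \<in> L" "d (lift v) = v" unfolding lift_def by blast+
  qed
  define \<alpha> where "\<alpha> e = (\<lambda>v\<in>carrier V. e (lift v))" for e :: "'a \<Rightarrow> 'v"
  have wd: "e (lift (d x)) = e x" if e: "e \<in> Van N" and x: "x \<in> L" for e x
  proof -
    have dx: "d x \<in> carrier V" using x d by (simp add: Van_Der Lc)
    note l = lift[OF dx]
    have "d (lift (d x) \<otimes> inv x) = 0\<^sub>V" using l x d dx by (simp add: dmult dinv Van_Der)
    then have "lift (d x) \<otimes> inv x \<in> N" using ker l x by auto
    then have "e (lift (d x) \<otimes> inv x) = 0\<^sub>V" using e by (simp add: Van_zero)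
    then show ?thesis using l x e by (simp add: dmult dinv Van_Der vdiff_zero_iff Lc)
  qed
  have \<alpha>d: "\<alpha> e (d x) = e x" if "e \<in> Van N" "x \<in> L" for e x
    using that wd d by (simp add: \<alpha>_def Van_Der Lc)
  have \<alpha>F: "\<alpha> e \<in> F" if e: "e \<in> Van N" for e
  proof (rule EndI)
    show "\<alpha> e v \<in> carrier V" if "v \<in> carrier V" for v
      using that lift e by (simp add: \<alpha>_def Van_Der Lc)
    have ex: "\<exists>x\<in>L. v = d x" if "v \<in> carrier V" for v using surj that by auto
    show "\<alpha> e (v +\<^sub>V w) = \<alpha> e v +\<^sub>V \<alpha> e w" if "v \<in> carrier V" "w \<in> carrier V" for v w
    proof -
      obtain x y where "x \<in> L" "v = d x" "y \<in> L" "w = d y" using ex \<open>v \<in> carrier V\<close> \<open>w \<in> carrier V\<close> by metis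
      then show ?thesis using \<alpha>d[OF e] dmult[OF Van_Der[OF d(1)], of x y, symmetric] dmult[OF Van_Der[OF e], of x y]
        by simp
    qed
    show "\<alpha> e (\<phi> g v) = \<phi> g (\<alpha> e v)" if "g \<in> carrier G" "v \<in> carrier V" for g v
    proof -
      obtain x where "x \<in> L" "v = d x" using ex \<open>v \<in> carrier V\<close> by metis
      then show ?thesis using that \<alpha>d[OF e] dconj[OF Van_Der[OF d(1)], of x g, symmetric] dconj[OF Van_Der[OF e], of x g]
          G.normal_conj[OF ch(1), of g x]
        by simp
    qed
  qed (simp add: \<alpha>_def)
  have finVan: "finite (Van N)" for N using finite_subset[OF _ finite_Der] by (auto simp: Van_def)
  have fib: "card {e \<in> Van N. \<alpha> e = \<beta>} \<le> card (Van L)" for \<beta>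
  proof (cases "{e \<in> Van N. \<alpha> e = \<beta>} = {}")
    case False
    then obtain e0 where e0: "e0 \<in> Van N" "\<alpha> e0 = \<beta>" by auto
    show ?thesis
    proof (rule card_inj_on_le[OF _ _ finVan])
      show "inj_on (\<lambda>e. dsub e e0) {e \<in> Van N. \<alpha> e = \<beta>}"
        by (rule inj_on_subset[OF dsub_inj]) (use e0 in \<open>auto simp: Van_Der\<close>)
      have "dsub e e0 \<in> Van L" if e: "e \<in> Van N" "\<alpha> e = \<beta>" for e
      proof -
        have "e x = e0 x" if "x \<in> L" for x
          using \<alpha>d[OF e(1) that] \<alpha>d[OF e0(1) that] e e0 by simp
        then show ?thesis using e e0 dsub_Der[of e e0]
          by (auto simp: Van_def) (auto simp: dsub_def Lc)
      qed
      then show "(\<lambda>e. dsub e e0) ` {e \<in> Van N. \<alpha> e = \<beta>} \<subseteq> Van L" by auto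
    qed
  next
    case True
    then show ?thesis by (simp only: card.empty)
  qed
  have un: "(\<Union>\<beta>\<in>F. {e \<in> Van N. \<alpha> e = \<beta>}) = Van N" using \<alpha>F by auto
  have "card (Van N) \<le> (\<Sum>\<beta>\<in>F. card {e \<in> Van N. \<alpha> e = \<beta>})"
    using card_UN_le[OF finite_F, of "\<lambda>\<beta>. {e \<in> Van N. \<alpha> e = \<beta>}"] by (simp only: un)
  also have "\<dots> \<le> (\<Sum>\<beta>\<in>F. card (Van L))" using fib by (intro sum_mono) auto
  finally show ?thesis by (simp add: q_mod_def)
qed

text \<open>The part of \<delta> contributed above position \<open>i\<close>, in the form needed for
  a descending induction.\<close>

definition rest where
  "rest Ns i = card {j. i \<le> j \<and> Suc j < length Ns \<and> complemented G (Ns ! Suc j) (Ns ! j) \<and>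
     G_isomorphic_to_section G V \<phi> (Ns ! Suc j) (Ns ! j)}"

lemma rest_0: "rest Ns 0 = delta_mod G Ns V \<phi>" by (simp add: rest_def delta_mod_def)

lemma rest_Suc:
  assumes "Suc i < length Ns"
  shows "rest Ns i = rest Ns (Suc i) + (if complemented G (Ns ! Suc i) (Ns ! i) \<and>
     G_isomorphic_to_section G V \<phi> (Ns ! Suc i) (Ns ! i) then 1 else 0)"
proof -
  let ?P = "\<lambda>j. Suc j < length Ns \<and> complemented G (Ns ! Suc j) (Ns ! j) \<and>
     G_isomorphic_to_section G V \<phi> (Ns ! Suc j) (Ns ! j)"
  have eq: "{j. i \<le> j \<and> ?P j} = (if ?P i then insert i {j. Suc i \<le> j \<and> ?P j} else {j. Suc i \<le> j \<and> ?P j})"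
    by (auto simp: le_eq_less_or_eq Suc_le_eq)
  have "finite {j. Suc i \<le> j \<and> ?P j}" by (rule finite_subset[of _ "{..<length Ns}"]) auto
  then show ?thesis using assms unfolding rest_def eq by auto
qed

lemma Van_trivial:
  assumes "carrier G \<subseteq> N" shows "Van N \<subseteq> Inn"
proof
  fix d assume d: "d \<in> Van N"
  have "d = (\<lambda>g\<in>carrier G. 0\<^sub>V)"
    by (rule Der_ext[OF Van_Der[OF d]]) (use zero_Inn Inn_subset d assms in \<open>auto simp: Van_zero\<close>)
  then show "d \<in> Inn" using zero_Inn by simp
qed

lemma finite_Inn: "finite Inn" using finite_subset[OF Inn_subset finite_Der] .

lemma finite_Van: "finite (Van N)" using finite_subset[OF _ finite_Der] by (auto simp: Van_def)

text \<open>Inside \<open>Ker\<close> a step down the series costs at most a factor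
  \<open>q\<close>, and this only when a new derivation certifies that the chief factor is one of
  those counted by \<delta>. At a factor whose top is not inside \<open>Ker\<close>,
  \<open>noncentral_step\<close> leaves inner derivations only.\<close>

lemma card_Van_chief_series:
  assumes Ns: "chief_series G Ns" and ab: "\<And>L N. chief_factor G L N \<Longrightarrow> abelian_section G L N"
    and "i < length Ns" "Ns ! i \<subseteq> Ker"
  shows "card (Van (Ns ! i)) \<le> card Inn * q ^ rest Ns i"
  using assms(3,4)
proof (induction "length Ns - i" arbitrary: i rule: less_induct)
  case less
  have q0: "q ^ n \<ge> 1" for n using two_le_q by simp
  have Inn: "card Inn \<le> card Inn * q ^ n" for n using q0[of n] by simp
  show ?case
  proof (cases "Suc i < length Ns")
    case False
    then have "i = length Ns - 1" using less.prems by simp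
    then have "Ns ! i = carrier G" using Ns last_conv_nth[of Ns] by (auto simp: chief_series_def)
    then have "card (Van (Ns ! i)) \<le> card Inn" by (intro card_mono finite_Inn Van_trivial) simp
    then show ?thesis using Inn by (rule order_trans)
  next
    case True
    let ?L = "Ns ! Suc i" and ?N = "Ns ! i"
    have ch: "chief_factor G ?L ?N" using Ns True by (simp add: chief_series_def)
    show ?thesis
    proof (cases "?L \<subseteq> Ker")
      case False
      then have "Van ?N \<subseteq> Inn" using noncentral_step[OF ch ab[OF ch] less.prems(2)] by auto
      then have "card (Van (Ns ! i)) \<le> card Inn" by (intro card_mono finite_Inn)
      then show ?thesis using Inn by (rule order_trans)
    next
      case LK: True
      have IH: "card (Van ?L) \<le> card Inn * q ^ rest Ns (Suc i)"
        by (rule less.hyps) (use True LK in auto)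
      show ?thesis
      proof (cases "Van ?N \<subseteq> Van ?L")
        case True
        then have "card (Van ?N) \<le> card (Van ?L)" by (intro card_mono finite_Van)
        also note IH
        also have "q ^ rest Ns (Suc i) \<le> q ^ rest Ns i"
          by (rule power_increasing) (use rest_Suc[OF \<open>Suc i < length Ns\<close>] two_le_q in auto)
        finally show ?thesis by simp
      next
        case False
        then obtain d where d: "d \<in> Van ?N" "d \<notin> Van ?L" by auto
        have r: "rest Ns i = Suc (rest Ns (Suc i))"
          using chief_step(3,4)[OF ch LK d] rest_Suc[OF \<open>Suc i < length Ns\<close>] by simp
        have "card (Van ?N) \<le> q * card (Van ?L)" by (rule card_Van_step[OF ch LK d])
        also have "\<dots> \<le> q * (card Inn * q ^ rest Ns (Suc i))" using IH by simp
        finally show ?thesis using r by (simp add: mult.left_commute)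
      qed
    qed
  qed
qed

text \<open>Vanishing of the first cohomology of H = G / C_G(V) with values in V. A derivation that
  is zero on \<open>Ker\<close> is zero on the last term of the series inside \<open>Ker\<close>;
  the next chief factor acts nontrivially and \<open>noncentral_step\<close> applies, unless the
  whole of G acts trivially.\<close>

lemma Van_Ker_Inn:
  assumes Ns: "chief_series G Ns" and ab: "\<And>L N. chief_factor G L N \<Longrightarrow> abelian_section G L N"
  shows "Van Ker \<subseteq> Inn"
proof -
  have "Van Ker \<subseteq> Inn" if "i < length Ns" "Ns ! i \<subseteq> Ker" for i
    using that
  proof (induction "length Ns - i" arbitrary: i rule: less_induct)
    case less
    show ?case
    proof (cases "Suc i < length Ns")
      case False
      then have "i = length Ns - 1" using less.prems by simp
      then have "Ns ! i = carrier G" using Ns last_conv_nth[of Ns] by (auto simp: chief_series_def)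
      then show ?thesis using less.prems by (intro Van_trivial) simp
    next
      case True
      have ch: "chief_factor G (Ns ! Suc i) (Ns ! i)" using Ns True by (simp add: chief_series_def)
      show ?thesis
      proof (cases "Ns ! Suc i \<subseteq> Ker")
        case False
        have "Van Ker \<subseteq> Van (Ns ! i)" using less.prems by (auto simp: Van_def)
        then show ?thesis using noncentral_step[OF ch ab[OF ch] less.prems(2) False] by auto
      qed (use less.hyps[of "Suc i"] True in auto)
    qed
  qed
  moreover have "Ns ! 0 = {\<one>}" "0 < length Ns" using Ns by (auto simp: chief_series_def hd_conv_nth)
  moreover have "\<one> \<in> Ker" by (simp add: Ker_def)
  ultimately show ?thesis by (metis empty_subsetI insert_subset)
qed

lemma card_Der_le:
  assumes Ns: "chief_series G Ns" and ab: "\<And>L N. chief_factor G L N \<Longrightarrow> abelian_section G L N"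
  shows "card Der \<le> card Inn * q ^ delta_mod G Ns V \<phi>"
proof -
  have 0: "Ns ! 0 = {\<one>}" "0 < length Ns" using Ns by (auto simp: chief_series_def hd_conv_nth)
  have "\<one> \<in> Ker" by (simp add: Ker_def)
  moreover have "Der = Van (Ns ! 0)" using 0 by (auto simp: Van_def)
  ultimately show ?thesis using card_Van_chief_series[OF Ns ab 0(2)] 0 by (simp add: rest_0)
qed

end

section \<open>Averages over tuples\<close>

text \<open>The expectation over \<open>k\<close> independent uniform elements, as a finite sum; the
  passage to the product measure is made in \<open>nn_integral_random_sequence\<close>.\<close>

definition average :: "nat \<Rightarrow> 'a set \<Rightarrow> ((nat \<Rightarrow> 'a) \<Rightarrow> real) \<Rightarrow> real" where
  "average k C f = (\<Sum>g\<in>{..<k} \<rightarrow>\<^sub>E C. f g) / real (card C) ^ k"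

lemma average_mono:
  "(\<And>g. g \<in> {..<k} \<rightarrow>\<^sub>E C \<Longrightarrow> f g \<le> h g) \<Longrightarrow> average k C f \<le> average k C h"
  unfolding average_def by (intro divide_right_mono sum_mono) auto

text \<open>The only tuple of length 0 is the function that is \<open>undefined\<close>
  everywhere.\<close>

lemma average_0: "average 0 C f = f (\<lambda>_. undefined)"
  by (simp add: average_def)

lemma average_Suc:
  assumes "\<And>y g. \<lbrakk>y \<in> C; g \<in> {..<k} \<rightarrow>\<^sub>E C\<rbrakk> \<Longrightarrow> f (g(k := y)) = h y g"
  shows "average (Suc k) C f = (\<Sum>y\<in>C. average k C (h y)) / real (card C)"
proof -
  have "{..<Suc k} \<rightarrow>\<^sub>E C = (\<lambda>(y, g). g(k := y)) ` (C \<times> ({..<k} \<rightarrow>\<^sub>E C))"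
    by (simp add: lessThan_Suc PiE_insert_eq)
  then have "(\<Sum>g\<in>{..<Suc k} \<rightarrow>\<^sub>E C. f g) = (\<Sum>(y, g)\<in>C \<times> ({..<k} \<rightarrow>\<^sub>E C). f (g(k := y)))"
    using inj_combinator[of k "{..<k}" "\<lambda>_. C"] by (simp add: sum.reindex case_prod_unfold)
  also have "\<dots> = (\<Sum>(y, g)\<in>C \<times> ({..<k} \<rightarrow>\<^sub>E C). h y g)"
    using assms by (intro sum.cong) auto
  also have "\<dots> = (\<Sum>y\<in>C. \<Sum>g\<in>{..<k} \<rightarrow>\<^sub>E C. h y g)" by (simp add: sum.cartesian_product)
  finally show ?thesis
    by (simp add: average_def sum_divide_distrib[symmetric] mult.commute)
qed

lemma average_const:
  "finite C \<Longrightarrow> C \<noteq> {} \<Longrightarrow> average k C (\<lambda>_. a) = a"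
  by (simp add: average_def card_PiE)

text \<open>Averaging \<open>f\<close> first over translates by elements of \<open>K\<close> does not change its average over the group.\<close>

lemma (in group) average_le_by_translates:
  assumes fin: "finite (carrier G)" and K: "K \<subseteq> carrier G" "K \<noteq> {}"
    and le: "\<And>g. g \<in> {..<k} \<rightarrow>\<^sub>E carrier G \<Longrightarrow>
      average k K (\<lambda>c. f (\<lambda>i\<in>{..<k}. g i \<otimes> c i)) \<le> h g"
  shows "average k (carrier G) f \<le> average k (carrier G) h"
proof -
  let ?T = "{..<k} \<rightarrow>\<^sub>E carrier G" and ?U = "{..<k} \<rightarrow>\<^sub>E K"
  have finK: "finite K" using K fin finite_subset by blast
  then have cK: "real (card K) ^ k > 0" using K by (simp add: card_gt_0_iff)
  have shift: "(\<Sum>g\<in>?T. f (\<lambda>i\<in>{..<k}. g i \<otimes> c i)) = (\<Sum>g\<in>?T. f g)" if c: "c \<in> ?U" for c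
  proof (rule sum.reindex_bij_betw)
    show "bij_betw (\<lambda>g. \<lambda>i\<in>{..<k}. g i \<otimes> c i) ?T ?T"
    proof (rule bij_betw_byWitness[where f' = "\<lambda>g. \<lambda>i\<in>{..<k}. g i \<otimes> inv (c i)"])
      have cc: "c i \<in> carrier G" if "i < k" for i using that c K by auto
      show "\<forall>g\<in>?T. (\<lambda>i\<in>{..<k}. (\<lambda>i\<in>{..<k}. g i \<otimes> c i) i \<otimes> inv (c i)) = g"
        using cc by (auto simp: m_assoc PiE_iff extensional_def)
      show "\<forall>g\<in>?T. (\<lambda>i\<in>{..<k}. (\<lambda>i\<in>{..<k}. g i \<otimes> inv (c i)) i \<otimes> c i) = g"
        using cc by (auto simp: m_assoc PiE_iff extensional_def)
      show "(\<lambda>g. \<lambda>i\<in>{..<k}. g i \<otimes> c i) ` ?T \<subseteq> ?T" using cc by (auto simp: PiE_iff)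
      show "(\<lambda>g. \<lambda>i\<in>{..<k}. g i \<otimes> inv (c i)) ` ?T \<subseteq> ?T" using cc by (auto simp: PiE_iff)
    qed
  qed
  have "average k (carrier G) (\<lambda>g. average k K (\<lambda>c. f (\<lambda>i\<in>{..<k}. g i \<otimes> c i)))
      = (\<Sum>g\<in>?T. \<Sum>c\<in>?U. f (\<lambda>i\<in>{..<k}. g i \<otimes> c i)) / real (card K) ^ k / real (card (carrier G)) ^ k"
    by (simp add: average_def sum_divide_distrib)
  also have "(\<Sum>g\<in>?T. \<Sum>c\<in>?U. f (\<lambda>i\<in>{..<k}. g i \<otimes> c i)) = (\<Sum>c\<in>?U. \<Sum>g\<in>?T. f g)"
    by (subst sum.swap) (use shift in \<open>auto intro!: sum.cong\<close>)
  also have "\<dots> = real (card K) ^ k * (\<Sum>g\<in>?T. f g)" using finK by (simp add: card_PiE)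
  also have "\<dots> / real (card K) ^ k / real (card (carrier G)) ^ k = average k (carrier G) f"
    using cK by (simp add: average_def)
  finally have eq: "average k (carrier G) (\<lambda>g. average k K (\<lambda>c. f (\<lambda>i\<in>{..<k}. g i \<otimes> c i)))
      = average k (carrier G) f" .
  show ?thesis unfolding eq[symmetric] by (rule average_mono[OF le])
qed

text \<open>Double counting of the pairs of a tuple \<open>c\<close> and a test \<open>e\<close> that \<open>c\<close> passes.\<close>

lemma average_ex_le:
  assumes K: "finite K" "K \<noteq> {}" and E: "finite E" and t: "t > 0"
    and size: "\<And>e j. \<lbrakk>e \<in> E; j < k\<rbrakk> \<Longrightarrow> real (card {c \<in> K. S e j c}) = real (card K) * w j"
    and mult: "\<And>c e. \<lbrakk>c \<in> {..<k} \<rightarrow>\<^sub>E K; e \<in> E; \<And>j. j < k \<Longrightarrow> S e j (c j)\<rbrakk>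
      \<Longrightarrow> t \<le> card {e \<in> E. \<forall>j<k. S e j (c j)}"
  shows "average k K (\<lambda>c. of_bool (\<exists>e\<in>E. \<forall>j<k. S e j (c j))) \<le> real (card E) / real t * (\<Prod>j<k. w j)"
proof -
  let ?U = "{..<k} \<rightarrow>\<^sub>E K" and ?P = "\<lambda>e c. \<forall>j<k. S e j (c j)"
  have cK: "real (card K) > 0" using K by (simp add: card_gt_0_iff)
  have finU: "finite ?U" by (rule finite_PiE) (simp_all add: K)
  \<comment> \<open>A passing tuple is counted at least \<open>t\<close> times by the sum over E,
    which is the gain over the plain union bound.\<close>
  have pt: "of_bool (\<exists>e\<in>E. ?P e c) \<le> (\<Sum>e\<in>E. of_bool (?P e c)) / real t" if c: "c \<in> ?U" for c
  proof (cases "\<exists>e\<in>E. ?P e c")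
    case True
    then obtain e where "e \<in> E" "\<And>j. j < k \<Longrightarrow> S e j (c j)" by blast
    from mult[OF c this] have "t \<le> card (E \<inter> {e. ?P e c})" by (simp add: Int_def)
    then have "real t \<le> (\<Sum>e\<in>E. of_bool (?P e c))" by (subst sum_of_bool_eq) (auto intro: E)
    then show ?thesis using True t by (simp only: of_bool_eq) (simp add: pos_le_divide_eq del: sum_of_bool_eq)
  next
    case False
    have "0 \<le> (\<Sum>e\<in>E. of_bool (?P e c)) / real t" by (intro divide_nonneg_nonneg sum_nonneg) auto
    then show ?thesis using False by (simp only: of_bool_eq(1))
  qed
  have tuple: "(\<Sum>c\<in>?U. of_bool (?P e c)) = (\<Prod>j<k. w j) * real (card K) ^ k" if e: "e \<in> E" for e
  proof -
    have "(\<Sum>c\<in>?U. of_bool (?P e c)) = real (card (?U \<inter> {c. ?P e c}))"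
      by (subst sum_of_bool_eq) (auto intro: finU)
    also have "?U \<inter> {c. ?P e c} = (\<Pi>\<^sub>E j\<in>{..<k}. {c \<in> K. S e j c})"
      unfolding PiE_def Pi_def lessThan_iff by blast
    also have "real (card \<dots>) = (\<Prod>j<k. real (card {c \<in> K. S e j c}))" by (simp add: card_PiE)
    also have "\<dots> = (\<Prod>j<k. real (card K) * w j)" using size[OF e] by (intro prod.cong) auto
    finally show ?thesis by (simp add: prod.distrib)
  qed
  have "(\<Sum>c\<in>?U. of_bool (\<exists>e\<in>E. ?P e c)) \<le> (\<Sum>c\<in>?U. (\<Sum>e\<in>E. of_bool (?P e c)) / real t)"
    by (intro sum_mono pt)
  also have "\<dots> = (\<Sum>e\<in>E. \<Sum>c\<in>?U. of_bool (?P e c)) / real t"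
    by (simp only: sum_divide_distrib[symmetric] sum.swap[of _ E])
  also have "(\<Sum>e\<in>E. \<Sum>c\<in>?U. of_bool (?P e c)) = (\<Sum>e\<in>E. (\<Prod>j<k. w j) * real (card K) ^ k)"
    by (intro sum.cong tuple refl)
  also have "\<dots> / real t = (real (card E) / real t * (\<Prod>j<k. w j)) * real (card K) ^ k" by simp
  finally show ?thesis unfolding average_def pos_divide_le_eq[OF zero_less_power[OF cK]] .
qed

text \<open>Bounds a sum of failure probabilities when every further element multiplies the bound
  \<open>x\<close> by \<open>r\<close>; the cap is there because probabilities never exceed
  1.\<close>

definition geometric_cap :: "real \<Rightarrow> real \<Rightarrow> real" where
  "geometric_cap r x = (\<Sum>m. min 1 (x * r ^ m))"

lemma summable_geometric_cap:
  fixes r x :: real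
  assumes "0 \<le> r" "r < 1" "0 \<le> x"
  shows "summable (\<lambda>m. min 1 (x * r ^ m))"
  by (rule summable_comparison_test'[OF summable_mult[OF summable_geometric[of r]], of 0 _ x])
    (use assms in auto)

lemma geometric_cap_nonneg: "\<lbrakk>0 \<le> r; r < 1; 0 \<le> x\<rbrakk> \<Longrightarrow> 0 \<le> geometric_cap r x"
  unfolding geometric_cap_def by (intro suminf_nonneg summable_geometric_cap) auto

lemma geometric_cap_step:
  assumes "0 \<le> r" "r < 1" "0 \<le> x"
  shows "geometric_cap r x = min 1 x + geometric_cap r (x * r)"
  unfolding geometric_cap_def
  using suminf_split_head[OF summable_geometric_cap[OF assms]] by (simp add: mult.assoc)

text \<open>\<open>t\<close> is a number of factors \<open>r\<close> that brings \<open>x\<close>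
  down to 1. Until then each term counts 1, afterwards the terms are dominated by a geometric
  series; so \<open>t\<close> becomes \<delta> \<theta> or the ceiling of its quotient by n, and the
  second summand becomes c_V or its analogue with q ^ n.\<close>

lemma geometric_cap_le:
  assumes "0 \<le> r" "r < 1" "0 \<le> x" "x * r ^ t \<le> 1"
  shows "geometric_cap r x \<le> real t + 1 / (1 - r)"
proof -
  note s = summable_geometric_cap[OF assms(1-3)]
  have le: "min 1 (x * r ^ (m + t)) \<le> r ^ m" for m
  proof -
    have "x * r ^ (m + t) = (x * r ^ t) * r ^ m" by (simp add: power_add)
    also have "\<dots> \<le> 1 * r ^ m" using assms by (intro mult_right_mono) auto
    finally show ?thesis by simp
  qed
  have "geometric_cap r x = (\<Sum>m. min 1 (x * r ^ (m + t))) + (\<Sum>m<t. min 1 (x * r ^ m))"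
    unfolding geometric_cap_def by (rule suminf_split_initial_segment[OF s])
  also have "(\<Sum>m. min 1 (x * r ^ (m + t))) \<le> (\<Sum>m. r ^ m)"
    by (rule suminf_le[OF le]) (use summable_ignore_initial_segment[OF s, of t] assms in auto)
  also have "(\<Sum>m. r ^ m) = 1 / (1 - r)" using assms by (simp add: suminf_geometric)
  also have "(\<Sum>m<t. min 1 (x * r ^ m)) \<le> (\<Sum>m<t. 1)" by (intro sum_mono) auto
  finally show ?thesis by simp
qed

text \<open>With probability at least \<open>p\<close> each new random element multiplies \<open>x\<close> by at most \<open>r\<close>, so that \<open>x\<close> spends an
  expected time of at most \<open>1 / p\<close> between any two such multiplications.\<close>

lemma sum_average_min_le:
  fixes c :: "'a \<Rightarrow> real"
  assumes C: "finite C" "C \<noteq> {}" and P: "P \<subseteq> C" "p * real (card C) \<le> real (card P)" and p: "0 < p"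
    and r: "0 \<le> r" "r < 1"
    and c: "\<And>y. y \<in> C \<Longrightarrow> 0 \<le> c y" "\<And>y. y \<in> C \<Longrightarrow> c y \<le> 1" "\<And>y. y \<in> P \<Longrightarrow> c y \<le> r"
    and x: "0 \<le> x"
  shows "(\<Sum>k<n. average k C (\<lambda>g. min 1 (x * (\<Prod>i<k. c (g i))))) \<le> geometric_cap r x / p"
proof -
  define u where "u k x = average k C (\<lambda>g. min 1 (x * (\<Prod>i<k. c (g i))))" for k x
  \<comment> \<open>The product is symmetric in its factors, so the last coordinate may be drawn
    first.\<close>
  have u_Suc: "u (Suc k) x = (\<Sum>y\<in>C. u k (x * c y)) / real (card C)" for k x
  proof -
    have "(\<Prod>i<Suc k. c ((g(k := y)) i)) = c y * (\<Prod>i<k. c (g i))" for g :: "nat \<Rightarrow> 'a" and y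
      by (simp add: mult.commute)
    then show ?thesis unfolding u_def
      by (subst average_Suc[where h = "\<lambda>y g. min 1 (x * c y * (\<Prod>i<k. c (g i)))"]) (auto simp: mult_ac)
  qed
  have mono: "u k x \<le> u k y" if "x \<le> y" for k x y
    unfolding u_def
  proof (rule average_mono)
    fix g assume "g \<in> {..<k} \<rightarrow>\<^sub>E C"
    then have "0 \<le> (\<Prod>i<k. c (g i))" using c by (intro prod_nonneg) auto
    then show "min 1 (x * (\<Prod>i<k. c (g i))) \<le> min 1 (y * (\<Prod>i<k. c (g i)))"
      using mult_right_mono[OF that, of "\<Prod>i<k. c (g i)"] by (simp add: min_def)
  qed
  define U where "U n x = (\<Sum>k<n. u k x)" for n x
  have Umono: "U n x \<le> U n y" if "x \<le> y" for n x y
    unfolding U_def using mono[OF that] by (intro sum_mono) auto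
  have N: "real (card C) > 0" using C by (simp add: card_gt_0_iff)
  have "p * real (card C) \<le> 1 * real (card C)"
    using P card_mono[OF C(1) P(1)] by simp
  then have p1: "p \<le> 1" using N by simp
  have "U n x \<le> geometric_cap r x / p"
    using x
  proof (induction n arbitrary: x)
    case 0
    then show ?case using geometric_cap_nonneg[OF r] p by (simp add: U_def)
  next
    case (Suc n)
    have xr: "x * r \<le> x" using r Suc.prems by (simp add: mult_left_le)
    have "(\<Sum>y\<in>C. U n (x * c y)) = (\<Sum>y\<in>P. U n (x * c y)) + (\<Sum>y\<in>C - P. U n (x * c y))"
      using sum.subset_diff[OF P(1) C(1), of "\<lambda>y. U n (x * c y)"] by (simp add: add.commute)
    also have "(\<Sum>y\<in>P. U n (x * c y)) \<le> (\<Sum>y\<in>P. U n (x * r))"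
      using c(3) Suc.prems by (intro sum_mono Umono mult_left_mono) auto
    also have "(\<Sum>y\<in>C - P. U n (x * c y)) \<le> (\<Sum>y\<in>C - P. U n x)"
      using c(2) Suc.prems by (intro sum_mono Umono) (auto simp: mult_left_le)
    also have "(\<Sum>y\<in>P. U n (x * r)) + (\<Sum>y\<in>C - P. U n x)
        = real (card C) * U n x - real (card P) * (U n x - U n (x * r))"
      using card_Diff_subset[OF finite_subset[OF P(1) C(1)] P(1)] card_mono[OF C(1) P(1)]
      by (simp add: of_nat_diff algebra_simps)
    \<comment> \<open>Elements of P in excess of the share \<open>p\<close> only help,
      \<open>U n\<close> being monotone.\<close>
    also have "\<dots> \<le> real (card C) * U n x - (p * real (card C)) * (U n x - U n (x * r))"
      using Umono[OF xr] P(2) by (intro diff_left_mono mult_right_mono) auto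
    also have "\<dots> = real (card C) * ((1 - p) * U n x + p * U n (x * r))" by (simp add: algebra_simps)
    finally have avg: "(\<Sum>y\<in>C. U n (x * c y)) / real (card C) \<le> (1 - p) * U n x + p * U n (x * r)"
      using N by (simp add: pos_divide_le_eq mult.commute)
    have "U (Suc n) x = u 0 x + (\<Sum>k<n. u (Suc k) x)" unfolding U_def by (rule sum.lessThan_Suc_shift)
    also have "(\<Sum>k<n. u (Suc k) x) = (\<Sum>y\<in>C. U n (x * c y)) / real (card C)"
      unfolding u_Suc U_def by (simp add: sum_divide_distrib[symmetric] sum.swap[of _ C])
    also have "u 0 x = min 1 x" by (simp add: u_def average_0)
    also note avg
    also have "(1 - p) * U n x \<le> (1 - p) * (geometric_cap r x / p)"
      using Suc p1 by (intro mult_left_mono) auto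
    also have "p * U n (x * r) \<le> p * (geometric_cap r (x * r) / p)"
      using Suc p r by (intro mult_left_mono) auto
    \<comment> \<open>\<open>geometric_cap r x / p\<close> solves exactly the recursion of a walk
      that moves from \<open>x\<close> to \<open>x * r\<close> with probability \<open>p\<close> and
      otherwise stays.\<close>
    also have "min 1 x + ((1 - p) * (geometric_cap r x / p) + p * (geometric_cap r (x * r) / p))
        = geometric_cap r x / p"
      using geometric_cap_step[OF r Suc.prems] p by (simp add: field_simps)
    finally show ?case by simp
  qed
  then show ?thesis by (simp add: U_def u_def)
qed

section \<open>Random elements and derivations\<close>

context finite_irreducible_module
begin

lemma one_Ker: "\<one> \<in> Ker" by (simp add: Ker_def)

lemma Comm_subset: "g \<in> carrier G \<Longrightarrow> Comm g \<subseteq> carrier V"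
  by (auto simp: Comm_def)

lemma Comm_subgroup:
  assumes g: "g \<in> carrier G" shows "subgroup (Comm g) V"
proof (rule V.subgroupI)
  show "Comm g \<noteq> {}" by (auto simp: Comm_def)
  show "inv\<^bsub>V\<^esub> a \<in> Comm g" if a: "a \<in> Comm g" for a
  proof -
    obtain v where v: "v \<in> carrier V" "a = v -\<^sub>V \<phi> g v" using a by (auto simp: Comm_def)
    then have "inv\<^bsub>V\<^esub> a = inv\<^bsub>V\<^esub> v -\<^sub>V \<phi> g (inv\<^bsub>V\<^esub> v)" using g by (simp add: act_minus V.inv_mult V.m_comm)
    then show ?thesis using v by (auto simp: Comm_def)
  qed
  show "a +\<^sub>V b \<in> Comm g" if ab: "a \<in> Comm g" "b \<in> Comm g" for a b
  proof -
    obtain v w where v: "v \<in> carrier V" "a = v -\<^sub>V \<phi> g v" "w \<in> carrier V" "b = w -\<^sub>V \<phi> g w"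
      using ab by (auto simp: Comm_def)
    then have "a +\<^sub>V b = (v +\<^sub>V w) -\<^sub>V \<phi> g (v +\<^sub>V w)" using g by (simp add: act_add vdiff_swap)
    then show ?thesis using v by (auto simp: Comm_def)
  qed
qed (rule Comm_subset[OF g])

lemma Comm_End: "\<lbrakk>\<alpha> \<in> F; g \<in> carrier G; u \<in> Comm g\<rbrakk> \<Longrightarrow> \<alpha> u \<in> Comm g"
  by (auto simp: Comm_def End_add End_minus End_act)

lemma Comm_mult_Ker: "\<lbrakk>g \<in> carrier G; c \<in> Ker\<rbrakk> \<Longrightarrow> Comm (g \<otimes> c) = Comm g"
  using Ker_subset by (auto simp: Comm_def act_mult Ker_act subset_iff)

lemma Fix_subgroup: "g \<in> carrier G \<Longrightarrow> subgroup (Fix g) V"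
  by (rule V.subgroupI) (auto simp: Fix_def act_add act_minus intro!: exI[of _ "0\<^sub>V"])

lemma card_Fix_ge_1: "g \<in> carrier G \<Longrightarrow> card (Fix g) \<ge> 1"
  using subgroup.one_closed[OF Fix_subgroup] finite_subset[OF _ finite_V, of "Fix g"]
  by (auto simp: Suc_le_eq card_gt_0_iff Fix_def)

text \<open>Rank and nullity of the map 1 - g.\<close>

lemma card_Comm_Fix:
  assumes g: "g \<in> carrier G" shows "card (Comm g) * card (Fix g) = card (carrier V)"
proof -
  interpret C: subgroup "Comm g" V using Comm_subgroup[OF g] .
  interpret h: group_hom V "V\<lparr>carrier := Comm g\<rparr>" "\<lambda>v. v -\<^sub>V \<phi> g v"
    by (intro group_hom.intro group_hom_axioms.intro homI V.is_group C.subgroup_is_group)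
      (use g in \<open>auto simp: Comm_def act_add vdiff_swap\<close>)
  have "card {v \<in> carrier V. v -\<^sub>V \<phi> g v \<in> {0\<^sub>V}} * card (Comm g) = card (carrier V) * card {0\<^sub>V}"
    using h.card_surj_hom_preimage[OF finite_V, of "{0\<^sub>V}"] subgroup.one_closed[OF Comm_subgroup[OF g]]
    by (simp add: Comm_def)
  moreover have "{v \<in> carrier V. v -\<^sub>V \<phi> g v \<in> {0\<^sub>V}} = Fix g"
    using g by (auto simp: Fix_def vdiff_zero_iff)
  ultimately show ?thesis by (simp add: mult.commute)
qed

lemma Der_Ker_surj:
  assumes d: "d \<in> Der" "d \<notin> Inn" and KI: "Van Ker \<subseteq> Inn"
  shows "d ` Ker = carrier V"
  using Der_surj_on[OF Ker_normal order_refl d(1)] d KI by blast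

text \<open>As \<open>c\<close> runs through \<open>Ker\<close>, d c is uniformly distributed over V
  by \<open>Der_Ker_surj\<close>, hence so is d (g c) = d g + g (d c); it falls into [V, g] with
  probability 1 / |C_V(g)|. Orders are multiplied out to stay with natural numbers.\<close>

lemma card_compatible_translates:
  assumes d: "d \<in> Der" "d \<notin> Inn" and KI: "Van Ker \<subseteq> Inn" and g: "g \<in> carrier G"
  shows "card {c \<in> Ker. d (g \<otimes> c) \<in> Comm g} * card (Fix g) = card Ker"
proof -
  interpret K: normal Ker G by (rule Ker_normal)
  have Kc: "x \<in> carrier G" if "x \<in> Ker" for x using that Ker_subset by auto
  interpret h: group_hom "G\<lparr>carrier := Ker\<rparr>" V d
    by (intro group_hom.intro group_hom_axioms.intro homI V.is_group K.subgroup_is_group[OF G.is_group])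
      (use d Kc in \<open>auto simp: Der_mult Ker_act\<close>)
  define S where "S = {u \<in> carrier V. d g +\<^sub>V \<phi> g u \<in> Comm g}"
  have dg: "d g \<in> carrier V" using d g by simp
  have "bij_betw (\<lambda>u. d g +\<^sub>V \<phi> g u) S (Comm g)"
  proof (rule bij_betw_byWitness[where f' = "\<lambda>w. \<phi> (inv g) (w -\<^sub>V d g)"])
    have W: "w \<in> carrier V" if "w \<in> Comm g" for w using that Comm_subset[OF g] by auto
    have a: "d g +\<^sub>V u -\<^sub>V d g = u" if "u \<in> carrier V" for u
      using that dg by (simp add: vdiff_eq_iff) (simp add: V.m_comm)
    have b: "d g +\<^sub>V (w -\<^sub>V d g) = w" if "w \<in> carrier V" for w
      using that dg by (simp add: V.m_assoc[symmetric] a)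
    show "\<forall>u\<in>S. \<phi> (inv g) (d g +\<^sub>V \<phi> g u -\<^sub>V d g) = u"
      using a g by (simp add: S_def)
    show "\<forall>w\<in>Comm g. d g +\<^sub>V \<phi> g (\<phi> (inv g) (w -\<^sub>V d g)) = w"
      using b g dg by (simp add: W)
    show "(\<lambda>u. d g +\<^sub>V \<phi> g u) ` S \<subseteq> Comm g" by (auto simp: S_def)
    show "(\<lambda>w. \<phi> (inv g) (w -\<^sub>V d g)) ` Comm g \<subseteq> S"
      using b g dg W by (auto simp: S_def)
  qed
  then have S: "card S = card (Comm g)" by (rule bij_betw_same_card)
  have "card {c \<in> Ker. d c \<in> S} * card (carrier V) = card Ker * card S"
    using h.card_surj_hom_preimage[of S] Der_Ker_surj[OF d KI] finite_subset[OF Ker_subset finite_G]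
    by (simp add: S_def)
  moreover have "{c \<in> Ker. d c \<in> S} = {c \<in> Ker. d (g \<otimes> c) \<in> Comm g}"
    using d g by (auto simp: S_def Der_mult Kc)
  ultimately have "card {c \<in> Ker. d (g \<otimes> c) \<in> Comm g} * card (carrier V) = card Ker * card (Comm g)"
    using S by simp
  then have "card {c \<in> Ker. d (g \<otimes> c) \<in> Comm g} * card (carrier V) * card (Fix g) = card Ker * (card (Comm g) * card (Fix g))"
    by simp
  then have "card {c \<in> Ker. d (g \<otimes> c) \<in> Comm g} * card (Fix g) * card (carrier V) = card Ker * card (carrier V)"
    unfolding card_Comm_Fix[OF g] by (simp only: mult.assoc mult.commute mult.left_commute)
  moreover have "card (carrier V) > 0" using finite_V by (auto simp: card_gt_0_iff)
  ultimately show ?thesis by simp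
qed

text \<open>A nonzero \<alpha> is invertible, and scaling back would make \<open>d\<close> inner:
  nonzero multiples of an outer derivation stay outer.\<close>

lemma dscale_Inn_imp_zero:
  assumes d: "d \<in> Der" "d \<notin> Inn" and \<alpha>: "\<alpha> \<in> F" and i: "dscale \<alpha> d \<in> Inn" and v: "v \<in> carrier V"
  shows "\<alpha> v = 0\<^sub>V"
proof (rule ccontr)
  assume "\<alpha> v \<noteq> 0\<^sub>V"
  then obtain \<beta> where \<beta>: "\<beta> \<in> F" "\<And>w. w \<in> carrier V \<Longrightarrow> \<beta> (\<alpha> w) = w" using End_inverse[OF \<alpha> v] by blast
  have "dscale \<beta> (dscale \<alpha> d) = d"
    by (rule Der_ext) (use d \<alpha> \<beta> in \<open>auto simp: dscale_Der\<close>, auto simp: dscale_def)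
  then show False using dscale_Inn[OF \<beta>(1) i] d by simp
qed

text \<open>Nonzero multiples of \<open>d\<close>, modulo inner derivations, inherit the compatibility of \<open>d\<close> with \<open>g\<close>.\<close>

lemma card_compatible_ge:
  assumes d: "d \<in> Der" "d \<notin> Inn" and g: "\<And>i. i < k \<Longrightarrow> g i \<in> carrier G"
    and comp: "\<And>i. i < k \<Longrightarrow> d (g i) \<in> Comm (g i)"
  shows "(q - 1) * card Inn \<le> card {e \<in> Der - Inn. \<forall>i<k. e (g i) \<in> Comm (g i)}"
proof -
  let ?z = "\<lambda>v\<in>carrier V. 0\<^sub>V"
  let ?f = "\<lambda>(\<alpha>, b). dadd (dscale \<alpha> d) b"
  let ?E = "{e \<in> Der - Inn. \<forall>i<k. e (g i) \<in> Comm (g i)}"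
  have I: "b \<in> Der" if "b \<in> Inn" for b using that Inn_subset by auto
  have "inj_on ?f ((F - {?z}) \<times> Inn)"
  proof (rule inj_onI)
    fix x y assume xy: "x \<in> (F - {?z}) \<times> Inn" "y \<in> (F - {?z}) \<times> Inn" "?f x = ?f y"
    obtain \<alpha> b \<beta> b' where p: "x = (\<alpha>, b)" "y = (\<beta>, b')" by (metis surj_pair)
    have *: "\<alpha> \<in> F" "b \<in> Inn" "\<beta> \<in> F" "b' \<in> Inn" "dadd (dscale \<alpha> d) b = dadd (dscale \<beta> d) b'"
      using xy by (auto simp: p)
    \<comment> \<open>Equal images make (\<alpha> - \<beta>) d inner, which forces \<alpha> =
      \<beta>, and then the inner parts agree as well.\<close>
    define \<gamma> where "\<gamma> = (\<lambda>v\<in>carrier V. \<alpha> v -\<^sub>V \<beta> v)"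
    have \<gamma>: "\<gamma> \<in> F" unfolding \<gamma>_def using * by (intro End_diff)
    have "dscale \<gamma> d = dsub b' b"
    proof (rule Der_ext)
      fix x assume x: "x \<in> carrier G"
      have c: "\<alpha> (d x) \<in> carrier V" "\<beta> (d x) \<in> carrier V" "b x \<in> carrier V" "b' x \<in> carrier V"
        using * d x I by auto
      have "\<alpha> (d x) +\<^sub>V b x = \<beta> (d x) +\<^sub>V b' x"
        using fun_cong[OF *(5), of x] x by (simp add: dadd_def dscale_def)
      then have "\<alpha> (d x) = \<beta> (d x) +\<^sub>V b' x -\<^sub>V b x" using c by (metis V.m_closed vdiff_eq_iff)
      then have "\<alpha> (d x) = (b' x -\<^sub>V b x) +\<^sub>V \<beta> (d x)" using c by (simp add: V.m_ac)
      then have "\<alpha> (d x) -\<^sub>V \<beta> (d x) = b' x -\<^sub>V b x" using c by (simp add: vdiff_eq_iff)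
      then show "dscale \<gamma> d x = dsub b' b x" using x d by (simp add: dscale_def dsub_def \<gamma>_def)
    qed (use \<gamma> d * I in \<open>auto simp: dscale_Der dsub_Der\<close>)
    then have "dscale \<gamma> d \<in> Inn" using dsub_Inn * by simp
    then have "\<gamma> v = 0\<^sub>V" if "v \<in> carrier V" for v using dscale_Inn_imp_zero[OF d \<gamma>] that by simp
    then have "\<alpha> v = \<beta> v" if "v \<in> carrier V" for v using that * by (simp add: \<gamma>_def vdiff_zero_iff)
    then have eq: "\<alpha> = \<beta>" using * by (intro End_ext)
    have "b = b'"
    proof (rule Der_ext)
      fix x assume x: "x \<in> carrier G"
      then show "b x = b' x"
        using fun_cong[OF *(5), of x] eq * d I by (simp add: dadd_def dscale_def)
    qed (use * I in auto)
    then show "x = y" using eq by (simp add: p)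
  qed
  moreover have "?f ` ((F - {?z}) \<times> Inn) \<subseteq> ?E"
  proof (rule image_subsetI)
    fix x assume x: "x \<in> (F - {?z}) \<times> Inn"
    obtain \<alpha> b where p: "x = (\<alpha>, b)" by (metis surj_pair)
    have *: "\<alpha> \<in> F" "\<alpha> \<noteq> ?z" "b \<in> Inn" using x by (auto simp: p)
    have D: "dadd (dscale \<alpha> d) b \<in> Der" using * d I by (simp add: dadd_Der dscale_Der)
    have N: "dadd (dscale \<alpha> d) b \<notin> Inn"
    proof
      assume "dadd (dscale \<alpha> d) b \<in> Inn"
      then have "dsub (dadd (dscale \<alpha> d) b) b \<in> Inn" using dsub_Inn * by simp
      then have "dscale \<alpha> d \<in> Inn" using dsub_dadd[of "dscale \<alpha> d" b] * d I by (simp add: dscale_Der)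
      then have "\<alpha> v = 0\<^sub>V" if "v \<in> carrier V" for v using dscale_Inn_imp_zero[OF d *(1)] that by simp
      then have "\<alpha> = ?z" using * zero_End by (intro End_ext) auto
      then show False using * by simp
    qed
    have "dadd (dscale \<alpha> d) b (g i) \<in> Comm (g i)" if i: "i < k" for i
    proof -
      have "\<alpha> (d (g i)) \<in> Comm (g i)" using Comm_End * g[OF i] comp[OF i] by simp
      moreover have "b (g i) \<in> Comm (g i)" using Inn_Comm * g[OF i] by simp
      ultimately show ?thesis using subgroup.m_closed[OF Comm_subgroup[OF g[OF i]]] g[OF i]
        by (simp add: dadd_def dscale_def)
    qed
    then show "?f x \<in> ?E" using D N by (simp add: p)
  qed
  moreover have "finite ?E" using finite_Der by simp
  ultimately have "card ((F - {?z}) \<times> Inn) \<le> card ?E" by (rule card_inj_on_le)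
  moreover have "card (F - {?z}) = q - 1" using zero_End finite_F by (simp add: q_mod_def)
  ultimately show ?thesis by (simp add: card_cartesian_product)
qed

text \<open>By \<open>Der_conj\<close>, the condition at \<open>i\<close> holds as soon as
  \<open>d\<close> vanishes at some conjugate of \<open>g i\<close>; it is stated in terms of
  \<open>g i\<close> alone, so that the conjugating elements disappear.\<close>

definition bad :: "nat \<Rightarrow> (nat \<Rightarrow> 'a) \<Rightarrow> bool" where
  "bad k g \<longleftrightarrow> (\<exists>d\<in>Der - Inn. \<forall>i<k. d (g i) \<in> Comm (g i))"

text \<open>The number of points of the projective space of derivations modulo inner ones.\<close>

definition outer_ratio :: real where
  "outer_ratio = real (card (Der - Inn)) / real ((q - 1) * card Inn)"

text \<open>The cosets of the entries modulo \<open>Ker\<close> determine the subspaces [V, g i];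
  within the cosets the values d (g i) are uniform. The minimum with 1 caps each conditional
  probability separately and not just their mean, as \<open>sum_average_min_le\<close>
  requires.\<close>

lemma average_bad_le:
  assumes KI: "Van Ker \<subseteq> Inn"
  shows "average k (carrier G) (\<lambda>g. of_bool (bad k g))
    \<le> average k (carrier G) (\<lambda>g. min 1 (outer_ratio * (\<Prod>i<k. 1 / real (card (Fix (g i))))))"
proof (rule G.average_le_by_translates[OF finite_G Ker_subset])
  have finK: "finite Ker" using finite_subset[OF Ker_subset finite_G] .
  show K0: "Ker \<noteq> {}" by (auto simp: Ker_def)
  fix g assume g: "g \<in> {..<k} \<rightarrow>\<^sub>E carrier G"
  have gc: "g i \<in> carrier G" if "i < k" for i using g that by auto
  let ?g = "\<lambda>c. \<lambda>i\<in>{..<k}. g i \<otimes> c i"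
  have bad_iff: "bad k (?g c) \<longleftrightarrow> (\<exists>e\<in>Der - Inn. \<forall>i<k. e (g i \<otimes> c i) \<in> Comm (g i))"
    if c: "c \<in> {..<k} \<rightarrow>\<^sub>E Ker" for c
  proof -
    have "(\<forall>i<k. e (?g c i) \<in> Comm (?g c i)) = (\<forall>i<k. e (g i \<otimes> c i) \<in> Comm (g i))" for e
      using gc PiE_mem[OF c] by (simp add: Comm_mult_Ker)
    then show ?thesis unfolding bad_def by (intro bex_cong refl)
  qed
  have "average k Ker (\<lambda>c. of_bool (bad k (?g c)))
      = average k Ker (\<lambda>c. of_bool (\<exists>e\<in>Der - Inn. \<forall>i<k. e (g i \<otimes> c i) \<in> Comm (g i)))"
    unfolding average_def by (intro arg_cong2[where f = "(/)"] sum.cong refl arg_cong[where f = of_bool] bad_iff)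
  also have "\<dots> \<le> real (card (Der - Inn)) / real ((q - 1) * card Inn) * (\<Prod>i<k. 1 / real (card (Fix (g i))))"
  proof (rule average_ex_le[OF finK K0])
    show "finite (Der - Inn)" using finite_Der by simp
    show "(q - 1) * card Inn > 0" using two_le_q card_Inn_pos by simp
    show "real (card {c \<in> Ker. e (g i \<otimes> c) \<in> Comm (g i)}) = real (card Ker) * (1 / real (card (Fix (g i))))"
      if e: "e \<in> Der - Inn" and i: "i < k" for e i
    proof -
      have "card {c \<in> Ker. e (g i \<otimes> c) \<in> Comm (g i)} * card (Fix (g i)) = card Ker"
        using card_compatible_translates[OF _ _ KI gc[OF i]] e by auto
      then have "real (card {c \<in> Ker. e (g i \<otimes> c) \<in> Comm (g i)}) * real (card (Fix (g i))) = real (card Ker)"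
        by (metis of_nat_mult)
      moreover have "real (card (Fix (g i))) \<noteq> 0" using card_Fix_ge_1[OF gc[OF i]] by simp
      ultimately show ?thesis by (simp add: field_simps)
    qed
    fix c e assume c: "c \<in> {..<k} \<rightarrow>\<^sub>E Ker" and e: "e \<in> Der - Inn"
      and comp: "\<And>i. i < k \<Longrightarrow> e (g i \<otimes> c i) \<in> Comm (g i)"
    have cc: "c i \<in> Ker" "c i \<in> carrier G" if "i < k" for i using PiE_mem[OF c] that Ker_subset by auto
    have C: "Comm (g i \<otimes> c i) = Comm (g i)" if "i < k" for i using Comm_mult_Ker gc cc that by blast
    have "(q - 1) * card Inn \<le> card {e \<in> Der - Inn. \<forall>i<k. e (g i \<otimes> c i) \<in> Comm (g i \<otimes> c i)}"
      by (rule card_compatible_ge[of e]) (use e comp C gc cc in auto)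
    also have "{e \<in> Der - Inn. \<forall>i<k. e (g i \<otimes> c i) \<in> Comm (g i \<otimes> c i)}
        = {e \<in> Der - Inn. \<forall>i<k. e (g i \<otimes> c i) \<in> Comm (g i)}" using C by auto
    finally show "(q - 1) * card Inn \<le> card {e \<in> Der - Inn. \<forall>i<k. e (g i \<otimes> c i) \<in> Comm (g i)}" .
  qed
  finally have "average k Ker (\<lambda>c. of_bool (bad k (?g c))) \<le> outer_ratio * (\<Prod>i<k. 1 / real (card (Fix (g i))))"
    by (simp only: outer_ratio_def)
  moreover have "average k Ker (\<lambda>c. of_bool (bad k (?g c))) \<le> average k Ker (\<lambda>_. 1)"
    by (rule average_mono) simp
  ultimately show "average k Ker (\<lambda>c. of_bool (bad k (?g c)))
      \<le> min 1 (outer_ratio * (\<Prod>i<k. 1 / real (card (Fix (g i)))))"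
    using average_const[OF finK K0, of k 1] by simp
qed

lemma outer_ratio_nonneg: "0 \<le> outer_ratio" by (simp add: outer_ratio_def)

lemma outer_ratio_le:
  assumes "card Der \<le> card Inn * q ^ \<delta>"
  shows "outer_ratio \<le> (real q ^ \<delta> - 1) / (real q - 1)"
proof -
  have q2: "real q \<ge> 2" using two_le_q by simp
  have "real (card (Der - Inn)) = real (card Der) - real (card Inn)"
    using card_Diff_subset[OF finite_Inn Inn_subset] card_mono[OF finite_Der Inn_subset] by simp
  also have "\<dots> \<le> real (card Inn * q ^ \<delta>) - real (card Inn)" using assms by (simp only: of_nat_le_iff diff_right_mono)
  also have "\<dots> = real (card Inn) * (real q ^ \<delta> - 1)" by (simp add: algebra_simps)
  finally have "outer_ratio \<le> real (card Inn) * (real q ^ \<delta> - 1) / real ((q - 1) * card Inn)"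
    unfolding outer_ratio_def by (intro divide_right_mono) auto
  also have "\<dots> = (real q ^ \<delta> - 1) / (real q - 1)" using card_Inn_pos two_le_q by (simp add: of_nat_diff)
  finally show ?thesis .
qed

text \<open>For \<delta> = 1 the projective space has at most one point, which is the origin of
  \<theta>; otherwise q - 1 \<ge> 1 is simply dropped from the denominator.\<close>

lemma outer_ratio_le_power:
  assumes "card Der \<le> card Inn * q ^ \<delta>"
  shows "outer_ratio \<le> real q ^ (\<delta> * (if \<delta> = 1 then 0 else 1))"
proof -
  have q2: "real q \<ge> 2" using two_le_q by simp
  have p: "1 \<le> real q ^ \<delta>" using q2 by simp
  have "(real q ^ \<delta> - 1) / (real q - 1) \<le> real q ^ (\<delta> * (if \<delta> = 1 then 0 else 1))"
  proof (cases "\<delta> = 1")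
    case False
    have "(real q ^ \<delta> - 1) / (real q - 1) \<le> (real q ^ \<delta> - 1) / 1" using q2 p by (intro divide_left_mono) auto
    then show ?thesis using False by simp
  qed (use q2 in simp)
  then show ?thesis using outer_ratio_le[OF assms] by simp
qed

text \<open>The subspace contains all multiples of a nonzero vector, and there are \<open>q\<close>
  of them by \<open>End_inj\<close>.\<close>

lemma q_le_card_subspace:
  assumes W: "subgroup W V" "W \<noteq> {0\<^sub>V}" and inv: "\<And>\<alpha> w. \<lbrakk>\<alpha> \<in> F; w \<in> W\<rbrakk> \<Longrightarrow> \<alpha> w \<in> W"
  shows "q \<le> card W"
proof -
  obtain w where w: "w \<in> W" "w \<noteq> 0\<^sub>V" using W subgroup.one_closed[OF W(1)] by blast
  have wV: "w \<in> carrier V" using w W subgroup.mem_carrier by metis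
  have "inj_on (\<lambda>\<alpha>. \<alpha> w) F" using End_inj wV w by (intro inj_onI) blast
  moreover have "(\<lambda>\<alpha>. \<alpha> w) ` F \<subseteq> W" using inv w by auto
  moreover have "finite W" using finite_subset[OF subgroup.subset[OF W(1)] finite_V] .
  ultimately show ?thesis unfolding q_mod_def by (rule card_inj_on_le)
qed

lemma q_le_card_Fix: "\<lbrakk>g \<in> carrier G; Fix g \<noteq> {0\<^sub>V}\<rbrakk> \<Longrightarrow> q \<le> card (Fix g)"
  by (rule q_le_card_subspace[OF Fix_subgroup]) (auto simp: Fix_def End_act[symmetric])

lemma q_le_card_V: "q \<le> card (carrier V)"
  by (rule q_le_card_subspace[OF V.subgroup_self nontrivial]) auto

text \<open>All elements of the stabiliser of one nonzero vector have a nonzero fixed point, and its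
  index, the length of an orbit in V, is at most |V|.\<close>

lemma card_Fix_nontrivial:
  "card (carrier G) \<le> card (carrier V) * card {g \<in> carrier G. Fix g \<noteq> {0\<^sub>V}}"
proof -
  obtain v where v: "v \<in> carrier V" "v \<noteq> 0\<^sub>V" using nontrivial by auto
  define S where "S = {g \<in> carrier G. \<phi> g v = v}"
  have finS: "finite S" using finite_G by (simp add: S_def)
  have fib: "card {g \<in> carrier G. \<phi> g v = u} \<le> card S" for u
  proof (cases "{g \<in> carrier G. \<phi> g v = u} = {}")
    case False
    then obtain a where a: "a \<in> carrier G" "\<phi> a v = u" by auto
    show ?thesis
    proof (rule card_inj_on_le[OF _ _ finS])
      show "inj_on (\<lambda>g. inv a \<otimes> g) {g \<in> carrier G. \<phi> g v = u}" using a by (auto simp: inj_on_def)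
      show "(\<lambda>g. inv a \<otimes> g) ` {g \<in> carrier G. \<phi> g v = u} \<subseteq> S"
        using a v by (auto simp: S_def act_mult)
    qed
  next
    case True
    then show ?thesis by (simp only: card.empty)
  qed
  have un: "(\<Union>u\<in>carrier V. {g \<in> carrier G. \<phi> g v = u}) = carrier G" using v by auto
  have "card (carrier G) \<le> (\<Sum>u\<in>carrier V. card {g \<in> carrier G. \<phi> g v = u})"
    using card_UN_le[OF finite_V, of "\<lambda>u. {g \<in> carrier G. \<phi> g v = u}"] by (simp only: un)
  also have "\<dots> \<le> (\<Sum>u\<in>carrier V. card S)" using fib by (intro sum_mono)
  also have "\<dots> = card (carrier V) * card S" by simp
  also have "card S \<le> card {g \<in> carrier G. Fix g \<noteq> {0\<^sub>V}}"
    by (rule card_mono) (use v finite_G in \<open>auto simp: S_def Fix_def\<close>)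
  finally show ?thesis by simp
qed

lemma Fix_Ker: "g \<in> Ker \<Longrightarrow> Fix g = carrier V" by (auto simp: Fix_def Ker_act)

text \<open>Each element of P shrinks the bound by a factor of at least q ^ m, so \<open>t\<close>
  of them bring it down to 1, and each has to be awaited for an expected time of at most 1 / p. With
  m = 1, P consists of the elements with a nonzero fixed point and p = 1 / |V|; with m = n, P is
  \<open>Ker\<close> and p = 1 / |H|.\<close>

lemma sum_average_bad_le:
  assumes KI: "Van Ker \<subseteq> Inn" and \<delta>: "card Der \<le> card Inn * q ^ \<delta>"
    and m: "m > 0" and t: "\<delta> * (if \<delta> = 1 then 0 else 1) \<le> m * t"
    and P: "P \<subseteq> carrier G" "p * real (card (carrier G)) \<le> real (card P)" "0 < p"
    and Fix: "\<And>g. g \<in> P \<Longrightarrow> q ^ m \<le> card (Fix g)"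
  shows "(\<Sum>k<n. average k (carrier G) (\<lambda>g. of_bool (bad k g)))
    \<le> (real t + real q ^ m / (real q ^ m - 1)) / p"
proof -
  let ?s = "\<delta> * (if \<delta> = 1 then 0 else 1)" and ?r = "1 / real q ^ m"
  have q2: "real q \<ge> 2" using two_le_q by simp
  have Q1: "real q ^ m > 1" using q2 m by (intro one_less_power) auto
  have "0 \<le> 1 / x \<and> 1 / x < 1 \<and> 1 / (1 - 1 / x) = x / (x - 1)" if "x > 1" for x :: real
    using that by (simp add: field_simps)
  note r = this[OF Q1]
  have "(\<Sum>k<n. average k (carrier G) (\<lambda>g. of_bool (bad k g)))
    \<le> (\<Sum>k<n. average k (carrier G) (\<lambda>g. min 1 (outer_ratio * (\<Prod>i<k. 1 / real (card (Fix (g i)))))))"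
    by (intro sum_mono average_bad_le KI)
  also have "\<dots> \<le> geometric_cap ?r outer_ratio / p"
  proof (rule sum_average_min_le[OF finite_G G.carrier_not_empty P])
    show "1 / real (card (Fix y)) \<le> 1" if "y \<in> carrier G" for y using card_Fix_ge_1[OF that] by simp
    show "1 / real (card (Fix y)) \<le> ?r" if "y \<in> P" for y
    proof -
      have le: "real q ^ m \<le> real (card (Fix y))" using Fix[OF that] by (metis of_nat_le_iff of_nat_power)
      have "0 < real (card (Fix y)) * real q ^ m" using le Q1 by (intro mult_pos_pos) linarith+
      then show ?thesis using le by (intro divide_left_mono) auto
    qed
  qed (use r outer_ratio_nonneg in auto)
  also have "geometric_cap ?r outer_ratio \<le> real t + 1 / (1 - ?r)"
  proof (rule geometric_cap_le)
    have "outer_ratio * ?r ^ t \<le> real q ^ ?s * ?r ^ t"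
      using outer_ratio_le_power[OF \<delta>] q2 by (intro mult_right_mono) auto
    also have "\<dots> \<le> real q ^ (m * t) * ?r ^ t"
      using q2 t by (intro mult_right_mono power_increasing) auto
    also have "\<dots> = 1" using q2 by (simp add: power_mult power_mult_distrib[symmetric])
    finally show "outer_ratio * ?r ^ t \<le> 1" .
  qed (use r outer_ratio_nonneg in auto)
  also have "1 / (1 - ?r) = real q ^ m / (real q ^ m - 1)" using r by blast
  finally show ?thesis using P(3) by (simp add: divide_right_mono)
qed

lemma sum_average_bad_le_1:
  assumes KI: "Van Ker \<subseteq> Inn" and \<delta>: "card Der \<le> card Inn * q ^ \<delta>"
  shows "(\<Sum>k<n. average k (carrier G) (\<lambda>g. of_bool (bad k g)))
    \<le> (real (\<delta> * (if \<delta> = 1 then 0 else 1)) + real q / (real q - 1)) * real (card (carrier V))"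
proof -
  let ?P = "{g \<in> carrier G. Fix g \<noteq> {0\<^sub>V}}"
  have V0: "real (card (carrier V)) > 0" using finite_V by (simp add: card_gt_0_iff V.carrier_not_empty)
  have "real (card (carrier G)) \<le> real (card (carrier V)) * real (card ?P)"
    using card_Fix_nontrivial by (simp only: of_nat_mult[symmetric] of_nat_le_iff)
  then have P: "1 / real (card (carrier V)) * real (card (carrier G)) \<le> real (card ?P)"
    using V0 by (simp add: field_simps)
  show ?thesis
    using sum_average_bad_le[OF KI \<delta>, of 1 "\<delta> * (if \<delta> = 1 then 0 else 1)" ?P "1 / real (card (carrier V))" n]
      P V0 q_le_card_Fix by simp
qed

lemma sum_average_bad_le_2:
  assumes KI: "Van Ker \<subseteq> Inn" and \<delta>: "card Der \<le> card Inn * q ^ \<delta>"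
    and n: "card (carrier V) = q ^ m"
  shows "(\<Sum>k<l. average k (carrier G) (\<lambda>g. of_bool (bad k g)))
    \<le> (real_of_int \<lceil>real (\<delta> * (if \<delta> = 1 then 0 else 1)) / real m\<rceil> + real q ^ m / (real q ^ m - 1))
        * (real (card (carrier G)) / real (card Ker))"
proof -
  let ?s = "\<delta> * (if \<delta> = 1 then 0 else 1)"
  define t where "t = nat \<lceil>real ?s / real m\<rceil>"
  have "card (carrier V) \<ge> 2" using q_le_card_V two_le_q by linarith
  then have m0: "m > 0" using n by (cases m) auto
  have K0: "real (card Ker) > 0"
    using one_Ker finite_subset[OF Ker_subset finite_G] by (auto simp: card_gt_0_iff)
  have G0: "real (card (carrier G)) > 0" using finite_G by (simp add: card_gt_0_iff G.carrier_not_empty)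
  have tr: "real t = real_of_int \<lceil>real ?s / real m\<rceil>" by (simp add: t_def)
  have "real ?s / real m \<le> real t" unfolding tr by linarith
  then have "real ?s \<le> real (m * t)" using m0 by (simp add: pos_divide_le_eq mult.commute)
  then have st: "?s \<le> m * t" by (simp only: of_nat_le_iff)
  have "(\<Sum>k<l. average k (carrier G) (\<lambda>g. of_bool (bad k g)))
    \<le> (real t + real q ^ m / (real q ^ m - 1)) / (real (card Ker) / real (card (carrier G)))"
    by (rule sum_average_bad_le[OF KI \<delta> m0 st Ker_subset]) (use K0 G0 n Fix_Ker in auto)
  then show ?thesis by (simp add: tr)
qed

end

section \<open>Bases over the endomorphism ring\<close>

context finite_irreducible_module
begin

definition lin where "lin S f = finprod V (\<lambda>s. f s s) S"

lemma lin_closed: "\<lbrakk>S \<subseteq> carrier V; f \<in> S \<rightarrow> F\<rbrakk> \<Longrightarrow> lin S f \<in> carrier V"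
  unfolding lin_def by (intro V.finprod_closed) (auto simp: Pi_def subset_iff)

lemma lin_insert:
  assumes "finite S" "v \<notin> S" "S \<subseteq> carrier V" "v \<in> carrier V" "f \<in> insert v S \<rightarrow> F"
  shows "lin (insert v S) f = f v v +\<^sub>V lin S f"
  unfolding lin_def by (rule V.finprod_insert) (use assms in \<open>auto simp: Pi_def subset_iff\<close>)

lemma lin_cong: "\<lbrakk>S \<subseteq> carrier V; g \<in> S \<rightarrow> F; \<And>s. s \<in> S \<Longrightarrow> f s s = g s s\<rbrakk> \<Longrightarrow> lin S f = lin S g"
  unfolding lin_def by (intro V.finprod_cong) (auto simp: Pi_def subset_iff simp_implies_def)

lemma lin_diff:
  assumes "finite S" "S \<subseteq> carrier V" "f \<in> S \<rightarrow> F" "g \<in> S \<rightarrow> F"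
  shows "lin S (\<lambda>s. \<lambda>v\<in>carrier V. f s v -\<^sub>V g s v) = lin S f -\<^sub>V lin S g"
  using assms
proof (induction S)
  case empty
  then show ?case by (simp add: lin_def)
next
  case (insert v S)
  define h where "h = (\<lambda>s. \<lambda>v\<in>carrier V. f s v -\<^sub>V g s v)"
  have h: "h \<in> insert v S \<rightarrow> F" using insert.prems by (auto simp: h_def intro!: End_diff)
  have "lin S h = lin S f -\<^sub>V lin S g" unfolding h_def using insert by (intro insert.IH) auto
  moreover have "h v v = f v v -\<^sub>V g v v" using insert.prems by (simp add: h_def)
  moreover have "lin (insert v S) h = h v v +\<^sub>V lin S h" using insert h by (intro lin_insert) auto
  ultimately have "lin (insert v S) h = (f v v -\<^sub>V g v v) +\<^sub>V (lin S f -\<^sub>V lin S g)" by simp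
  also have "\<dots> = lin (insert v S) f -\<^sub>V lin (insert v S) g"
    using insert lin_closed[of S f] lin_closed[of S g] by (simp add: lin_insert vdiff_swap)
  finally show ?case by (simp only: h_def)
qed

lemma End_comp: "\<lbrakk>\<alpha> \<in> F; \<beta> \<in> F\<rbrakk> \<Longrightarrow> (\<lambda>v\<in>carrier V. \<beta> (\<alpha> v)) \<in> F"
  by (rule EndI) (simp_all add: End_add End_act)

lemma End_lin:
  assumes "finite S" "S \<subseteq> carrier V" "f \<in> S \<rightarrow> F" "\<beta> \<in> F"
  shows "\<beta> (lin S f) = lin S (\<lambda>s. \<lambda>v\<in>carrier V. \<beta> (f s v))"
  using assms
proof (induction S)
  case empty
  then show ?case by (simp add: lin_def)
next
  case (insert v S)
  define h where "h = (\<lambda>s. \<lambda>v\<in>carrier V. \<beta> (f s v))"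
  have h: "h \<in> insert v S \<rightarrow> F" 
  proof
    fix s assume "s \<in> insert v S"
    then have "f s \<in> F" using insert.prems by auto
    then show "h s \<in> F" unfolding h_def by (rule End_comp[OF _ \<open>\<beta> \<in> F\<close>])
  qed
  have "lin S h = \<beta> (lin S f)" unfolding h_def using insert by (intro insert.IH[symmetric]) auto
  moreover have "h v v = \<beta> (f v v)" using insert.prems by (simp add: h_def)
  moreover have "lin (insert v S) h = h v v +\<^sub>V lin S h" using insert h by (intro lin_insert) auto
  ultimately have "lin (insert v S) h = \<beta> (f v v) +\<^sub>V \<beta> (lin S f)" by simp
  also have "\<dots> = \<beta> (lin (insert v S) f)"
    using insert lin_closed[of S f] by (simp add: lin_insert End_add)
  finally show ?case by (simp only: h_def)
qed

definition indep where
  "indep S \<longleftrightarrow> S \<subseteq> carrier V \<and> inj_on (lin S) (S \<rightarrow>\<^sub>E F)"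

text \<open>If two combinations agreed with different coefficients at \<open>v\<close>, the
  difference of these coefficients would be invertible, and solving for \<open>v\<close> would put
  it into the span of S.\<close>

lemma indep_insert:
  assumes S: "indep S" and v: "v \<in> carrier V" "v \<notin> lin S ` (S \<rightarrow>\<^sub>E F)" and vS: "v \<notin> S"
  shows "indep (insert v S)"
  unfolding indep_def
proof (intro conjI inj_onI)
  have Sc: "S \<subseteq> carrier V" using S by (simp add: indep_def)
  have fin: "finite S" using finite_subset[OF Sc finite_V] .
  show "insert v S \<subseteq> carrier V" using Sc v by simp
  fix f g assume f: "f \<in> insert v S \<rightarrow>\<^sub>E F" and g: "g \<in> insert v S \<rightarrow>\<^sub>E F" and eq: "lin (insert v S) f = lin (insert v S) g"
  have ff: "f \<in> S \<rightarrow> F" "g \<in> S \<rightarrow> F" "f v \<in> F" "g v \<in> F" "f \<in> insert v S \<rightarrow> F" "g \<in> insert v S \<rightarrow> F"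
    using f g by auto
  have c: "lin S f \<in> carrier V" "lin S g \<in> carrier V" "f v v \<in> carrier V" "g v v \<in> carrier V"
    using lin_closed[OF Sc] ff v by auto
  have eq': "f v v +\<^sub>V lin S f = g v v +\<^sub>V lin S g"
    using eq lin_insert[OF fin vS Sc v(1) ff(5)] lin_insert[OF fin vS Sc v(1) ff(6)] by simp
  have fg: "f v = g v"
  proof (rule ccontr)
    assume ne: "f v \<noteq> g v"
    define \<gamma> where "\<gamma> = (\<lambda>w\<in>carrier V. g v w -\<^sub>V f v w)"
    have \<gamma>: "\<gamma> \<in> F" unfolding \<gamma>_def using ff by (intro End_diff)
    have \<gamma>v: "\<gamma> v = lin S f -\<^sub>V lin S g"
    proof -
      have "lin S f +\<^sub>V f v v = lin S g +\<^sub>V g v v" using eq' c by (simp add: V.m_comm)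
      then have "lin S f = lin S g +\<^sub>V g v v -\<^sub>V f v v" using c by (metis V.m_closed vdiff_eq_iff)
      then have "lin S f = (g v v -\<^sub>V f v v) +\<^sub>V lin S g" using c by (simp add: V.m_ac)
      then have "lin S f -\<^sub>V lin S g = g v v -\<^sub>V f v v" using c by (subst vdiff_eq_iff) auto
      then show ?thesis using v by (simp add: \<gamma>_def)
    qed
    have v0: "v \<noteq> 0\<^sub>V"
    proof
      assume "v = 0\<^sub>V"
      define z where "z = (\<lambda>s\<in>S. \<lambda>v\<in>carrier V. 0\<^sub>V)"
      have "z \<in> S \<rightarrow>\<^sub>E F" using zero_End by (auto simp: z_def)
      moreover have "lin S z = 0\<^sub>V" unfolding lin_def
        by (rule V.finprod_one_eqI) (use Sc in \<open>auto simp: z_def\<close>)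
      ultimately show False using v(2) \<open>v = 0\<^sub>V\<close> by (metis image_eqI)
    qed
    have "\<gamma> v \<noteq> 0\<^sub>V"
    proof
      assume "\<gamma> v = 0\<^sub>V"
      then have "g v v = f v v" using c v by (simp add: \<gamma>_def vdiff_zero_iff)
      then show False using End_inj[OF ff(4,3) v(1) v0] ne by simp
    qed
    then obtain \<beta> where \<beta>: "\<beta> \<in> F" "\<And>w. w \<in> carrier V \<Longrightarrow> \<beta> (\<gamma> w) = w" using End_inverse[OF \<gamma> v(1)] by blast
    define h where "h = (\<lambda>s\<in>S. \<lambda>w\<in>carrier V. \<beta> ((\<lambda>w\<in>carrier V. f s w -\<^sub>V g s w) w))"
    have h: "h \<in> S \<rightarrow>\<^sub>E F" unfolding h_def using ff \<beta> by (intro restrict_PiE_iff[THEN iffD2] ballI End_comp End_diff) auto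
    have "v = \<beta> (\<gamma> v)" using \<beta> v by simp
    also have "\<dots> = \<beta> (lin S (\<lambda>s. \<lambda>w\<in>carrier V. f s w -\<^sub>V g s w))" using \<gamma>v lin_diff[OF fin Sc ff(1,2)] by simp
    also have "\<dots> = lin S (\<lambda>s. \<lambda>w\<in>carrier V. \<beta> ((\<lambda>w\<in>carrier V. f s w -\<^sub>V g s w) w))"
      by (rule End_lin[OF fin Sc _ \<beta>(1)]) (use ff in \<open>auto intro!: End_diff\<close>)
    also have "\<dots> = lin S h"
      by (rule lin_cong[OF Sc]) (use h in \<open>auto simp: h_def\<close>)
    finally show False using v(2) h by blast
  qed
  then have "lin S f = lin S g" using eq' c by simp
  moreover have "lin S (restrict f S) = lin S f" "lin S (restrict g S) = lin S g"
    using lin_cong[OF Sc ff(1), of "restrict f S"] lin_cong[OF Sc ff(2), of "restrict g S"] by auto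
  moreover have "restrict f S \<in> S \<rightarrow>\<^sub>E F" "restrict g S \<in> S \<rightarrow>\<^sub>E F" using ff by auto
  ultimately have r: "restrict f S = restrict g S" using S unfolding indep_def inj_on_def by metis
  show "f = g"
  proof (rule PiE_ext[OF f g])
    fix s assume "s \<in> insert v S"
    then show "f s = g s" using fg fun_cong[OF r, of s] by (cases "s = v") auto
  qed
qed

text \<open>A maximal independent set spans, by \<open>indep_insert\<close>. A basis is what gives
  the definite description \<open>n_mod\<close> a value.\<close>

lemma ex_basis: "\<exists>S. is_End_basis G V \<phi> S"
proof -
  let ?A = "{S. S \<subseteq> carrier V \<and> indep S}"
  have "finite ?A" using finite_V by (simp add: finite_Collect_conjI)
  have "{} \<in> ?A" by (simp add: indep_def)
  then have "?A \<noteq> {}" by blast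
  with \<open>finite ?A\<close> have "\<exists>S\<in>?A. \<forall>T\<in>?A. S \<subseteq> T \<longrightarrow> S = T" by (intro finite_has_maximal)
  then obtain S where "S \<in> ?A" "\<forall>T\<in>?A. S \<subseteq> T \<longrightarrow> S = T" ..
  then have S: "S \<in> ?A" "\<And>T. T \<in> ?A \<Longrightarrow> S \<subseteq> T \<Longrightarrow> S = T" by blast+
  have Sc: "S \<subseteq> carrier V" and ind: "indep S" using S by auto
  have cl: "lin S f \<in> carrier V" if "f \<in> S \<rightarrow>\<^sub>E F" for f using lin_closed[OF Sc] that by auto
  have mem: "s \<in> lin S ` (S \<rightarrow>\<^sub>E F)" if s: "s \<in> S" for s
  proof -
    define z where "z = (\<lambda>t\<in>S. if t = s then (\<lambda>v\<in>carrier V. v) else (\<lambda>v\<in>carrier V. 0\<^sub>V))"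
    have z: "z \<in> S \<rightarrow>\<^sub>E F" using zero_End id_End by (auto simp: z_def)
    have sv: "s \<in> carrier V" using s Sc by auto
    have "lin S z = finprod V (\<lambda>t. if s = t then (\<lambda>_. s) t else 0\<^sub>V) S"
      unfolding lin_def by (rule V.finprod_cong) (use Sc sv in \<open>auto simp: z_def simp_implies_def\<close>)
    also have "\<dots> = s"
      using V.finprod_singleton[OF s finite_subset[OF Sc finite_V], of "\<lambda>_. s"] sv by simp
    finally show ?thesis using z by (metis image_eqI)
  qed
  have sur: "v \<in> lin S ` (S \<rightarrow>\<^sub>E F)" if v: "v \<in> carrier V" for v
  proof (rule ccontr)
    assume n: "v \<notin> lin S ` (S \<rightarrow>\<^sub>E F)"
    then have vS: "v \<notin> S" using mem by blast
    have "insert v S \<in> ?A" using indep_insert[OF ind v n vS] v Sc by simp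
    then have "S = insert v S" using S(2) by blast
    then show False using vS by blast
  qed
  have "is_End_basis G V \<phi> S"
    unfolding is_End_basis_def lin_def[symmetric]
  proof (intro conjI ballI)
    show "finite S" using finite_subset[OF Sc finite_V] .
    show "S \<subseteq> carrier V" by fact
    fix v assume "v \<in> carrier V"
    then obtain f where f: "f \<in> S \<rightarrow>\<^sub>E F" "v = lin S f" using sur by blast
    then show "\<exists>!f. f \<in> S \<rightarrow>\<^sub>E F \<and> lin S f = v" using ind unfolding indep_def inj_on_def by metis
  qed
  then show ?thesis by blast
qed

lemma card_V_basis:
  assumes "is_End_basis G V \<phi> S" shows "card (carrier V) = q ^ card S"
proof -
  have S: "finite S" "S \<subseteq> carrier V" "\<And>v. v \<in> carrier V \<Longrightarrow> \<exists>!f. f \<in> S \<rightarrow>\<^sub>E F \<and> lin S f = v"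
    using assms unfolding is_End_basis_def lin_def by auto
  have "bij_betw (lin S) (S \<rightarrow>\<^sub>E F) (carrier V)"
    unfolding bij_betw_def
  proof (intro conjI inj_onI equalityI subsetI)
    have cl: "lin S f \<in> carrier V" if "f \<in> S \<rightarrow>\<^sub>E F" for f using lin_closed[OF S(2)] that by auto
    show "f = g" if "f \<in> S \<rightarrow>\<^sub>E F" "g \<in> S \<rightarrow>\<^sub>E F" "lin S f = lin S g" for f g
      using S(3)[OF cl[OF that(1)]] that by metis
    show "v \<in> carrier V" if "v \<in> lin S ` (S \<rightarrow>\<^sub>E F)" for v using that cl by blast
    show "v \<in> lin S ` (S \<rightarrow>\<^sub>E F)" if "v \<in> carrier V" for v using S(3)[OF that] by blast
  qed
  from bij_betw_same_card[OF this] show ?thesis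
    using card_PiE[OF S(1), of "\<lambda>_. F"] by (simp add: q_mod_def)
qed

text \<open>All bases have the same size, since q ^ n determines n for q \<ge> 2; so exactly one
  number meets the description.\<close>

lemma card_V_eq: "card (carrier V) = q ^ n_mod G V \<phi>"
proof -
  obtain S where S: "is_End_basis G V \<phi> S" using ex_basis by blast
  have "n_mod G V \<phi> = card S"
    unfolding n_mod_def
  proof (rule the_equality)
    fix n assume "\<exists>T. is_End_basis G V \<phi> T \<and> card T = n"
    then have "q ^ n = q ^ card S" using card_V_basis S by metis
    then show "n = card S" using two_le_q by simp
  qed (use S in blast)
  then show ?thesis using card_V_basis[OF S] by simp
qed

end

section \<open>Maximal subgroups of soluble groups\<close>

lemma (in group) inv_cancel_left:
  "\<lbrakk>g \<in> carrier G; z \<in> carrier G\<rbrakk> \<Longrightarrow> inv g \<otimes> (g \<otimes> z) = z"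
  "\<lbrakk>g \<in> carrier G; z \<in> carrier G\<rbrakk> \<Longrightarrow> g \<otimes> (inv g \<otimes> z) = z"
  by (simp_all add: m_assoc[symmetric])

text \<open>The product of N and the derived subgroup of L is normal in G and lies between N and L.
  Were it L, the image of L in G / N would equal its own derived subgroup, so the derived series
  could never make it trivial.\<close>

lemma (in group) solvable_abelian_section:
  assumes sol: "solvable G" and ch: "chief_factor G L N"
  shows "abelian_section G L N"
proof -
  note C = chief_factorD[OF ch]
  interpret N: normal N G by (rule C(2))
  interpret h: group_hom G "G Mod N" "\<lambda>x. N #> x"
    by (intro group_hom.intro group_hom_axioms.intro N.r_coset_hom_Mod is_group N.factorgroup_is_group)
  have sL: "subgroup L G" using C(1) normal_imp_subgroup by blast
  have Lc: "L \<subseteq> carrier G" by (rule subgroup.subset[OF sL])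
  let ?D = "derived G L"
  have D: "?D \<lhd> G" by (rule derived_is_normal[OF C(1)])
  have sD: "subgroup ?D G" using D normal_imp_subgroup by blast
  have DL: "?D \<subseteq> L" by (rule derived_incl[OF subset_refl sL])
  let ?T = "N <#> ?D"
  have NT: "N \<subseteq> ?T"
  proof
    fix n assume "n \<in> N"
    then have "n = n \<otimes> \<one>" "\<one> \<in> ?D" using subgroup.one_closed[OF sD] by auto
    then show "n \<in> ?T" using \<open>n \<in> N\<close> unfolding set_mult_def by blast
  qed
  have "?T \<lhd> G" unfolding normal_inv_iff
  proof (intro conjI ballI)
    show "subgroup ?T G" by (rule mult_norm_subgroup[OF C(2) sD])
    fix g t assume g: "g \<in> carrier G" and "t \<in> ?T"
    then obtain n d where nd: "n \<in> N" "d \<in> ?D" "t = n \<otimes> d" unfolding set_mult_def by blast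
    have c: "n \<in> carrier G" "d \<in> carrier G" using nd subgroup.mem_carrier[OF sD] by auto
    have "g \<otimes> t \<otimes> inv g = (g \<otimes> n \<otimes> inv g) \<otimes> (g \<otimes> d \<otimes> inv g)"
      using g c by (simp add: nd(3) m_assoc inv_cancel_left)
    then show "g \<otimes> t \<otimes> inv g \<in> ?T"
      using normal_conj[OF C(2) g nd(1)] normal_conj[OF D g nd(2)] unfolding set_mult_def by blast
  qed
  moreover have "?T \<subseteq> L" using C(3) DL subgroup.m_closed[OF sL] unfolding set_mult_def by blast
  ultimately have "?T = N \<or> ?T = L" using C(5) NT by blast
  moreover have "?T \<noteq> L"
  proof
    assume T: "?T = L"
    have "N #> x \<in> (\<lambda>x. N #> x) ` ?D" if "x \<in> L" for x
    proof -
      have "x \<in> ?T" using T that by simp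
      then obtain n d where nd: "n \<in> N" "d \<in> ?D" "x = n \<otimes> d" unfolding set_mult_def by blast
      have "N #> x = N #> d"
        using nd subgroup.mem_carrier[OF sD nd(2)] coset_mult_assoc[of N n d] coset_join2[of n N] N.is_subgroup N.subset
        by simp
      then show ?thesis using nd(2) by blast
    qed
    then have "(\<lambda>x. N #> x) ` L = (\<lambda>x. N #> x) ` ?D" using DL by blast
    also have "\<dots> = derived (G Mod N) ((\<lambda>x. N #> x) ` L)" using h.derived_img[OF Lc] by simp
    finally have fixed: "derived (G Mod N) ((\<lambda>x. N #> x) ` L) = (\<lambda>x. N #> x) ` L" by simp
    have iter: "(derived (G Mod N) ^^ n) ((\<lambda>x. N #> x) ` L) = (\<lambda>x. N #> x) ` L" for n
      by (induction n) (simp_all add: fixed)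
    obtain m where m: "(derived G ^^ m) (carrier G) = {\<one>}"
      using sol unfolding solvable_iff_trivial_derived_seq by blast
    have "(derived G ^^ m) L \<subseteq> {\<one>}" using mono_exp_of_derived[OF Lc, of m] m by simp
    moreover have "(\<lambda>x. N #> x) ` L = (\<lambda>x. N #> x) ` (derived G ^^ m) L"
      using h.exp_of_derived_img[OF Lc, of m] iter[of m] by simp
    ultimately have "(\<lambda>x. N #> x) ` L \<subseteq> {N}" using coset_mult_one[OF N.subset] by auto
    then have "N #> x = N" if "x \<in> L" for x using that by blast
    then have "x \<in> N" if "x \<in> L" for x
      using that coset_join1[of N x] N.subset N.is_subgroup Lc by blast
    then show False using C(3,4) by blast
  qed
  ultimately have T: "?T = N" by blast
  have "?D \<subseteq> ?T"
  proof
    fix d assume "d \<in> ?D"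
    then have "d = \<one> \<otimes> d" using subgroup.mem_carrier[OF sD] by simp
    then show "d \<in> ?T" using \<open>d \<in> ?D\<close> N.one_closed unfolding set_mult_def by blast
  qed
  moreover have "x \<otimes> y \<otimes> inv x \<otimes> inv y \<in> ?D" if "x \<in> L" "y \<in> L" for x y
    unfolding derived_def by (rule generate.incl) (use that in auto)
  ultimately show ?thesis unfolding abelian_section_def using T by blast
qed

text \<open>M is a maximal subgroup above H, Y a largest normal subgroup of G inside M, and X / Y a
  minimal normal subgroup of G / Y. Maximality of M gives M X = G. The intersection of M and X is
  normalised by M, and by X since X / Y is abelian and Y lies in M; so it is normal in G and equals
  Y by the choice of Y.\<close>

lemma (in group) proper_subgroup_le_complement:
  assumes fin: "finite (carrier G)" and sol: "solvable G"
    and H: "subgroup H G" "H \<noteq> carrier G"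
  obtains M X Y where "subgroup M G" "H \<subseteq> M" "chief_factor G X Y" "M <#> X = carrier G" "M \<inter> X = Y"
proof -
  have "finite {M. subgroup M G \<and> M \<noteq> carrier G}"
    by (rule finite_subset[of _ "Pow (carrier G)"]) (use fin subgroup.subset in auto)
  then obtain M where M: "subgroup M G" "M \<noteq> carrier G" "H \<subseteq> M"
    and max: "\<And>K. \<lbrakk>subgroup K G; K \<noteq> carrier G; M \<subseteq> K\<rbrakk> \<Longrightarrow> K = M"
    using finite_has_maximal2[of "{M. subgroup M G \<and> M \<noteq> carrier G}" H] H by auto
  have Mc: "M \<subseteq> carrier G" by (rule subgroup.subset[OF M(1)])
  have finN: "finite {N. N \<lhd> G}"
    by (rule finite_subset[of _ "Pow (carrier G)"]) (use fin normal_imp_subgroup subgroup.subset in blast)+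
  have "{\<one>} \<lhd> G" "{\<one>} \<subseteq> M" using one_is_normal subgroup.one_closed[OF M(1)] by auto
  then have "{N. N \<lhd> G \<and> N \<subseteq> M} \<noteq> {}" by blast
  moreover have "finite {N. N \<lhd> G \<and> N \<subseteq> M}" by (rule finite_subset[OF _ finN]) blast
  ultimately have "\<exists>Y\<in>{N. N \<lhd> G \<and> N \<subseteq> M}. \<forall>N\<in>{N. N \<lhd> G \<and> N \<subseteq> M}. Y \<subseteq> N \<longrightarrow> Y = N"
    by (intro finite_has_maximal)
  then obtain Y where "Y \<in> {N. N \<lhd> G \<and> N \<subseteq> M}"
    and "\<forall>N\<in>{N. N \<lhd> G \<and> N \<subseteq> M}. Y \<subseteq> N \<longrightarrow> Y = N" ..
  then have Y: "Y \<lhd> G" "Y \<subseteq> M" and maxY: "\<And>N. \<lbrakk>N \<lhd> G; N \<subseteq> M; Y \<subseteq> N\<rbrakk> \<Longrightarrow> N = Y"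
    by blast+
  have "Y \<subset> carrier G" using Y M Mc by blast
  then have "{N. N \<lhd> G \<and> Y \<subset> N} \<noteq> {}" using normal_self by blast
  moreover have "finite {N. N \<lhd> G \<and> Y \<subset> N}" by (rule finite_subset[OF _ finN]) blast
  ultimately have "\<exists>X\<in>{N. N \<lhd> G \<and> Y \<subset> N}. \<forall>N\<in>{N. N \<lhd> G \<and> Y \<subset> N}. N \<subseteq> X \<longrightarrow> X = N"
    by (intro finite_has_minimal)
  then obtain X where "X \<in> {N. N \<lhd> G \<and> Y \<subset> N}"
    and "\<forall>N\<in>{N. N \<lhd> G \<and> Y \<subset> N}. N \<subseteq> X \<longrightarrow> X = N" ..
  then have X: "X \<lhd> G" "Y \<subset> X" and minX: "\<And>N. \<lbrakk>N \<lhd> G; Y \<subset> N; N \<subseteq> X\<rbrakk> \<Longrightarrow> N = X"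
    by blast+
  have ch: "chief_factor G X Y" unfolding chief_factor_def using X Y minX by blast
  have sX: "subgroup X G" using X normal_imp_subgroup by blast
  have Xc: "X \<subseteq> carrier G" by (rule subgroup.subset[OF sX])
  have XM: "\<not> X \<subseteq> M" using maxY[OF X(1)] X(2) by blast
  have commute: "M <#> X = X <#> M"
    using commut_normal[OF M(1) X(1)] .
  have prod: "M <#> X = carrier G"
  proof (rule ccontr)
    assume ne: "M <#> X \<noteq> carrier G"
    have s: "subgroup (M <#> X) G" unfolding commute by (rule mult_norm_subgroup[OF X(1) M(1)])
    have "M \<subseteq> M <#> X" 
    proof
      fix m assume "m \<in> M"
      then have "m = m \<otimes> \<one>" "\<one> \<in> X" using Mc subgroup.one_closed[OF sX] by auto
      then show "m \<in> M <#> X" using \<open>m \<in> M\<close> unfolding set_mult_def by blast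
    qed
    then have eq: "M <#> X = M" using max[OF s ne] by blast
    have "X \<subseteq> M <#> X"
    proof
      fix x assume "x \<in> X"
      then have "x = \<one> \<otimes> x" "\<one> \<in> M" using Xc subgroup.one_closed[OF M(1)] by auto
      then show "x \<in> M <#> X" using \<open>x \<in> X\<close> unfolding set_mult_def by blast
    qed
    then show False using eq XM by simp
  qed
  have ab: "abelian_section G X Y" by (rule solvable_abelian_section[OF sol ch])
  have "M \<inter> X \<lhd> G" unfolding normal_inv_iff
  proof (intro conjI ballI)
    show "subgroup (M \<inter> X) G" by (rule subgroups_Inter_pair[OF M(1) sX])
    fix g z assume g: "g \<in> carrier G" and z: "z \<in> M \<inter> X"
    obtain m x where mx: "m \<in> M" "x \<in> X" "g = m \<otimes> x" using g prod unfolding set_mult_def by blast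
    have c: "m \<in> carrier G" "x \<in> carrier G" "z \<in> carrier G" using mx z Mc Xc by auto
    have "x \<otimes> z \<otimes> inv x \<otimes> inv z \<in> Y" using ab mx z unfolding abelian_section_def by blast
    then have "(x \<otimes> z \<otimes> inv x \<otimes> inv z) \<otimes> z \<in> M" using Y z subgroup.m_closed[OF M(1)] by blast
    then have xM: "x \<otimes> z \<otimes> inv x \<in> M" using c by (simp add: m_assoc)
    have "m \<otimes> (x \<otimes> z \<otimes> inv x) \<otimes> inv m \<in> M"
      using subgroup.m_closed[OF M(1) subgroup.m_closed[OF M(1) mx(1) xM] subgroup.m_inv_closed[OF M(1) mx(1)]] .
    then have "g \<otimes> z \<otimes> inv g \<in> M" using c by (simp add: mx inv_mult_group m_assoc)
    then show "g \<otimes> z \<otimes> inv g \<in> M \<inter> X" using normal_conj[OF X(1) g] z by blast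
  qed
  then have "M \<inter> X = Y" using maxY[of "M \<inter> X"] Y X by blast
  then show ?thesis using that[OF M(1,3) ch prod] by blast
qed

section \<open>From complements to derivations\<close>

context finite_irreducible_module
begin

text \<open>Each g is x m with x in X and m in M, and x is determined up to Y, so the image of x in
  V under X / Y \<cong> V is a function of g. It is zero on M but not on X, whereas inner
  derivations vanish on X because X centralises X / Y.\<close>

lemma complement_derivation:
  assumes ch: "chief_factor G X Y" and ab: "abelian_section G X Y"
    and M: "subgroup M G" "M <#> X = carrier G" "M \<inter> X = Y"
    and iso: "G_isomorphic_to_section G V \<phi> X Y"
  obtains d where "d \<in> Der" "d \<notin> Inn" "\<And>m. m \<in> M \<Longrightarrow> d m = 0\<^sub>V"
proof -
  note ch = chief_factorD[OF ch]
  interpret X: normal X G by fact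
  interpret Y: normal Y G by fact
  have sX: "subgroup X G" and sY: "subgroup Y G" using X.is_subgroup Y.is_subgroup by auto
  have Xc: "x \<in> carrier G" if "x \<in> X" for x using that subgroup.mem_carrier[OF sX] by blast
  have Mc: "x \<in> carrier G" if "x \<in> M" for x using that subgroup.mem_carrier[OF M(1)] by blast
  have YnX: "Y \<lhd> G\<lparr>carrier := X\<rparr>" by (rule G.normal_restrict_supergroup[OF sX ch(2,3)])
  interpret Q: group "section_group G X Y" by (rule normal.factorgroup_is_group[OF YnX])
  have "G_isomorphic G (section_group G X Y) (section_action G X Y) V \<phi>"
    using iso unfolding G_isomorphic_to_section_def by (rule G_isomorphic_sym) (auto intro: V.is_group)
  then obtain f where f: "f \<in> iso (section_group G X Y) V"
    and fact: "\<And>g C. \<lbrakk>g \<in> carrier G; C \<in> carrier (section_group G X Y)\<rbrakk> \<Longrightarrow> f (section_action G X Y g C) = \<phi> g (f C)"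
    unfolding G_isomorphic_def by blast
  have bij: "bij_betw f (carrier (section_group G X Y)) (carrier V)" and fh: "f \<in> hom (section_group G X Y) V"
    using f by (auto simp: iso_def)
  define e where "e x = f (Y #> x)" for x
  have Qm: "Y #> x \<in> carrier (section_group G X Y)" if "x \<in> X" for x
    using that by (auto simp: G.carrier_section_group)
  have ec: "e x \<in> carrier V" if "x \<in> X" for x using Qm[OF that] fh unfolding e_def hom_def by blast
  have em: "e (x \<otimes> y) = e x +\<^sub>V e y" if "x \<in> X" "y \<in> X" for x y
  proof -
    have "Y #> (x \<otimes> y) = (Y #> x) <#> (Y #> y)" using Y.rcos_sum[OF Xc Xc] that by simp
    then show ?thesis using hom_mult[OF fh Qm[OF that(1)] Qm[OF that(2)]] by (simp add: e_def)
  qed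
  have eY: "e x = 0\<^sub>V \<longleftrightarrow> x \<in> Y" if x: "x \<in> X" for x
  proof -
    have one: "f Y = 0\<^sub>V" using hom_one[OF fh Q.is_group V.is_group] by simp
    have "e x = 0\<^sub>V \<longleftrightarrow> Y #> x = Y"
      using bij Qm[OF x] Qm[OF X.one_closed] one Y.subset G.coset_mult_one
      unfolding e_def bij_betw_def inj_on_def by metis
    also have "\<dots> \<longleftrightarrow> x \<in> Y"
      using G.coset_join1[of Y x] G.coset_join2[of x Y] Y.subset sY Xc[OF x] by blast
    finally show ?thesis .
  qed
  have econj: "e (g \<otimes> x \<otimes> inv g) = \<phi> g (e x)" if "g \<in> carrier G" "x \<in> X" for g x
    using fact[OF that(1) Qm[OF that(2)]] G.section_action_coset[OF ch(2) X.subset that] by (simp add: e_def)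
  have esurj: "\<exists>x\<in>X. e x = v" if "v \<in> carrier V" for v
  proof -
    have "v \<in> f ` carrier (section_group G X Y)" using bij that by (simp add: bij_betw_def)
    then show ?thesis by (auto simp: G.carrier_section_group e_def)
  qed
  have XK: "X \<subseteq> Ker"
  proof
    fix x assume x: "x \<in> X"
    have "\<phi> x v = v" if "v \<in> carrier V" for v
    proof -
      obtain y where y: "y \<in> X" "e y = v" using esurj \<open>v \<in> carrier V\<close> by blast
      define c where "c = x \<otimes> y \<otimes> inv x \<otimes> inv y"
      have c: "c \<in> Y" using ab x y unfolding abelian_section_def c_def by blast
      have "x \<otimes> y \<otimes> inv x = c \<otimes> y" using Xc x y by (simp add: c_def G.m_assoc)
      have cX: "c \<in> X" using c ch(3) by blast
      have "\<phi> x v = e (x \<otimes> y \<otimes> inv x)" using econj[OF Xc[OF x] y(1)] y(2) by simp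
      also have "\<dots> = e c +\<^sub>V e y" unfolding \<open>x \<otimes> y \<otimes> inv x = c \<otimes> y\<close> by (rule em[OF cX y(1)])
      also have "\<dots> = v" using eY[OF cX] c y(2) \<open>v \<in> carrier V\<close> by simp
      finally show ?thesis .
    qed
    then show "x \<in> Ker" using Xc[OF x] unfolding Ker_def by blast
  qed
  \<comment> \<open>The factors are put in the order x m, so that the X-part of a product (x m) (y
    n) is x times a conjugate of y.\<close>
  have dec: "\<exists>x m. x \<in> X \<and> m \<in> M \<and> g = x \<otimes> m" if g: "g \<in> carrier G" for g
  proof -
    obtain m x where mx: "m \<in> M" "x \<in> X" "g = m \<otimes> x" using g M(2) unfolding set_mult_def by blast
    then have "g = (m \<otimes> x \<otimes> inv m) \<otimes> m" using Xc Mc by (simp add: G.m_assoc)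
    moreover have "m \<otimes> x \<otimes> inv m \<in> X" using G.normal_conj[OF ch(1) Mc[OF mx(1)] mx(2)] .
    ultimately show ?thesis using mx by blast
  qed
  define s where "s g = (SOME x. x \<in> X \<and> (\<exists>m. m \<in> M \<and> g = x \<otimes> m))" for g
  define d where "d = (\<lambda>g\<in>carrier G. e (s g))"
  \<comment> \<open>Two decompositions of the same element differ by an element of the intersection
    of M and X, that is of Y, where \<open>e\<close> vanishes.\<close>
  have d: "d (x \<otimes> m) = e x" if x: "x \<in> X" and m: "m \<in> M" for x m
  proof -
    have c: "x \<in> carrier G" "m \<in> carrier G" using x m Xc Mc by auto
    have "\<exists>x'. x' \<in> X \<and> (\<exists>m'. m' \<in> M \<and> x \<otimes> m = x' \<otimes> m')" using x m by blast
    from someI_ex[OF this] obtain m' where s: "s (x \<otimes> m) \<in> X" "m' \<in> M" "x \<otimes> m = s (x \<otimes> m) \<otimes> m'"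
      unfolding s_def by blast
    define x' where "x' = s (x \<otimes> m)"
    have x': "x' \<in> X" "x \<otimes> m = x' \<otimes> m'" "x' \<in> carrier G" "m' \<in> carrier G" using s Xc Mc by (auto simp: x'_def)
    have "inv x' \<otimes> x = m' \<otimes> inv m"
    proof -
      have "x = x' \<otimes> m' \<otimes> inv m" using x'(2)[symmetric] c by (simp add: G.m_assoc)
      then show ?thesis using x' c by (simp add: G.m_assoc[symmetric])
    qed
    moreover have "m' \<otimes> inv m \<in> M" using s m M(1) by (auto intro!: subgroup.m_closed subgroup.m_inv_closed)
    moreover have "inv x' \<otimes> x \<in> X" using x x' sX by (auto intro!: subgroup.m_closed subgroup.m_inv_closed)
    ultimately have y: "inv x' \<otimes> x \<in> Y" using M(3) by auto
    have "x = x' \<otimes> (inv x' \<otimes> x)" using x' c by (simp add: G.m_assoc[symmetric])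
    then have "e x = e x' +\<^sub>V e (inv x' \<otimes> x)"
      using em[OF x'(1) subsetD[OF ch(3) y]] by simp
    also have "\<dots> = e x'" using eY[OF subsetD[OF ch(3) y]] y ec[OF x'(1)] by simp
    finally show ?thesis using c by (simp add: d_def x'_def)
  qed
  have dD: "d \<in> Der"
  proof (rule DerI)
    show "d \<in> extensional (carrier G)" by (simp add: d_def)
    show "d g \<in> carrier V" if "g \<in> carrier G" for g
    proof -
      obtain x m where "x \<in> X" "m \<in> M" "g = x \<otimes> m" using dec \<open>g \<in> carrier G\<close> by blast
      then show ?thesis using d ec by simp
    qed
    show "d (g \<otimes> h) = d g +\<^sub>V \<phi> g (d h)" if gh: "g \<in> carrier G" "h \<in> carrier G" for g h
    proof -
      obtain x m where xm: "x \<in> X" "m \<in> M" "g = x \<otimes> m" using dec gh(1) by blast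
      obtain y n where yn: "y \<in> X" "n \<in> M" "h = y \<otimes> n" using dec gh(2) by blast
      have c: "x \<in> carrier G" "m \<in> carrier G" "y \<in> carrier G" "n \<in> carrier G" using xm yn Xc Mc by auto
      have y': "m \<otimes> y \<otimes> inv m \<in> X" using G.normal_conj[OF ch(1) c(2) yn(1)] .
      have "g \<otimes> h = (x \<otimes> (m \<otimes> y \<otimes> inv m)) \<otimes> (m \<otimes> n)"
        using c by (simp add: xm yn G.m_assoc G.inv_cancel_left)
      moreover have "x \<otimes> (m \<otimes> y \<otimes> inv m) \<in> X" using subgroup.m_closed[OF sX xm(1) y'] .
      moreover have "m \<otimes> n \<in> M" using subgroup.m_closed[OF M(1) xm(2) yn(2)] .
      ultimately have "d (g \<otimes> h) = e (x \<otimes> (m \<otimes> y \<otimes> inv m))" using d by simp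
      also have "\<dots> = e x +\<^sub>V \<phi> m (e y)" using em[OF xm(1) y'] econj[OF c(2) yn(1)] by simp
      also have "\<phi> m (e y) = \<phi> g (e y)" using c ec[OF yn(1)] XK xm(1) by (auto simp: xm(3) act_mult Ker_act)
      finally show ?thesis using d[OF xm(1,2)] d[OF yn(1,2)] xm yn by simp
    qed
  qed
  have dM: "d m = 0\<^sub>V" if "m \<in> M" for m
    using d[OF subgroup.one_closed[OF sX] that] Mc[OF that] eY[OF subgroup.one_closed[OF sX]] subgroup.one_closed[OF sY]
    by simp
  have "d \<notin> Inn"
  proof
    assume dI: "d \<in> Inn"
    obtain v where v: "v \<in> carrier V" "v \<noteq> 0\<^sub>V" using nontrivial by auto
    obtain x where x: "x \<in> X" "e x = v" using esurj v by blast
    have "d x = v" using d[OF x(1) subgroup.one_closed[OF M(1)]] x Xc by simp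
    moreover have "d x = 0\<^sub>V" using Inn_Ker[OF dI] x XK by blast
    ultimately show False using v by simp
  qed
  then show ?thesis using that dD dM by blast
qed

text \<open>The derivation attached to the complement vanishes at the given conjugates, and
  \<open>Der_conj\<close> is solved for d (g i).\<close>

lemma bad_of_conjugates_in_complement:
  assumes ch: "chief_factor G X Y" and ab: "abelian_section G X Y"
    and M: "subgroup M G" "M <#> X = carrier G" "M \<inter> X = Y"
    and iso: "G_isomorphic_to_section G V \<phi> X Y"
    and g: "\<And>i. i < k \<Longrightarrow> g i \<in> carrier G" and x: "\<And>i. i < k \<Longrightarrow> x i \<in> carrier G"
    and conj: "\<And>i. i < k \<Longrightarrow> inv (x i) \<otimes> g i \<otimes> x i \<in> M"
  shows "bad k g"
proof -
  obtain d where d: "d \<in> Der" "d \<notin> Inn" "\<And>m. m \<in> M \<Longrightarrow> d m = 0\<^sub>V"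
    using complement_derivation[OF ch ab M iso] by blast
  have "d (g i) \<in> Comm (g i)" if i: "i < k" for i
  proof -
    note gx = g[OF i] x[OF i]
    have c: "d (g i) \<in> carrier V" "d (x i) \<in> carrier V" "\<phi> (g i) (d (x i)) \<in> carrier V" using d gx by auto
    have "\<phi> (inv (x i)) (d (g i) +\<^sub>V \<phi> (g i) (d (x i)) -\<^sub>V d (x i)) = 0\<^sub>V"
      using d(3)[OF conj[OF i]] Der_conj[OF d(1) gx] by simp
    then have "\<phi> (x i) (\<phi> (inv (x i)) (d (g i) +\<^sub>V \<phi> (g i) (d (x i)) -\<^sub>V d (x i))) = 0\<^sub>V" using gx by simp
    then have "d (g i) +\<^sub>V \<phi> (g i) (d (x i)) -\<^sub>V d (x i) = 0\<^sub>V" using gx c by simp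
    then have "d (g i) +\<^sub>V \<phi> (g i) (d (x i)) = d (x i)" using c by (simp add: vdiff_zero_iff)
    then have "d (g i) = d (x i) -\<^sub>V \<phi> (g i) (d (x i))" using c by (metis vdiff_eq_iff)
    then show ?thesis using c unfolding Comm_def by blast
  qed
  then show ?thesis using d unfolding bad_def by blast
qed

end

section \<open>The waiting time\<close>

text \<open>The tail-sum formula for the expectation, before integration: each length below the
  first success contributes 1, and if there is no success the sum is infinite.\<close>

lemma waiting_time_le:
  "waiting_time G g \<le> (\<Sum>k. of_bool (\<not> invariably_generates G k g) :: ennreal)"
proof (cases "\<exists>n. invariably_generates G n g")
  case True
  define n where "n = (LEAST n. invariably_generates G n g)"
  have n: "invariably_generates G n g" unfolding n_def using True by (rule LeastI_ex)
  have "waiting_time G g \<le> of_nat n"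
    unfolding waiting_time_def using n by (intro INF_lower) simp
  also have "of_nat n = (\<Sum>k<n. of_bool (\<not> invariably_generates G k g) :: ennreal)"
  proof -
    have "\<not> invariably_generates G k g" if "k < n" for k using not_less_Least that unfolding n_def by blast
    then show ?thesis by simp
  qed
  also have "\<dots> \<le> (\<Sum>k. of_bool (\<not> invariably_generates G k g))"
    by (rule sum_le_suminf) auto
  finally show ?thesis .
next
  case False
  then have "(\<Sum>k. of_bool (\<not> invariably_generates G k g) :: ennreal) = (\<Sum>k. 1)" by simp
  also have "\<dots> = \<infinity>"
  proof -
    have "of_nat n \<le> (\<Sum>k::nat. 1 :: ennreal)" for n
      using sum_le_suminf[of "\<lambda>_. 1 :: ennreal" "{..<n}"] by simp
    then show ?thesis
      using ennreal_Ex_less_of_nat[of "\<Sum>k::nat. 1 :: ennreal"] by (metis infinity_ennreal_def linorder_not_less top.not_eq_extremum)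
  qed
  finally show ?thesis by simp
qed

lemma invariably_generates_restrict:
  "invariably_generates G k (restrict g {..<k}) = invariably_generates G k g"
  unfolding invariably_generates_def by (intro ball_cong refl) (simp cong: image_cong_simp)

text \<open>The event depends on the first \<open>k\<close> coordinates only, so it is the preimage
  of a finite set of \<open>k\<close>-tuples, each of which has mass |G| ^ -k under the finite
  product measure.\<close>

lemma nn_integral_random_sequence:
  assumes fin: "finite (carrier G)" and ne: "carrier G \<noteq> {}"
    and local: "\<And>g. P (restrict g {..<k}) = P g"
  shows "(\<lambda>g. of_bool (P g) :: ennreal) \<in> borel_measurable (random_sequence G)"
    and "(\<integral>\<^sup>+ g. of_bool (P g) \<partial>random_sequence G) = ennreal (average k (carrier G) (\<lambda>g. of_bool (P g)))"
proof -
  let ?U = "uniform_count_measure (carrier G)"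
  interpret U: prob_space ?U by (rule prob_space_uniform_count_measure[OF fin ne])
  interpret product_prob_space "\<lambda>_. ?U" "UNIV :: nat set" ..
  let ?M = "PiM {..<k} (\<lambda>_. ?U)"
  let ?T = "{..<k} \<rightarrow>\<^sub>E carrier G"
  have sU: "space ?U = carrier G" by (simp add: space_uniform_count_measure)
  have sing: "{x} \<in> sets ?M \<and> emeasure ?M {x} = ennreal (1 / real (card (carrier G)) ^ k)" if x: "x \<in> ?T" for x
  proof -
    have eq: "{x} = (\<Pi>\<^sub>E i\<in>{..<k}. {x i})" using PiE_singleton[of x "{..<k}"] x by (auto simp: PiE_def)
    have s: "{x i} \<in> sets ?U" if "i < k" for i using that x by (auto simp: sets_uniform_count_measure)
    have "{x} \<in> sets ?M" unfolding eq using s by (intro sets_PiM_I_finite) auto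
    moreover have "emeasure ?M {x} = (\<Prod>i<k. emeasure ?U {x i})" unfolding eq
      using s by (intro emeasure_PiM) auto
    moreover have "emeasure ?U {x i} = ennreal (1 / real (card (carrier G)))" if "i < k" for i
      using that x by (subst emeasure_uniform_count_measure[OF fin]) auto
    ultimately show ?thesis by (simp add: ennreal_power power_one_over)
  qed
  define E where "E = {g \<in> ?T. P g}"
  have finE: "finite E" unfolding E_def using finite_PiE[of "{..<k}" "\<lambda>_. carrier G"] fin by simp
  have sE: "E \<in> sets ?M"
  proof -
    have "(\<Union>x\<in>E. {x}) \<in> sets ?M" using finE sing by (intro sets.finite_UN) (auto simp: E_def)
    then show ?thesis by simp
  qed
  have "emeasure ?M E = (\<Sum>x\<in>E. emeasure ?M {x})"
    using finE sing by (intro emeasure_eq_sum_singleton) (auto simp: E_def)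
  also have "\<dots> = (\<Sum>x\<in>E. ennreal (1 / real (card (carrier G)) ^ k))" using sing by (intro sum.cong) (auto simp: E_def)
  also have "\<dots> = ennreal (real (card E) * (1 / real (card (carrier G)) ^ k))"
    by (simp only: sum_constant ennreal_of_nat_eq_real_of_nat) (rule ennreal_mult[symmetric], auto)
  also have "real (card E) * (1 / real (card (carrier G)) ^ k) = average k (carrier G) (\<lambda>g. of_bool (P g))"
    unfolding average_def using fin by (subst sum_of_bool_eq) (auto simp: E_def finite_PiE intro!: arg_cong[where f = card])
  finally have emE: "emeasure ?M E = ennreal (average k (carrier G) (\<lambda>g. of_bool (P g)))" .
  have res: "(\<lambda>g. restrict g {..<k}) \<in> measurable (PiM UNIV (\<lambda>_. ?U)) ?M"
    by (intro measurable_restrict_subset) simp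
  let ?R = "PiM UNIV (\<lambda>_::nat. ?U)"
  have spR: "space ?R = (UNIV \<rightarrow>\<^sub>E carrier G)" by (simp add: space_PiM sU)
  have pre: "(\<lambda>g. restrict g {..<k}) -` E \<inter> space ?R = {g \<in> space ?R. P g}"
    using local by (auto simp: E_def spR)
  have set: "{g \<in> space ?R. P g} \<in> sets ?R" using measurable_sets[OF res sE] pre by simp
  have ind: "of_bool (P g) = (indicator {g \<in> space ?R. P g} g :: ennreal)" if "g \<in> space ?R" for g
    using that by (simp add: indicator_def)
  show "(\<lambda>g. of_bool (P g) :: ennreal) \<in> borel_measurable (random_sequence G)"
    unfolding random_sequence_def
    by (subst measurable_cong[OF ind]) (use set in auto)
  have "(\<integral>\<^sup>+ g. of_bool (P g) \<partial>?R) = (\<integral>\<^sup>+ g. indicator {g \<in> space ?R. P g} g \<partial>?R)"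
    by (rule nn_integral_cong) (use ind in simp)
  also have "\<dots> = emeasure ?R {g \<in> space ?R. P g}" using set by simp
  also have "\<dots> = emeasure (distr ?R ?M (\<lambda>g. restrict g {..<k})) E"
    using emeasure_distr[OF res sE] pre by simp
  also have "distr ?R ?M (\<lambda>g. restrict g {..<k}) = ?M"
    by (rule distr_PiM_restrict_finite) auto
  finally show "(\<integral>\<^sup>+ g. of_bool (P g) \<partial>random_sequence G) = ennreal (average k (carrier G) (\<lambda>g. of_bool (P g)))"
    unfolding random_sequence_def using emE by simp
qed

text \<open>A bound on the partial sums is enough, because the series of failure probabilities has
  nonnegative terms and is summed in \<open>ennreal\<close>.\<close>

lemma chebotarev_invariant_le:
  assumes fin: "finite (carrier G)" and ne: "carrier G \<noteq> {}"
    and le: "\<And>n. (\<Sum>k<n. average k (carrier G) (\<lambda>g. of_bool (\<not> invariably_generates G k g))) \<le> c"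
  shows "chebotarev_invariant G \<le> ennreal c"
proof -
  note I = nn_integral_random_sequence[OF fin ne, where P = "\<lambda>g. \<not> invariably_generates G k g" and k = k for k]
  have "chebotarev_invariant G \<le> (\<integral>\<^sup>+ g. (\<Sum>k. of_bool (\<not> invariably_generates G k g)) \<partial>random_sequence G)"
    unfolding chebotarev_invariant_def by (intro nn_integral_mono waiting_time_le)
  also have "\<dots> = (\<Sum>k. \<integral>\<^sup>+ g. of_bool (\<not> invariably_generates G k g) \<partial>random_sequence G)"
    by (intro nn_integral_suminf I(1)) (simp add: invariably_generates_restrict)
  also have "\<dots> = (\<Sum>k. ennreal (average k (carrier G) (\<lambda>g. of_bool (\<not> invariably_generates G k g))))"
    by (intro suminf_cong I(2)) (simp add: invariably_generates_restrict)
  also have "\<dots> \<le> ennreal c"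
  proof (rule suminf_le_const)
    fix n
    have "(\<Sum>k<n. ennreal (average k (carrier G) (\<lambda>g. of_bool (\<not> invariably_generates G k g))))
        = ennreal (\<Sum>k<n. average k (carrier G) (\<lambda>g. of_bool (\<not> invariably_generates G k g)))"
      by (intro sum_ennreal) (simp add: average_def sum_nonneg)
    then show "(\<Sum>k<n. ennreal (average k (carrier G) (\<lambda>g. of_bool (\<not> invariably_generates G k g)))) \<le> ennreal c"
      using le[of n] by (simp add: ennreal_leI)
  qed simp
  finally show ?thesis .
qed

section \<open>Pomerance's constant\<close>

lemma summable_zeta: "i \<ge> 2 \<Longrightarrow> summable (\<lambda>k. 1 / real (Suc k) ^ i)"
  using inverse_power_summable[of i, where 'a = real]
  by (subst summable_Suc_iff) (simp add: inverse_eq_divide)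

text \<open>In each term with base at least 2, two factors are kept to make the series converge and
  the other i - 2 are estimated by 1 / 2. The geometric decay in \<open>i\<close> is what makes the
  product and the sum in \<open>pomerance_sigma\<close> converge.\<close>

lemma zeta_nat_bounds:
  assumes i: "i \<ge> 2"
  shows "1 \<le> zeta_nat i" and "zeta_nat i - 1 \<le> zeta_nat 2 * (1 / 2) ^ (i - 2)"
proof -
  have split: "zeta_nat j = 1 + (\<Sum>k. 1 / real (Suc (Suc k)) ^ j)" if "j \<ge> 2" for j
    using suminf_split_head[OF summable_zeta[OF that]] by (simp add: zeta_nat_def)
  have sS: "summable (\<lambda>k. 1 / real (Suc (Suc k)) ^ j)" if "j \<ge> 2" for j
    using summable_zeta[OF that] by (subst (asm) summable_Suc_iff[symmetric])
  have "0 \<le> (\<Sum>k. 1 / real (Suc (Suc k)) ^ i)" by (rule suminf_nonneg[OF sS[OF i]]) simp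
  then show "1 \<le> zeta_nat i" using split[OF i] by simp
  have "0 \<le> (\<Sum>k. 1 / real (Suc (Suc k)) ^ 2)" by (rule suminf_nonneg[OF sS]) auto
  then have z2: "(\<Sum>k. 1 / real (Suc (Suc k)) ^ 2) \<le> zeta_nat 2" using split[of 2] by simp
  have "zeta_nat i - 1 = (\<Sum>k. 1 / real (Suc (Suc k)) ^ i)" using split[OF i] by simp
  also have "\<dots> \<le> (\<Sum>k. (1 / 2) ^ (i - 2) * (1 / real (Suc (Suc k)) ^ 2))"
  proof (rule suminf_le)
    fix k
    have "1 / real (Suc (Suc k)) ^ i = (1 / real (Suc (Suc k))) ^ (i - 2) * (1 / real (Suc (Suc k)) ^ 2)"
    proof -
      have "real (Suc (Suc k)) ^ i = real (Suc (Suc k)) ^ (i - 2) * real (Suc (Suc k)) ^ 2"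
        using i by (metis le_add_diff_inverse2 power_add)
      then show ?thesis by (simp add: power_one_over)
    qed
    also have "\<dots> \<le> (1 / 2) ^ (i - 2) * (1 / real (Suc (Suc k)) ^ 2)"
      by (intro mult_right_mono power_mono) (auto simp: field_simps)
    finally show "1 / real (Suc (Suc k)) ^ i \<le> (1 / 2) ^ (i - 2) * (1 / real (Suc (Suc k)) ^ 2)" .
  qed (use sS[OF i] summable_mult[OF sS[of 2], of "(1 / 2) ^ (i - 2)"] in \<open>auto simp del: of_nat_Suc\<close>)
  also have "\<dots> = (1 / 2) ^ (i - 2) * (\<Sum>k. 1 / real (Suc (Suc k)) ^ 2)"
    by (rule suminf_mult[OF sS]) simp
  also have "\<dots> \<le> (1 / 2) ^ (i - 2) * zeta_nat 2" using z2 by (intro mult_left_mono) auto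
  finally show "zeta_nat i - 1 \<le> zeta_nat 2 * (1 / 2) ^ (i - 2)" by (simp add: mult.commute)
qed

lemma inverse_zeta_bounds:
  assumes "i \<ge> 2"
  shows "0 < inverse (zeta_nat i)" "inverse (zeta_nat i) \<le> 1"
    "1 - inverse (zeta_nat i) \<le> zeta_nat 2 * (1 / 2) ^ (i - 2)"
proof -
  note z = zeta_nat_bounds[OF assms]
  show "0 < inverse (zeta_nat i)" using z by simp
  show "inverse (zeta_nat i) \<le> 1" using z by (simp add: inverse_le_1_iff)
  have "1 - inverse (zeta_nat i) \<le> zeta_nat i - 1"
  proof -
    have "2 * zeta_nat i \<le> zeta_nat i * zeta_nat i + 1"
      using zero_le_power2[of "zeta_nat i - 1"] by (simp add: power2_eq_square algebra_simps)
    then show ?thesis using z by (simp add: field_simps)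
  qed
  then show "1 - inverse (zeta_nat i) \<le> zeta_nat 2 * (1 / 2) ^ (i - 2)" using z by simp
qed

text \<open>The product of 1 / \<zeta>(i) over i \<ge> j + 2: the limit, as D grows, of the density
  of generating (D + 1 + j)-tuples in a free abelian group of rank D.\<close>

definition zeta_tail :: "nat \<Rightarrow> real" where
  "zeta_tail j = (\<Prod>k. inverse (zeta_nat (j + 2 + k)))"

lemma convergent_zeta_tail: "convergent_prod (\<lambda>k. inverse (zeta_nat (j + 2 + k)))"
proof -
  have "summable (\<lambda>k. norm (inverse (zeta_nat (j + 2 + k)) - 1))"
  proof (rule summable_comparison_test')
    show "summable (\<lambda>k. zeta_nat 2 * (1 / 2) ^ j * (1 / 2) ^ k)"
      by (intro summable_mult summable_geometric) simp
    fix k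
    show "norm (norm (inverse (zeta_nat (j + 2 + k)) - 1)) \<le> zeta_nat 2 * (1 / 2) ^ j * (1 / 2) ^ k"
      using inverse_zeta_bounds[of "j + 2 + k"] by (simp add: power_add abs_if)
  qed
  then show ?thesis
    by (intro abs_convergent_prod_imp_convergent_prod summable_imp_abs_convergent_prod)
qed

lemma zeta_tail_le_prod: "zeta_tail j \<le> (\<Prod>k<n. inverse (zeta_nat (j + 2 + k)))"
  unfolding zeta_tail_def
  by (rule prod_ge_prodinf[OF convergent_prod_has_prod[OF convergent_zeta_tail]])
    (use inverse_zeta_bounds in \<open>auto intro: less_imp_le\<close>)

text \<open>The Weierstrass inequality bounds the partial products below by one minus a sum,
  uniformly in their length; the factor 2 is the sum of the geometric series.\<close>

lemma one_minus_zeta_tail_le: "1 - zeta_tail j \<le> 2 * zeta_nat 2 * (1 / 2) ^ j"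
proof -
  have le: "1 - 2 * zeta_nat 2 * (1 / 2) ^ j \<le> (\<Prod>k<n. inverse (zeta_nat (j + 2 + k)))" for n
  proof -
    have "(\<Sum>k<n. 1 - inverse (zeta_nat (j + 2 + k))) \<le> (\<Sum>k<n. zeta_nat 2 * (1 / 2) ^ j * (1 / 2) ^ k)"
      by (intro sum_mono) (use inverse_zeta_bounds(3)[of "j + 2 + _"] in \<open>simp add: power_add mult.assoc\<close>)
    also have "\<dots> = zeta_nat 2 * (1 / 2) ^ j * (\<Sum>k<n. (1 / 2) ^ k)" by (simp add: sum_distrib_left)
    also have "\<dots> \<le> zeta_nat 2 * (1 / 2) ^ j * 2"
    proof (intro mult_left_mono)
      have "(\<Sum>k<n. (1 / 2 :: real) ^ k) \<le> (\<Sum>k. (1 / 2) ^ k)"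
        by (intro sum_le_suminf summable_geometric) auto
      then show "(\<Sum>k<n. (1 / 2 :: real) ^ k) \<le> 2" by (simp add: suminf_geometric)
    qed (use zeta_nat_bounds(1)[of 2] in simp)
    finally have "1 - 2 * zeta_nat 2 * (1 / 2) ^ j \<le> 1 - (\<Sum>k<n. 1 - inverse (zeta_nat (j + 2 + k)))" by simp
    also have "\<dots> \<le> (\<Prod>k<n. 1 - (1 - inverse (zeta_nat (j + 2 + k))))"
      by (rule Weierstrass_prod_ineq) (use inverse_zeta_bounds in \<open>auto intro: less_imp_le\<close>)
    finally show ?thesis by simp
  qed
  have ne: "inverse (zeta_nat (j + 2 + k)) \<noteq> 0" for k using inverse_zeta_bounds(1)[of "j + 2 + k"] by simp
  have "(\<lambda>n. \<Prod>k\<le>n. inverse (zeta_nat (j + 2 + k))) \<longlonglongrightarrow> zeta_tail j"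
    unfolding zeta_tail_def by (rule convergent_prod_LIMSEQ[OF convergent_zeta_tail])
  then have "1 - 2 * zeta_nat 2 * (1 / 2) ^ j \<le> zeta_tail j"
    by (rule LIMSEQ_le_const) (use le[of "Suc _"] in \<open>auto simp only: lessThan_Suc_atMost\<close>)
  then show ?thesis by simp
qed

lemma zeta_tail_le_1: "zeta_tail j \<le> 1" using zeta_tail_le_prod[of j 0] by simp

lemma summable_zeta_tail: "summable (\<lambda>j. 1 - zeta_tail j)"
proof (rule summable_comparison_test')
  show "summable (\<lambda>j. 2 * zeta_nat 2 * (1 / 2) ^ j)" by (intro summable_mult summable_geometric) simp
  show "norm (1 - zeta_tail n) \<le> 2 * zeta_nat 2 * (1 / 2) ^ n" for n
    using one_minus_zeta_tail_le[of n] zeta_tail_le_1[of n] by simp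
qed

lemma pomerance_sigma_eq: "pomerance_sigma = 1 + (\<Sum>j. 1 - zeta_tail j)"
  by (simp add: pomerance_sigma_def zeta_tail_def)

text \<open>Sieving: removing the multiples of a further prime \<open>p\<close> from the sum defining \<open>\<zeta>(i)\<close> multiplies it by
  \<open>1 - 1 / p ^ i\<close>, and the summand 1 always survives.\<close>

lemma euler_product_ge:
  assumes i: "i \<ge> 2" and S: "finite S" "\<And>p. p \<in> S \<Longrightarrow> prime (p::nat)"
  shows "inverse (zeta_nat i) \<le> (\<Prod>p\<in>S. 1 - 1 / real p ^ i)"
proof -
  define f :: "nat \<Rightarrow> real" where "f n = 1 / real n ^ i" for n
  define T where "T S = {n::nat. n \<ge> 1 \<and> (\<forall>p\<in>S. \<not> p dvd n)}" for S
  have f1: "f summable_on {1..}"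
  proof -
    have "(\<lambda>k. 1 / real (Suc k) ^ i) summable_on UNIV"
      by (rule norm_summable_imp_summable_on) (use summable_zeta[OF i] in \<open>simp del: of_nat_Suc\<close>)
    moreover have "bij_betw Suc UNIV {1..}" by (rule bij_betw_byWitness[where f' = "\<lambda>n. n - 1"]) auto
    ultimately show ?thesis
      using summable_on_reindex_bij_betw[of Suc UNIV "{1..}" f] by (simp add: f_def del: of_nat_Suc)
  qed
  have z: "infsum f {1..} = zeta_nat i"
  proof -
    have "bij_betw Suc UNIV {1..}" by (rule bij_betw_byWitness[where f' = "\<lambda>n. n - 1"]) auto
    then have "infsum f {1..} = infsum (\<lambda>k. 1 / real (Suc k) ^ i) UNIV"
      using infsum_reindex_bij_betw[of Suc UNIV "{1..}" f] by (simp add: f_def del: of_nat_Suc)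
    also have "((\<lambda>k. 1 / real (Suc k) ^ i) has_sum zeta_nat i) UNIV"
      unfolding zeta_nat_def
      by (rule norm_summable_imp_has_sum[OF _ summable_sums]) (use summable_zeta[OF i] in \<open>simp_all del: of_nat_Suc\<close>)
    then have "infsum (\<lambda>k. 1 / real (Suc k) ^ i) UNIV = zeta_nat i" by (rule infsumI)
    finally show ?thesis .
  qed
  have fT: "f summable_on T S" for S by (rule summable_on_subset_banach[OF f1]) (auto simp: T_def)
  have key: "infsum f (T S) = zeta_nat i * (\<Prod>p\<in>S. 1 - 1 / real p ^ i)"
    using S
  proof (induction S)
    case empty
    have "T {} = {1..}" by (auto simp: T_def)
    then show ?case using z by simp
  next
    case (insert p S)
    have p: "prime p" using insert by simp
    have dv: "r dvd p * n \<longleftrightarrow> r dvd n" if "r \<in> S" for r n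
      using that insert p primes_dvd_imp_eq[of r p] prime_dvd_mult_iff[of r p n] by auto
    \<comment> \<open>A survivor of S that is divisible by \<open>p\<close> is \<open>p\<close>
      times another survivor, because no prime of S divides \<open>p\<close>. Hence the removed
      terms add up to 1 / p ^ i times the previous sum.\<close>
    have im: "T S - T (insert p S) = (\<lambda>n. p * n) ` T S"
    proof (intro equalityI subsetI)
      fix m assume m: "m \<in> T S - T (insert p S)"
      then have "p dvd m" by (auto simp: T_def)
      then obtain n where "m = p * n" by (auto elim: dvdE)
      then show "m \<in> (\<lambda>n. p * n) ` T S" using m dv by (auto simp: T_def)
    next
      fix m assume "m \<in> (\<lambda>n. p * n) ` T S"
      then show "m \<in> T S - T (insert p S)" using dv prime_gt_0_nat[OF p] by (auto simp: T_def)
    qed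
    have inj: "inj_on (\<lambda>n. p * n) (T S)" using prime_gt_0_nat[OF p] by (auto simp: inj_on_def)
    have sub: "T (insert p S) \<subseteq> T S" by (auto simp: T_def)
    have "infsum f (T S) = infsum f (T (insert p S)) + infsum f (T S - T (insert p S))"
      using infsum_Un_disjoint[OF fT[of "insert p S"] summable_on_subset_banach[OF fT[of S]], of "T S - T (insert p S)"] sub
      by (simp add: Un_absorb1)
    also have "infsum f (T S - T (insert p S)) = infsum (\<lambda>n. 1 / real p ^ i * f n) (T S)"
      unfolding im infsum_reindex[OF inj] by (simp add: o_def f_def power_mult_distrib)
    also have "\<dots> = 1 / real p ^ i * infsum f (T S)" by (rule infsum_cmult_right')
    finally have "infsum f (T (insert p S)) = infsum f (T S) - 1 / real p ^ i * infsum f (T S)" by linarith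
    then have "infsum f (T (insert p S)) = infsum f (T S) * (1 - 1 / real p ^ i)"
      by (simp only: right_diff_distrib mult_1_right mult.commute)
    then show ?case using insert by (simp add: mult.assoc mult.commute)
  qed
  have "1 \<notin> S" using S(2)[of 1] by auto
  then have "1 \<in> T S" by (auto simp: T_def)
  then have "sum f {1} \<le> infsum f (T S)"
    by (intro finite_sum_le_infsum fT) (auto simp: f_def)
  then have "1 \<le> zeta_nat i * (\<Prod>p\<in>S. 1 - 1 / real p ^ i)" by (simp add: key f_def)
  then show ?thesis using zeta_nat_bounds(1)[OF i] by (simp add: field_simps)
qed

text \<open>\<open>P k\<close> stands for the probability that \<open>k\<close> random elements generate the direct product of the elementary
  abelian groups of order \<open>p V ^ \<delta> V\<close>.\<close>

lemma pomerance_bound: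
  fixes p \<delta> :: "'b \<Rightarrow> nat" and P :: "nat \<Rightarrow> real"
  assumes B: "finite B" "inj_on p B" "\<And>V. V \<in> B \<Longrightarrow> prime (p V)" "\<And>V. V \<in> B \<Longrightarrow> \<delta> V \<le> D"
    and P: "\<And>k. 0 \<le> P k" "\<And>k. P k \<le> 1"
    and le: "\<And>k. k \<ge> D \<Longrightarrow> (\<Prod>V\<in>B. \<Prod>j<\<delta> V. 1 - real (p V) ^ j / real (p V) ^ k) \<le> P k"
  shows "(\<Sum>k<n. 1 - P k) \<le> real D + pomerance_sigma"
proof -
  have tail: "zeta_tail j \<le> P (D + 1 + j)" for j
  proof -
    let ?k = "D + 1 + j"
    have f01: "0 \<le> 1 - 1 / real (p V) ^ m" "1 - 1 / real (p V) ^ m \<le> 1" if "V \<in> B" for V m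
    proof -
      have "1 \<le> real (p V) ^ m" using prime_gt_0_nat[OF B(3)[OF that]] by (intro one_le_power) simp
      moreover have "0 \<le> 1 - 1 / x \<and> 1 - 1 / x \<le> 1" if "1 \<le> x" for x :: real using that by simp
      ultimately show "0 \<le> 1 - 1 / real (p V) ^ m" "1 - 1 / real (p V) ^ m \<le> 1" by blast+
    qed
    have pw: "1 - real (p V) ^ l / real (p V) ^ ?k = 1 - 1 / real (p V) ^ (?k - l)" if "V \<in> B" "l < \<delta> V" for V l
    proof -
      have "l \<le> ?k" using that B(4)[OF that(1)] by simp
      then have "real (p V) ^ ?k = real (p V) ^ l * real (p V) ^ (?k - l)" by (simp only: power_add[symmetric]) simp
      then show ?thesis using prime_gt_0_nat[OF B(3)[OF that(1)]] by simp
    qed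
    have "zeta_tail j \<le> (\<Prod>m<D. inverse (zeta_nat (j + 2 + m)))" by (rule zeta_tail_le_prod)
    also have "\<dots> \<le> (\<Prod>m<D. \<Prod>q\<in>p ` B. 1 - 1 / real q ^ (j + 2 + m))"
    proof (rule prod_mono)
      fix m assume "m \<in> {..<D}"
      show "0 \<le> inverse (zeta_nat (j + 2 + m)) \<and>
          inverse (zeta_nat (j + 2 + m)) \<le> (\<Prod>q\<in>p ` B. 1 - 1 / real q ^ (j + 2 + m))"
        using inverse_zeta_bounds(1)[of "j + 2 + m"] B
        by (intro conjI euler_product_ge) (auto intro: less_imp_le)
    qed
    also have "\<dots> = (\<Prod>m<D. \<Prod>V\<in>B. 1 - 1 / real (p V) ^ (j + 2 + m))"
      by (simp add: prod.reindex[OF B(2)])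
    also have "\<dots> = (\<Prod>V\<in>B. \<Prod>m<D. 1 - 1 / real (p V) ^ (j + 2 + m))" by (rule prod.swap)
    also have "\<dots> \<le> (\<Prod>V\<in>B. \<Prod>l<\<delta> V. 1 - real (p V) ^ l / real (p V) ^ ?k)"
    proof (rule prod_mono, intro conjI)
      fix V assume V: "V \<in> B"
      show "0 \<le> (\<Prod>m<D. 1 - 1 / real (p V) ^ (j + 2 + m))" by (intro prod_nonneg ballI f01(1)[OF V])
      \<comment> \<open>Since the number of elements is D + 1 + j, the exponents for l < D run
        through j + 2, ..., D + 1 + j, and l = D - 1 - m matches the two products. The factors with
        l \<ge> \<delta> V are then dropped, being at most 1.\<close>
      have "(\<Prod>m<D. 1 - 1 / real (p V) ^ (j + 2 + m)) = (\<Prod>l<D. 1 - 1 / real (p V) ^ (?k - l))"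
        by (rule prod.reindex_bij_witness[of _ "\<lambda>l. D - 1 - l" "\<lambda>m. D - 1 - m"])
          (auto intro!: arg_cong[where f = "\<lambda>e. real (p V) ^ e"] simp: algebra_simps)
      also have "\<dots> = (\<Prod>l<\<delta> V. 1 - 1 / real (p V) ^ (?k - l)) * (\<Prod>l\<in>{\<delta> V..<D}. 1 - 1 / real (p V) ^ (?k - l))"
        using B(4)[OF V] by (subst prod.union_disjoint[symmetric]) (auto intro!: prod.cong)
      also have "\<dots> \<le> (\<Prod>l<\<delta> V. 1 - 1 / real (p V) ^ (?k - l)) * 1"
        by (intro mult_left_mono prod_le_1 prod_nonneg) (use f01[OF V] in auto)
      also have "\<dots> = (\<Prod>l<\<delta> V. 1 - real (p V) ^ l / real (p V) ^ ?k)"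
        using pw[OF V] by (auto intro!: prod.cong)
      finally show "(\<Prod>m<D. 1 - 1 / real (p V) ^ (j + 2 + m)) \<le> (\<Prod>l<\<delta> V. 1 - real (p V) ^ l / real (p V) ^ ?k)" .
    qed
    also have "\<dots> \<le> P ?k" by (rule le) simp
    finally show ?thesis .
  qed
  have split: "(\<Sum>k<m + n. h k) = (\<Sum>k<m. h k) + (\<Sum>j<n. h (m + j))" for h :: "nat \<Rightarrow> real" and m n
    by (induction n) simp_all
  have "(\<Sum>k<n. 1 - P k) \<le> (\<Sum>k<D + 1 + n. 1 - P k)" by (rule sum_mono2) (use P in auto)
  also have "\<dots> = (\<Sum>k<D + 1. 1 - P k) + (\<Sum>j<n. 1 - P (D + 1 + j))"
    by (rule split)
  \<comment> \<open>Of these D + 1 trivial terms, the last one is the leading 1 of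
    \<open>pomerance_sigma\<close>.\<close>
  also have "(\<Sum>k<D + 1. 1 - P k) \<le> (\<Sum>k<D + 1. 1)" using P by (intro sum_mono) auto
  also have "(\<Sum>j<n. 1 - P (D + 1 + j)) \<le> (\<Sum>j<n. 1 - zeta_tail j)" using tail by (intro sum_mono) auto
  also have "\<dots> \<le> (\<Sum>j. 1 - zeta_tail j)"
    by (intro sum_le_suminf summable_zeta_tail) (use zeta_tail_le_1 in auto)
  finally show ?thesis by (simp add: pomerance_sigma_eq)
qed

section \<open>Central chief factors\<close>

lemma (in group) nat_pow_mod:
  assumes x: "x \<in> carrier G" and n: "x [^] (n::nat) = \<one>" shows "x [^] i = x [^] (i mod n)"
proof -
  have "x [^] (n * (i div n)) = \<one>" using nat_pow_pow[OF x, of n "i div n"] n by simp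
  then have "x [^] (n * (i div n) + i mod n) = x [^] (i mod n)"
    using nat_pow_mult[OF x, of "n * (i div n)" "i mod n"] x by simp
  then show ?thesis by simp
qed

context finite_irreducible_module
begin

lemma dscale_Van:
  assumes "\<alpha> \<in> F" "d \<in> Van N" "N \<subseteq> carrier G"
  shows "dscale \<alpha> d \<in> Van N"
  using assms dscale_Der[OF assms(1) Van_Der[OF assms(2)]] unfolding Van_def
  by (auto simp: dscale_def subset_iff)

text \<open>The counterpart of \<open>card_compatible_ge\<close> relative to a chief factor:
  \<open>d\<close> is nonzero at some y in L, and evaluation at y shows that its nonzero multiples
  are distinct and again do not vanish on L.\<close>

lemma card_vanishing_multiples:
  assumes Lc: "L \<subseteq> carrier G" and NL: "N \<subseteq> L"
    and d: "d \<in> Van N - Van L" and x: "\<And>j. j < k \<Longrightarrow> x j \<in> carrier G" and dx: "\<And>j. j < k \<Longrightarrow> d (x j) = 0\<^sub>V"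
  shows "q - 1 \<le> card {e \<in> Van N - Van L. \<forall>j<k. e (x j) = 0\<^sub>V}"
proof -
  let ?z = "\<lambda>v\<in>carrier V. 0\<^sub>V"
  let ?E = "{e \<in> Van N - Van L. \<forall>j<k. e (x j) = 0\<^sub>V}"
  have dD: "d \<in> Der" using d Van_Der by blast
  obtain y where y: "y \<in> L" "d y \<noteq> 0\<^sub>V" using d dD unfolding Van_def by blast
  have yc: "y \<in> carrier G" using y Lc by blast
  have dy: "d y \<in> carrier V" using dD yc by simp
  have inj: "\<alpha> = \<beta>" if "\<alpha> \<in> F" "\<beta> \<in> F" "\<alpha> (d y) = \<beta> (d y)" for \<alpha> \<beta>
    using End_inj[OF that(1,2) dy y(2) that(3)] .
  have "inj_on (\<lambda>\<alpha>. dscale \<alpha> d) (F - {?z})"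
  proof (rule inj_onI)
    fix \<alpha> \<beta> assume *: "\<alpha> \<in> F - {?z}" "\<beta> \<in> F - {?z}" "dscale \<alpha> d = dscale \<beta> d"
    then have "dscale \<alpha> d y = dscale \<beta> d y" by simp
    then have "\<alpha> (d y) = \<beta> (d y)" using yc by (simp add: dscale_def)
    then show "\<alpha> = \<beta>" using inj * by blast
  qed
  moreover have "(\<lambda>\<alpha>. dscale \<alpha> d) ` (F - {?z}) \<subseteq> ?E"
  proof (rule image_subsetI)
    fix \<alpha> assume \<alpha>: "\<alpha> \<in> F - {?z}"
    have "\<alpha> (d y) \<noteq> 0\<^sub>V"
    proof
      assume "\<alpha> (d y) = 0\<^sub>V"
      then have "\<alpha> = ?z" using \<alpha> zero_End dy by (intro inj) auto
      then show False using \<alpha> by simp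
    qed
    then have "dscale \<alpha> d y \<noteq> 0\<^sub>V" using yc by (simp add: dscale_def)
    then have "dscale \<alpha> d \<notin> Van L" using y unfolding Van_def by blast
    moreover have "dscale \<alpha> d \<in> Van N" by (rule dscale_Van) (use \<alpha> d NL Lc in auto)
    moreover have "dscale \<alpha> d (x j) = 0\<^sub>V" if "j < k" for j
      using x[OF that] dx[OF that] \<alpha> by (simp add: dscale_def)
    ultimately show "dscale \<alpha> d \<in> ?E" by blast
  qed
  moreover have "finite ?E" using finite_Van[of N] by (rule rev_finite_subset) blast
  ultimately have "card (F - {?z}) \<le> card ?E" by (rule card_inj_on_le)
  moreover have "card (F - {?z}) = q - 1" using zero_End finite_F by (simp add: q_mod_def)
  ultimately show ?thesis by simp
qed

text \<open>A new derivation maps each coset of L uniformly onto V, so it vanishes at all entries of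
  a random translate with probability |V| ^ -k. By \<open>card_Van_step\<close> there are at most
  \<open>(q - 1) * card (Van L)\<close> new ones, and dividing by the q - 1 scalars leaves
  \<open>card (Van L)\<close>.\<close>

lemma average_new_vanishing_le:
  assumes ch: "chief_factor G L N" and LK: "L \<subseteq> Ker" and g: "g \<in> {..<k} \<rightarrow>\<^sub>E carrier G"
  shows "average k L (\<lambda>c. of_bool (\<exists>d\<in>Van N - Van L. \<forall>j<k. d (g j \<otimes> c j) = 0\<^sub>V))
    \<le> real (card (Van L)) / real (card (carrier V)) ^ k"
proof (cases "Van N \<subseteq> Van L")
  case True
  then have none: "(\<exists>d\<in>Van N - Van L. \<forall>j<k. d (g j \<otimes> c j) = 0\<^sub>V) = False" for c by blast
  show ?thesis unfolding none by (simp add: average_def)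
next
  case False
  then obtain d0 where d0: "d0 \<in> Van N" "d0 \<notin> Van L" by blast
  note C = chief_factorD[OF ch]
  interpret L: normal L G by fact
  have sL: "subgroup L G" by (rule L.is_subgroup)
  have Lc: "x \<in> carrier G" if "x \<in> L" for x using that subgroup.mem_carrier[OF sL] by blast
  have Lsub: "L \<subseteq> carrier G" using Lc by blast
  have finL: "finite L" using finite_subset[OF Lsub finite_G] .
  have L0: "L \<noteq> {}" using subgroup.one_closed[OF sL] by blast
  have V0: "real (card (carrier V)) > 0" using finite_V by (simp add: card_gt_0_iff V.carrier_not_empty)
  have gc: "g j \<in> carrier G" if "j < k" for j using g that by auto
  let ?D = "Van N - Van L"
  have q1: "real (q - 1) > 0" using two_le_q by simp
  have single: "card {c \<in> L. e (g j \<otimes> c) = 0\<^sub>V} * card (carrier V) = card L" if e: "e \<in> ?D" and j: "j < k" for e j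
  proof -
    have eD: "e \<in> Der" using e Van_Der by blast
    interpret h: group_hom "G\<lparr>carrier := L\<rparr>" V e
      by (intro group_hom.intro group_hom_axioms.intro homI V.is_group L.subgroup_is_group[OF G.is_group])
        (use eD Lc LK in \<open>auto simp: Der_mult Ker_act subset_iff\<close>)
    have surj: "e ` L = carrier V" using chief_step(1)[OF ch LK] e by blast
    \<comment> \<open>The value that \<open>e c\<close> must take for \<open>e\<close> to vanish at
      the translate.\<close>
    define u where "u = \<phi> (inv (g j)) (inv\<^bsub>V\<^esub> (e (g j)))"
    have u: "u \<in> carrier V" using gc[OF j] eD by (simp add: u_def)
    have iff: "e (g j \<otimes> c) = 0\<^sub>V \<longleftrightarrow> e c \<in> {u}" if c: "c \<in> L" for c
    proof -
      have cl: "e c \<in> carrier V" "e (g j) \<in> carrier V" "\<phi> (g j) (e c) \<in> carrier V" using eD Lc[OF c] gc[OF j] by auto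
      have "e (g j \<otimes> c) = 0\<^sub>V \<longleftrightarrow> e (g j) +\<^sub>V \<phi> (g j) (e c) = 0\<^sub>V" using eD Lc[OF c] gc[OF j] by (simp add: Der_mult)
      also have "\<dots> \<longleftrightarrow> \<phi> (g j) (e c) = inv\<^bsub>V\<^esub> (e (g j))"
      proof
        assume "e (g j) +\<^sub>V \<phi> (g j) (e c) = 0\<^sub>V"
        then have "inv\<^bsub>V\<^esub> (e (g j)) = \<phi> (g j) (e c)" using cl by (metis V.inv_equality V.m_comm)
        then show "\<phi> (g j) (e c) = inv\<^bsub>V\<^esub> (e (g j))" by simp
      next
        assume "\<phi> (g j) (e c) = inv\<^bsub>V\<^esub> (e (g j))"
        then show "e (g j) +\<^sub>V \<phi> (g j) (e c) = 0\<^sub>V" using cl by simp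
      qed
      also have "\<dots> \<longleftrightarrow> e c = u"
      proof
        assume "\<phi> (g j) (e c) = inv\<^bsub>V\<^esub> (e (g j))"
        then have "\<phi> (inv (g j)) (\<phi> (g j) (e c)) = u" by (simp add: u_def)
        then show "e c = u" using cl gc[OF j] by simp
      next
        assume "e c = u"
        then show "\<phi> (g j) (e c) = inv\<^bsub>V\<^esub> (e (g j))" using cl gc[OF j] by (simp add: u_def)
      qed
      finally show ?thesis by simp
    qed
    have "{c \<in> L. e (g j \<otimes> c) = 0\<^sub>V} = {c \<in> L. e c \<in> {u}}" using iff by blast
    then show ?thesis using h.card_surj_hom_preimage[of "{u}"] surj u finL by simp
  qed
  have sub: "Van L \<subseteq> Van N" using C(3) unfolding Van_def by blast
  have "card ?D = card (Van N) - card (Van L)" by (rule card_Diff_subset[OF finite_Van sub])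
  also have "\<dots> \<le> q * card (Van L) - card (Van L)" using card_Van_step[OF ch LK d0] by (rule diff_le_mono)
  also have "\<dots> = (q - 1) * card (Van L)" by (simp add: diff_mult_distrib)
  finally have "real (card ?D) \<le> real (q - 1) * real (card (Van L))" by (simp only: of_nat_le_iff of_nat_mult[symmetric])
  then have D: "real (card ?D) / real (q - 1) \<le> real (card (Van L))" using q1 by (simp add: pos_divide_le_eq mult.commute)
  have "average k L (\<lambda>c. of_bool (\<exists>d\<in>?D. \<forall>j<k. d (g j \<otimes> c j) = 0\<^sub>V))
      \<le> real (card ?D) / real (q - 1) * (\<Prod>j<k. 1 / real (card (carrier V)))"
  proof (rule average_ex_le[OF finL L0])
    show "finite ?D" using finite_Van by simp
    show "q - 1 > 0" using two_le_q by simp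
    show "real (card {c \<in> L. e (g j \<otimes> c) = 0\<^sub>V}) = real (card L) * (1 / real (card (carrier V)))"
      if "e \<in> ?D" "j < k" for e j
    proof -
      have "real (card {c \<in> L. e (g j \<otimes> c) = 0\<^sub>V}) * real (card (carrier V)) = real (card L)"
        using single[OF that] by (metis of_nat_mult)
      then show ?thesis using V0 by (simp add: field_simps)
    qed
    fix c e assume c: "c \<in> {..<k} \<rightarrow>\<^sub>E L" and e: "e \<in> ?D" "\<And>j. j < k \<Longrightarrow> e (g j \<otimes> c j) = 0\<^sub>V"
    show "q - 1 \<le> card {e \<in> ?D. \<forall>j<k. e (g j \<otimes> c j) = 0\<^sub>V}"
      by (rule card_vanishing_multiples[OF Lsub C(3) e(1)]) (use e(2) gc c Lc in \<open>auto simp: PiE_iff\<close>)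
  qed
  also have "\<dots> \<le> real (card (Van L)) * (\<Prod>j<k. 1 / real (card (carrier V)))"
    using D by (intro mult_right_mono prod_nonneg) auto
  finally show ?thesis by (simp add: power_divide)
qed

lemma Inn_central:
  assumes K: "Ker = carrier G" shows "Inn = {\<lambda>g\<in>carrier G. 0\<^sub>V}"
proof -
  have "b = (\<lambda>g\<in>carrier G. 0\<^sub>V)" if "b \<in> Inn" for b
    by (rule Der_ext) (use that Inn_subset zero_Inn Inn_Ker K in auto)
  then show ?thesis using zero_Inn by blast
qed

lemma Comm_central: "Ker = carrier G \<Longrightarrow> g \<in> carrier G \<Longrightarrow> Comm g = {0\<^sub>V}"
  using V.carrier_not_empty by (auto simp: Comm_def Ker_act)

lemma Van_carrier_Inn: "Ker = carrier G \<Longrightarrow> Van (carrier G) = Inn"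
  using Van_trivial[of "carrier G"] Inn_subset Inn_Ker unfolding Van_def by blast

text \<open>With trivial action every subgroup is a submodule, so each nonzero element generates V
  and has order |V|. For a divisor m of |V|, either v ^ m is trivial or it has order |V| again,
  which leaves m = |V| or m = 1.\<close>

lemma prime_card_central:
  assumes K: "Ker = carrier G" shows "prime (card (carrier V))"
proof -
  let ?n = "card (carrier V)"
  have sub: "W = {0\<^sub>V} \<or> W = carrier V" if W: "subgroup W V" for W
  proof (rule irreducible[OF W])
    fix g assume "g \<in> carrier G"
    then have "\<phi> g w = w" if "w \<in> W" for w using K Ker_act subgroup.mem_carrier[OF W that] by simp
    then show "\<phi> g ` W \<subseteq> W" by auto
  qed
  have ord: "V.ord v = ?n" if v: "v \<in> carrier V" "v \<noteq> 0\<^sub>V" for v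
  proof -
    have "v \<in> generate V {v}" by (rule generate.incl) simp
    then have "generate V {v} = carrier V" using sub[OF V.generate_is_subgroup[of "{v}"]] v by auto
    then show ?thesis using V.generate_pow_card[OF v(1)] by simp
  qed
  obtain v where v: "v \<in> carrier V" "v \<noteq> 0\<^sub>V" using nontrivial by auto
  have n2: "?n \<ge> 2" using q_le_card_V two_le_q by simp
  show ?thesis unfolding prime_nat_iff
  proof (intro conjI allI impI)
    show "1 < ?n" using n2 by simp
    fix m assume m: "m dvd ?n"
    show "m = 1 \<or> m = ?n"
    proof (cases "v [^]\<^bsub>V\<^esub> m = 0\<^sub>V")
      case True
      then have "?n dvd m" using V.pow_eq_id[OF v(1), of m] ord[OF v] by simp
      then show ?thesis using m by (simp add: dvd_antisym)
    next
      case False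
      obtain r where r: "?n = m * r" using m by (auto elim: dvdE)
      have "(v [^]\<^bsub>V\<^esub> m) [^]\<^bsub>V\<^esub> r = 0\<^sub>V"
        using V.nat_pow_pow[OF v(1), of m r] r V.pow_eq_id[OF v(1), of ?n] ord[OF v] by simp
      then have "?n dvd r" using V.pow_eq_id[of "v [^]\<^bsub>V\<^esub> m" r] ord[of "v [^]\<^bsub>V\<^esub> m"] v False by simp
      then have "m * r dvd r" using r by simp
      moreover have "r > 0" using r n2 by (cases r) auto
      ultimately show ?thesis using dvd_imp_le[of "m * r" r] by (cases m) auto
    qed
  qed
qed

lemma central_imp_cyclic:
  assumes K: "Ker = carrier G"
  obtains v where "v \<in> carrier V" "bij_betw (\<lambda>i::nat. v [^]\<^bsub>V\<^esub> i) {..<card (carrier V)} (carrier V)"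
    "v [^]\<^bsub>V\<^esub> card (carrier V) = 0\<^sub>V"
proof -
  obtain v where v: "v \<in> carrier V" "v \<noteq> 0\<^sub>V" using nontrivial by auto
  let ?n = "card (carrier V)"
  have p: "prime ?n" by (rule prime_card_central[OF K])
  have "V.ord v dvd ?n" using V.ord_dvd_group_order[OF v(1)] by (simp add: Coset.order_def)
  moreover have "V.ord v \<noteq> 1" using V.ord_eq_1[OF v(1)] v by simp
  ultimately have ord: "V.ord v = ?n" using prime_nat_iff[THEN iffD1, OF p] by blast
  have "{..<?n} = {0..?n - 1}" using prime_gt_0_nat[OF p] by auto
  then have inj: "inj_on (\<lambda>i::nat. v [^]\<^bsub>V\<^esub> i) {..<?n}" using V.ord_inj[OF v(1)] ord by simp
  have "(\<lambda>i::nat. v [^]\<^bsub>V\<^esub> i) ` {..<?n} \<subseteq> carrier V" using v by auto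
  then have "(\<lambda>i::nat. v [^]\<^bsub>V\<^esub> i) ` {..<?n} = carrier V"
    by (rule card_subset_eq[OF finite_V]) (simp add: card_image[OF inj])
  then show ?thesis using that[OF v(1)] inj V.pow_ord_eq_1[OF v(1)] ord by (simp add: bij_betw_def)
qed

end

text \<open>Two cyclic groups of the same order with trivial action are matched by discrete
  logarithms. So distinct members of B belong to distinct primes, and each Euler factor is used only
  once.\<close>

lemma central_modules_isomorphic:
  fixes G :: "('a, 'm) monoid_scheme"
  assumes V: "finite_irreducible_module G V \<phi>" "finite_irreducible_module.Ker G V \<phi> = carrier G"
    and W: "finite_irreducible_module G W \<psi>" "finite_irreducible_module.Ker G W \<psi> = carrier G"
    and card: "card (carrier V) = card (carrier W)"
  shows "G_isomorphic G V \<phi> W \<psi>"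
proof -
  interpret V: finite_irreducible_module G V \<phi> by fact
  interpret W: finite_irreducible_module G W \<psi> by fact
  let ?n = "card (carrier V)"
  obtain v where v: "v \<in> carrier V" "bij_betw (\<lambda>i::nat. v [^]\<^bsub>V\<^esub> i) {..<?n} (carrier V)" "v [^]\<^bsub>V\<^esub> ?n = \<one>\<^bsub>V\<^esub>"
    using V.central_imp_cyclic[OF V(2)] by blast
  obtain w where w: "w \<in> carrier W" "bij_betw (\<lambda>i::nat. w [^]\<^bsub>W\<^esub> i) {..<?n} (carrier W)" "w [^]\<^bsub>W\<^esub> ?n = \<one>\<^bsub>W\<^esub>"
    using W.central_imp_cyclic[OF W(2)] card by metis
  define l where "l = inv_into {..<?n} (\<lambda>i::nat. v [^]\<^bsub>V\<^esub> i)"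
  define f where "f x = w [^]\<^bsub>W\<^esub> l x" for x
  have l: "bij_betw l (carrier V) {..<?n}" unfolding l_def by (rule bij_betw_inv_into[OF v(2)])
  have vl: "v [^]\<^bsub>V\<^esub> l x = x" if "x \<in> carrier V" for x
    unfolding l_def using bij_betw_inv_into_right[OF v(2) that] by simp
  have lv: "l (v [^]\<^bsub>V\<^esub> i) = i" if "i < ?n" for i
    unfolding l_def using bij_betw_inv_into_left[OF v(2), of i] that by simp
  note modv = V.V.nat_pow_mod[OF v(1,3)] and modw = W.V.nat_pow_mod[OF w(1,3)]
  have n0: "?n > 0" using prime_gt_0_nat[OF V.prime_card_central[OF V(2)]] .
  have "f \<in> hom V W"
  proof (rule homI)
    show "f x \<in> carrier W" for x using w by (simp add: f_def)
    fix x y assume x: "x \<in> carrier V" and y: "y \<in> carrier V"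
    have "x \<otimes>\<^bsub>V\<^esub> y = v [^]\<^bsub>V\<^esub> (l x + l y)" using vl[OF x] vl[OF y] V.V.nat_pow_mult[OF v(1), of "l x" "l y"] by simp
    also have "\<dots> = v [^]\<^bsub>V\<^esub> ((l x + l y) mod ?n)" by (rule modv)
    finally have "l (x \<otimes>\<^bsub>V\<^esub> y) = (l x + l y) mod ?n" using lv n0 by simp
    then have "f (x \<otimes>\<^bsub>V\<^esub> y) = w [^]\<^bsub>W\<^esub> (l x + l y)" using modw[of "l x + l y"] by (simp add: f_def)
    then show "f (x \<otimes>\<^bsub>V\<^esub> y) = f x \<otimes>\<^bsub>W\<^esub> f y" using W.V.nat_pow_mult[OF w(1), of "l x" "l y"] by (simp add: f_def)
  qed
  moreover have "bij_betw f (carrier V) (carrier W)"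
    using bij_betw_trans[OF l w(2)] by (simp add: f_def[abs_def] o_def)
  moreover have "f (\<phi> g x) = \<psi> g (f x)" if "g \<in> carrier G" "x \<in> carrier V" for g x
  proof -
    have "f x \<in> carrier W" using w by (simp add: f_def)
    then show ?thesis using V.Ker_act[of g x] W.Ker_act[of g "f x"] V(2) W(2) that by simp
  qed
  ultimately show ?thesis unfolding G_isomorphic_def iso_def by blast
qed

lemma of_bool_mono: "(P \<Longrightarrow> Q) \<Longrightarrow> of_bool P \<le> (of_bool Q :: real)"
  by (cases P) simp_all

lemma prod_le_prod_lessThan_antimono:
  fixes f :: "nat \<Rightarrow> real"
  assumes "m \<le> n" "\<And>j. j < n \<Longrightarrow> 0 \<le> f j" "\<And>j. j < n \<Longrightarrow> f j \<le> 1"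
  shows "(\<Prod>j<n. f j) \<le> (\<Prod>j<m. f j)"
proof -
  have "(\<Prod>j<n. f j) = (\<Prod>j<m. f j) * (\<Prod>j\<in>{m..<n}. f j)"
    using assms(1) by (subst prod.union_disjoint[symmetric]) (auto intro!: prod.cong)
  also have "\<dots> \<le> (\<Prod>j<m. f j) * 1"
    using assms by (intro mult_left_mono prod_le_1 prod_nonneg) auto
  finally show ?thesis by simp
qed

text \<open>Descending induction along the chief series: given that \<open>g\<close> generates the abelianisation of \<open>G / Ns ! Suc i\<close>,
  the translates of \<open>g\<close> by \<open>Ns ! Suc i\<close> that fail to do so for \<open>G / Ns ! i\<close> are annihilated by a new derivation into
  the only possible module.\<close>

lemma central_generation_probability:
  fixes G :: "('a, 'm) monoid_scheme" and B :: "(('w, 'n) monoid_scheme \<times> ('a \<Rightarrow> 'w \<Rightarrow> 'w)) set"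
  assumes G: "group G" "finite (carrier G)" and Ns: "chief_series G Ns"
    and ab: "\<And>L N. chief_factor G L N \<Longrightarrow> abelian_section G L N"
    and B: "finite B" "\<And>b. b \<in> B \<Longrightarrow> finite_irreducible_module G (fst b) (snd b)"
      "\<And>b. b \<in> B \<Longrightarrow> finite_irreducible_module.Ker G (fst b) (snd b) = carrier G"
      "\<And>b c. \<lbrakk>b \<in> B; c \<in> B; G_isomorphic G (fst b) (snd b) (fst c) (snd c)\<rbrakk> \<Longrightarrow> b = c"
    and k: "\<And>b. b \<in> B \<Longrightarrow> delta_mod G Ns (fst b) (snd b) \<le> k"
  shows "(\<Prod>b\<in>B. \<Prod>j<delta_mod G Ns (fst b) (snd b). 1 - real (card (carrier (fst b))) ^ j / real (card (carrier (fst b))) ^ k)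
    \<le> 1 - average k (carrier G) (\<lambda>g. of_bool (\<exists>b\<in>B. finite_irreducible_module.bad G (fst b) (snd b) k g))"
proof -
  interpret G: group G by fact
  define Van where "Van b N = finite_irreducible_module.Van G (fst b) (snd b) N" for b :: "('w, 'n) monoid_scheme \<times> ('a \<Rightarrow> 'w \<Rightarrow> 'w)" and N
  define r where "r b i = finite_irreducible_module.rest G (fst b) (snd b) Ns i" for b :: "('w, 'n) monoid_scheme \<times> ('a \<Rightarrow> 'w \<Rightarrow> 'w)" and i
  define p where "p b = real (card (carrier (fst b)))" for b :: "('w, 'n) monoid_scheme \<times> ('a \<Rightarrow> 'w \<Rightarrow> 'w)"
  let ?T = "{..<k} \<rightarrow>\<^sub>E carrier G"
  \<comment> \<open>\<open>dead\<close> says that a nonzero derivation which is trivial on N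
    vanishes at all entries, an obstruction to generating G / N; \<open>new\<close> restricts to
    derivations that appear only on passing from L down to N.\<close>
  define dead where "dead N b g \<longleftrightarrow> (\<exists>d\<in>Van b N - Van b (carrier G). \<forall>j<k. d (g j) = \<one>\<^bsub>fst b\<^esub>)"
    for N and b :: "('w, 'n) monoid_scheme \<times> ('a \<Rightarrow> 'w \<Rightarrow> 'w)" and g :: "nat \<Rightarrow> 'a"
  define new where "new L N b g \<longleftrightarrow> (\<exists>d\<in>Van b N - Van b L. \<forall>j<k. d (g j) = \<one>\<^bsub>fst b\<^esub>)"
    for L N and b :: "('w, 'n) monoid_scheme \<times> ('a \<Rightarrow> 'w \<Rightarrow> 'w)" and g :: "nat \<Rightarrow> 'a"
  define a where "a i = average k (carrier G) (\<lambda>g. of_bool (\<exists>b\<in>B. dead (Ns ! i) b g))" for i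
  define R where "R i = (\<Prod>b\<in>B. \<Prod>j<r b i. 1 - p b ^ j / p b ^ k)" for i
  have cne: "carrier G \<noteq> {}" using G.carrier_not_empty .
  have p1: "p b \<ge> 1" if "b \<in> B" for b
  proof -
    interpret M: finite_irreducible_module G "fst b" "snd b" using B that by blast
    show ?thesis using M.prime_card_central[OF B(3)[OF that]] prime_gt_0_nat by (auto simp: p_def Suc_le_eq)
  qed
  have r0: "r b 0 = delta_mod G Ns (fst b) (snd b)" if "b \<in> B" for b
  proof -
    interpret M: finite_irreducible_module G "fst b" "snd b" using B that by blast
    show ?thesis by (simp add: r_def M.rest_0)
  qed
  have rSuc: "r b i = r b (Suc i) + (if complemented G (Ns ! Suc i) (Ns ! i) \<and>
     G_isomorphic_to_section G (fst b) (snd b) (Ns ! Suc i) (Ns ! i) then 1 else 0)" if "b \<in> B" "Suc i < length Ns" for b i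
  proof -
    interpret M: finite_irreducible_module G "fst b" "snd b" using B that by blast
    show ?thesis unfolding r_def by (rule M.rest_Suc[OF that(2)])
  qed
  have rk: "r b i \<le> k" if "b \<in> B" for b i
  proof -
    interpret M: finite_irreducible_module G "fst b" "snd b" using B that by blast
    have "r b i \<le> delta_mod G Ns (fst b) (snd b)"
      unfolding r_def M.rest_def delta_mod_def
      by (rule card_mono[OF finite_subset[of _ "{..<length Ns}"]]) auto
    then show ?thesis using k[OF that] by simp
  qed
  have factor: "0 \<le> 1 - p b ^ j / p b ^ k" "1 - p b ^ j / p b ^ k \<le> 1" if "b \<in> B" "j \<le> k" for b j
  proof -
    have "p b ^ j \<le> p b ^ k" "0 < p b ^ k" "0 \<le> p b ^ j" using p1[OF that(1)] that(2) by (auto intro: power_increasing)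
    then show "0 \<le> 1 - p b ^ j / p b ^ k" "1 - p b ^ j / p b ^ k \<le> 1" by (auto simp: pos_divide_le_eq)
  qed
  have Rfac0: "0 \<le> (\<Prod>j<r b i. 1 - p b ^ j / p b ^ k)" if "b \<in> B" for b i
    using factor(1)[OF that] rk[OF that, of i] by (intro prod_nonneg) auto
  have Rle1: "(\<Prod>j<r b i. 1 - p b ^ j / p b ^ k) \<le> 1" if b: "b \<in> B" for b i
  proof (rule prod_le_1)
    fix j assume "j \<in> {..<r b i}"
    then have "j \<le> k" using rk[OF b, of i] by simp
    then show "0 \<le> 1 - p b ^ j / p b ^ k \<and> 1 - p b ^ j / p b ^ k \<le> 1" using factor[OF b] by blast
  qed
  have Rmono: "(\<Prod>j<r b i. 1 - p b ^ j / p b ^ k) \<le> (\<Prod>j<r b (Suc i). 1 - p b ^ j / p b ^ k)"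
    if "b \<in> B" "Suc i < length Ns" for b i
    using rSuc[OF that] factor[OF that(1)] rk[OF that(1), of i] by (intro prod_le_prod_lessThan_antimono) auto
  have avg_le1: "average k (carrier G) (\<lambda>g. of_bool (Q g)) \<le> 1" for Q
    using average_mono[of k "carrier G" "\<lambda>g. of_bool (Q g)" "\<lambda>_. 1"] average_const[OF G(2) cne, of k 1] by simp
  have a_le1: "a i \<le> 1" for i unfolding a_def by (rule avg_le1)
  have main: "R i \<le> 1 - a i" if "i < length Ns" for i
    using that
  proof (induction "length Ns - i" arbitrary: i rule: less_induct)
    case less
    show ?case
    proof (cases "Suc i < length Ns")
      case False
      then have "i = length Ns - 1" using less.prems by simp
      then have top: "Ns ! i = carrier G" using Ns last_conv_nth[of Ns] by (auto simp: chief_series_def)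
      have "\<not> dead (Ns ! i) b g" for b g by (simp add: dead_def top)
      then have "a i = 0" by (simp add: a_def average_def)
      moreover have "R i \<le> 1" unfolding R_def
        using Rfac0 Rle1 by (intro prod_le_1) auto
      ultimately show ?thesis by simp
    next
      case True
      let ?L = "Ns ! Suc i" and ?N = "Ns ! i"
      have ch: "chief_factor G ?L ?N" using Ns True by (simp add: chief_series_def)
      note C = chief_factorD[OF ch]
      have sL: "subgroup ?L G" using C(1) normal_imp_subgroup by blast
      have Lc: "?L \<subseteq> carrier G" by (rule subgroup.subset[OF sL])
      have L0: "?L \<noteq> {}" using subgroup.one_closed[OF sL] by blast
      have IH: "R (Suc i) \<le> 1 - a (Suc i)" by (rule less.hyps) (use True in auto)
      have split: "dead ?N b g \<Longrightarrow> dead ?L b g \<or> new ?L ?N b g" for b g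
        unfolding dead_def new_def by blast
      show ?thesis
      proof (cases "\<exists>b\<in>B. \<not> Van b ?N \<subseteq> Van b ?L")
        case False
        have "\<not> new ?L ?N b g" if "b \<in> B" for b g using False that unfolding new_def by blast
        then have imp: "\<exists>b\<in>B. dead ?L b g" if "\<exists>b\<in>B. dead ?N b g" for g using that split by blast
        have "a i \<le> a (Suc i)" unfolding a_def
        proof (rule average_mono)
          show "of_bool (\<exists>b\<in>B. dead ?N b g) \<le> (of_bool (\<exists>b\<in>B. dead ?L b g) :: real)" for g
            using imp[of g] by (rule of_bool_mono)
        qed
        moreover have "R i \<le> R (Suc i)" unfolding R_def
          using Rfac0 Rmono True by (intro prod_mono) auto
        ultimately show ?thesis using IH by simp
      next
        case ex: True
        then obtain b0 where b0: "b0 \<in> B" "\<not> Van b0 ?N \<subseteq> Van b0 ?L" by blast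
        have iso: "complemented G ?L ?N \<and> G_isomorphic_to_section G (fst b) (snd b) ?L ?N"
          if b: "b \<in> B" "\<not> Van b ?N \<subseteq> Van b ?L" for b
        proof -
          interpret M: finite_irreducible_module G "fst b" "snd b" using B b by blast
          obtain d where "d \<in> M.Van ?N" "d \<notin> M.Van ?L" using b unfolding Van_def by blast
          then show ?thesis using M.chief_step(3,4)[OF ch] B(3)[OF b(1)] Lc by simp
        qed
        \<comment> \<open>By \<open>chief_step\<close> a new derivation identifies its module with L
          / N, and distinct members of B are not isomorphic.\<close>
        have uniq: "b = b0" if b: "b \<in> B" "\<not> Van b ?N \<subseteq> Van b ?L" for b
        proof -
          interpret M0: finite_irreducible_module G "fst b0" "snd b0" using B b0 by blast
          have "G_isomorphic G (section_group G ?L ?N) (section_action G ?L ?N) (fst b0) (snd b0)"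
            using iso[OF b0, THEN conjunct2] unfolding G_isomorphic_to_section_def
            by (rule G_isomorphic_sym[OF _ M0.V.is_group M0.act_closed])
          then have "G_isomorphic G (fst b) (snd b) (fst b0) (snd b0)"
            using iso[OF b] G_isomorphic_trans unfolding G_isomorphic_to_section_def by blast
          then show ?thesis using B(4) b b0 by blast
        qed
        have rb0: "r b0 i = Suc (r b0 (Suc i))" using rSuc[OF b0(1) True] iso[OF b0] by simp
        \<comment> \<open>\<open>1 - e\<close> is the factor, with j equal to
          \<open>r b0 (Suc i)\<close>, that the product for \<open>b0\<close> gains at
          \<open>i\<close>.\<close>
        define e where "e = p b0 ^ r b0 (Suc i) / p b0 ^ k"
        have e01: "0 \<le> 1 - e" "1 - e \<le> 1" using factor[OF b0(1), of "r b0 (Suc i)"] rk[OF b0(1)] by (auto simp: e_def)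
        interpret M: finite_irreducible_module G "fst b0" "snd b0" using B b0 by blast
        have K: "M.Ker = carrier G" using B(3)[OF b0(1)] .
        have LK: "?L \<subseteq> M.Ker" unfolding K by (rule Lc)
        have pn: "p b0 ^ k > 0" using p1[OF b0(1)] by simp
        have cardV: "real (card (M.Van ?L)) \<le> p b0 ^ r b0 (Suc i)"
        proof -
          have "card (M.Van ?L) \<le> card M.Inn * M.q ^ M.rest Ns (Suc i)"
            by (rule M.card_Van_chief_series[OF Ns ab True LK])
          also have "card M.Inn = 1" using M.Inn_central[OF K] by simp
          also have "1 * M.q ^ M.rest Ns (Suc i) \<le> card (carrier (fst b0)) ^ M.rest Ns (Suc i)"
            using M.q_le_card_V by (simp add: power_mono)
          finally show ?thesis by (simp add: p_def r_def)
        qed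
        have newavg: "average k ?L (\<lambda>c. of_bool (new ?L ?N b0 (\<lambda>j\<in>{..<k}. g j \<otimes>\<^bsub>G\<^esub> c j))) \<le> e" if g: "g \<in> ?T" for g
        proof -
          have "average k ?L (\<lambda>c. of_bool (new ?L ?N b0 (\<lambda>j\<in>{..<k}. g j \<otimes>\<^bsub>G\<^esub> c j)))
              = average k ?L (\<lambda>c. of_bool (\<exists>d\<in>M.Van ?N - M.Van ?L. \<forall>j<k. d (g j \<otimes>\<^bsub>G\<^esub> c j) = \<one>\<^bsub>fst b0\<^esub>))"
            by (simp add: new_def Van_def)
          also have "\<dots> \<le> real (card (M.Van ?L)) / real (card (carrier (fst b0))) ^ k"
            by (rule M.average_new_vanishing_le[OF ch LK g])
          also have "\<dots> \<le> e" unfolding e_def using cardV pn by (simp add: p_def divide_right_mono)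
          finally show ?thesis .
        qed
        \<comment> \<open>Derivations that vanish on L are constant on the cosets of L, so
          conditioning on the cosets fixes whether \<open>g\<close> is dead over L.\<close>
        have shift: "dead ?L b (\<lambda>j\<in>{..<k}. g j \<otimes>\<^bsub>G\<^esub> c j) = dead ?L b g"
          if b: "b \<in> B" and g: "g \<in> ?T" and c: "c \<in> {..<k} \<rightarrow>\<^sub>E ?L" for b g c
        proof -
          interpret M1: finite_irreducible_module G "fst b" "snd b" using B b by blast
          have step: "d (g j \<otimes>\<^bsub>G\<^esub> c j) = d (g j)" if d: "d \<in> M1.Van ?L" and j: "j < k" for d j
          proof -
            have "g j \<in> carrier G" "c j \<in> ?L" using g c j by auto
            then show ?thesis using M1.Der_mult[OF M1.Van_Der[OF d]] M1.Van_zero[OF d] Lc M1.DerD[OF M1.Van_Der[OF d]] by auto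
          qed
          have "(\<forall>j<k. d ((\<lambda>j\<in>{..<k}. g j \<otimes>\<^bsub>G\<^esub> c j) j) = \<one>\<^bsub>fst b\<^esub>) = (\<forall>j<k. d (g j) = \<one>\<^bsub>fst b\<^esub>)"
            if d: "d \<in> Van b ?L - Van b (carrier G)" for d
          proof -
            have "d \<in> M1.Van ?L" using d unfolding Van_def by blast
            from step[OF this] show ?thesis by simp
          qed
          then show ?thesis unfolding dead_def by (rule bex_cong[OF refl])
        qed
        \<comment> \<open>The bound for the conditional probability: 1 if \<open>g\<close> is
          already dead over L, and \<open>e\<close> otherwise.\<close>
        define h where "h g = of_bool (\<exists>b\<in>B. dead ?L b g) * (1 - e) + e" for g
        have "a i \<le> average k (carrier G) h"
          unfolding a_def
        proof (rule G.average_le_by_translates[OF G(2) Lc L0])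
          fix g assume g: "g \<in> ?T"
          have finL: "finite ?L" using finite_subset[OF Lc G(2)] .
          show "average k ?L (\<lambda>c. of_bool (\<exists>b\<in>B. dead ?N b (\<lambda>j\<in>{..<k}. g j \<otimes>\<^bsub>G\<^esub> c j))) \<le> h g"
          proof (cases "\<exists>b\<in>B. dead ?L b g")
            case True
            have "average k ?L (\<lambda>c. of_bool (\<exists>b\<in>B. dead ?N b (\<lambda>j\<in>{..<k}. g j \<otimes>\<^bsub>G\<^esub> c j))) \<le> average k ?L (\<lambda>_. 1)"
              by (rule average_mono) simp
            then show ?thesis using True average_const[OF finL L0, of k 1] by (simp add: h_def)
          next
            case False
            have "average k ?L (\<lambda>c. of_bool (\<exists>b\<in>B. dead ?N b (\<lambda>j\<in>{..<k}. g j \<otimes>\<^bsub>G\<^esub> c j)))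
                \<le> average k ?L (\<lambda>c. of_bool (new ?L ?N b0 (\<lambda>j\<in>{..<k}. g j \<otimes>\<^bsub>G\<^esub> c j)))"
            proof (rule average_mono)
              fix c assume c: "c \<in> {..<k} \<rightarrow>\<^sub>E ?L"
              let ?gc = "\<lambda>j\<in>{..<k}. g j \<otimes>\<^bsub>G\<^esub> c j"
              have "new ?L ?N b0 ?gc" if ex: "\<exists>b\<in>B. dead ?N b ?gc"
              proof -
                obtain b where b: "b \<in> B" "dead ?N b ?gc" using ex by blast
                have "\<not> dead ?L b ?gc" using shift[OF b(1) g c] False b by blast
                then have n: "new ?L ?N b ?gc" using split b by blast
                then have "\<not> Van b ?N \<subseteq> Van b ?L" unfolding new_def by blast
                then show ?thesis using n uniq[OF b(1)] by blast
              qed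
              then show "of_bool (\<exists>b\<in>B. dead ?N b ?gc) \<le> (of_bool (new ?L ?N b0 ?gc) :: real)" by (rule of_bool_mono)
            qed
            also note newavg[OF g]
            finally show ?thesis using False by (simp add: h_def)
          qed
        qed
        also have "average k (carrier G) h = a (Suc i) * (1 - e) + e"
        proof -
          have "average k (carrier G) h = average k (carrier G) (\<lambda>g. of_bool (\<exists>b\<in>B. dead ?L b g)) * (1 - e)
              + average k (carrier G) (\<lambda>_. e)"
            unfolding average_def h_def by (simp add: sum.distrib sum_distrib_right[symmetric] add_divide_distrib)
          then show ?thesis using average_const[OF G(2) cne] by (simp add: a_def)
        qed
        finally have ai: "(1 - a (Suc i)) * (1 - e) \<le> 1 - a i" by (simp add: algebra_simps)
        have "R i \<le> R (Suc i) * (1 - e)"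
        proof -
          have f0: "(\<Prod>j<r b0 i. 1 - p b0 ^ j / p b0 ^ k) = (\<Prod>j<r b0 (Suc i). 1 - p b0 ^ j / p b0 ^ k) * (1 - e)"
            unfolding rb0 e_def by simp
          have "R i = (\<Prod>j<r b0 i. 1 - p b0 ^ j / p b0 ^ k) * (\<Prod>b\<in>B - {b0}. \<Prod>j<r b i. 1 - p b ^ j / p b ^ k)"
            unfolding R_def by (rule prod.remove[OF B(1) b0(1)])
          also have "\<dots> \<le> (\<Prod>j<r b0 i. 1 - p b0 ^ j / p b0 ^ k) * (\<Prod>b\<in>B - {b0}. \<Prod>j<r b (Suc i). 1 - p b ^ j / p b ^ k)"
            using Rfac0 Rmono True b0 by (intro mult_left_mono prod_mono) auto
          also have "\<dots> = R (Suc i) * (1 - e)"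
            unfolding R_def f0 by (subst prod.remove[OF B(1) b0(1)]) (simp add: mult_ac)
          finally show ?thesis .
        qed
        also have "\<dots> \<le> (1 - a (Suc i)) * (1 - e)" using IH e01 by (intro mult_right_mono) auto
        also note ai
        finally show ?thesis .
      qed
    qed
  qed
  have len: "0 < length Ns" "Ns ! 0 = {\<one>\<^bsub>G\<^esub>}" using Ns by (auto simp: chief_series_def hd_conv_nth)
  \<comment> \<open>For trivial action the subgroups [V, g i] are zero and \<open>Inn\<close>
    contains only the zero map; thus \<open>bad\<close> says that some nonzero homomorphism into V
    kills all entries.\<close>
  have bad_dead: "finite_irreducible_module.bad G (fst b) (snd b) k g = dead (Ns ! 0) b g" if b: "b \<in> B" and g: "g \<in> ?T" for b g
  proof -
    interpret M: finite_irreducible_module G "fst b" "snd b" using B b by blast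
    have K: "M.Ker = carrier G" using B(3)[OF b] .
    have "M.Van {\<one>\<^bsub>G\<^esub>} = M.Der" unfolding M.Van_def using M.Der_one by blast
    moreover have "M.Comm (g i) = {\<one>\<^bsub>fst b\<^esub>}" if "i < k" for i
      by (rule M.Comm_central[OF K]) (use g that in auto)
    ultimately show ?thesis unfolding M.bad_def dead_def Van_def len(2) using M.Van_carrier_Inn[OF K] by auto
  qed
  have "average k (carrier G) (\<lambda>g. of_bool (\<exists>b\<in>B. finite_irreducible_module.bad G (fst b) (snd b) k g)) = a 0"
    unfolding a_def average_def using bad_dead by (intro arg_cong2[where f = "(/)"] sum.cong refl) auto
  moreover have "R 0 = (\<Prod>b\<in>B. \<Prod>j<delta_mod G Ns (fst b) (snd b). 1 - real (card (carrier (fst b))) ^ j / real (card (carrier (fst b))) ^ k)"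
    unfolding R_def using r0 by (intro prod.cong) (auto simp: p_def)
  ultimately show ?thesis using main[OF len(1)] by simp
qed

section \<open>The bound\<close>

lemma (in group) module_of_chief_factor:
  fixes V :: "('v, 'n) monoid_scheme"
  assumes "finite (carrier G)" and irr: "irreducible_G_module G V \<phi>"
    and ch: "chief_factor G X Y" and iso: "G_isomorphic_to_section G V \<phi> X Y"
  shows "finite_irreducible_module G V \<phi>"
    and "central_factor G X Y \<Longrightarrow> finite_irreducible_module.Ker G V \<phi> = carrier G"
proof -
  obtain f where f: "f \<in> iso V (section_group G X Y)"
    "\<And>g v. \<lbrakk>g \<in> carrier G; v \<in> carrier V\<rbrakk> \<Longrightarrow> f (\<phi> g v) = section_action G X Y g (f v)"
    using iso unfolding G_isomorphic_to_section_def G_isomorphic_def by blast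
  have bij: "bij_betw f (carrier V) (carrier (section_group G X Y))" using f(1) by (simp add: iso_def)
  have "X \<subseteq> carrier G" using chief_factorD(1)[OF ch] normal_imp_subgroup subgroup.subset by blast
  then have "finite (carrier (section_group G X Y))"
    using finite_subset[OF _ assms(1)] by (simp add: carrier_section_group)
  then have fin: "finite (carrier V)" using bij_betw_finite[OF bij] by simp
  show M: "finite_irreducible_module G V \<phi>"
    by (rule finite_irreducible_moduleI[OF is_group assms(1) fin irr])
  interpret M: finite_irreducible_module G V \<phi> by fact
  assume central: "central_factor G X Y"
  have "\<phi> g v = v" if g: "g \<in> carrier G" "v \<in> carrier V" for g v
  proof -
    have "f v \<in> carrier (section_group G X Y)" using bij g(2) by (auto simp: bij_betw_def)
    then have "f (\<phi> g v) = f v" using f(2)[OF g] central g(1)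
      unfolding central_factor_def trivial_action_def by simp
    then show ?thesis using bij g M.act_closed[OF g] unfolding bij_betw_def inj_on_def by blast
  qed
  then show "M.Ker = carrier G" unfolding M.Ker_def by blast
qed

lemma module_representativesD:
  assumes A: "module_representatives G P A" and a: "a \<in> A"
  shows "irreducible_G_module G (fst a) (snd a)"
    and "\<exists>X Y. chief_factor G X Y \<and> complemented G X Y \<and> P X Y \<and> G_isomorphic_to_section G (fst a) (snd a) X Y"
proof -
  have "case a of (V, \<phi>) \<Rightarrow> irreducible_G_module G V \<phi> \<and>
    (\<exists>X Y. chief_factor G X Y \<and> complemented G X Y \<and> P X Y \<and> G_isomorphic_to_section G V \<phi> X Y)"
    using A unfolding module_representatives_def by (rule conjunct1[THEN bspec, OF _ a])
  then show "irreducible_G_module G (fst a) (snd a)"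
    "\<exists>X Y. chief_factor G X Y \<and> complemented G X Y \<and> P X Y \<and> G_isomorphic_to_section G (fst a) (snd a) X Y"
    unfolding case_prod_beta by blast+
qed

lemma module_representatives_ex:
  assumes "module_representatives G P A" "chief_factor G X Y" "complemented G X Y" "P X Y"
  shows "\<exists>a\<in>A. G_isomorphic_to_section G (fst a) (snd a) X Y"
  using assms unfolding module_representatives_def case_prod_beta by blast

lemma module_representatives_eq:
  assumes A: "module_representatives G P A" and ab: "a \<in> A" "b \<in> A"
    and iso: "G_isomorphic G (fst a) (snd a) (fst b) (snd b)"
  shows "a = b"
proof -
  have "\<forall>a\<in>A. \<forall>b\<in>A. G_isomorphic G (fst a) (snd a) (fst b) (snd b) \<longrightarrow> (fst a, snd a) = (fst b, snd b)"
    using A unfolding module_representatives_def case_prod_beta by blast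
  then show ?thesis using ab iso by (auto simp: prod_eq_iff)
qed

text \<open>Mapping a representative to some chief factor isomorphic to it is injective, because
  representatives are pairwise non-isomorphic. Finiteness matters since a sum over an infinite set
  would be 0.\<close>

lemma (in group) finite_module_representatives:
  fixes A :: "('v monoid \<times> ('a \<Rightarrow> 'v \<Rightarrow> 'v)) set"
  assumes fin: "finite (carrier G)" and A: "module_representatives G P A"
  shows "finite A"
proof -
  let ?S = "{X. X \<subseteq> carrier G} \<times> {X. X \<subseteq> carrier G}"
  have ex: "\<exists>s. s \<in> ?S \<and> chief_factor G (fst s) (snd s) \<and> G_isomorphic_to_section G (fst a) (snd a) (fst s) (snd s)"
    if a: "a \<in> A" for a
  proof -
    obtain X Y where XY: "chief_factor G X Y" "G_isomorphic_to_section G (fst a) (snd a) X Y"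
      using module_representativesD(2)[OF A a] by blast
    have "X \<subseteq> carrier G" "Y \<subseteq> carrier G"
      using chief_factorD(1,2)[OF XY(1)] normal_imp_subgroup subgroup.subset by blast+
    then show ?thesis using XY by (intro exI[of _ "(X, Y)"]) simp
  qed
  define s where "s a = (SOME s. s \<in> ?S \<and> chief_factor G (fst s) (snd s) \<and>
    G_isomorphic_to_section G (fst a) (snd a) (fst s) (snd s))" for a :: "'v monoid \<times> ('a \<Rightarrow> 'v \<Rightarrow> 'v)"
  have s: "s a \<in> ?S" "chief_factor G (fst (s a)) (snd (s a))"
    "G_isomorphic_to_section G (fst a) (snd a) (fst (s a)) (snd (s a))" if "a \<in> A" for a
    using someI_ex[OF ex[OF that]] unfolding s_def by blast+
  have "inj_on s A"
  proof (rule inj_onI)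
    fix a b assume ab: "a \<in> A" "b \<in> A" "s a = s b"
    have "irreducible_G_module G (fst b) (snd b)" by (rule module_representativesD(1)[OF A ab(2)])
    then interpret M: finite_irreducible_module G "fst b" "snd b"
      using module_of_chief_factor(1)[OF fin _ s(2,3)[OF ab(2)]] by blast
    have "G_isomorphic G (section_group G (fst (s b)) (snd (s b))) (section_action G (fst (s b)) (snd (s b))) (fst b) (snd b)"
      using s(3)[OF ab(2)] unfolding G_isomorphic_to_section_def
      by (rule G_isomorphic_sym[OF _ M.V.is_group M.act_closed])
    then have "G_isomorphic G (fst a) (snd a) (fst b) (snd b)"
      using s(3)[OF ab(1)] G_isomorphic_trans unfolding ab(3) G_isomorphic_to_section_def by blast
    then show "a = b" by (rule module_representatives_eq[OF A ab(1,2)])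
  qed
  moreover have "finite ?S" using fin by simp
  moreover have "s ` A \<subseteq> ?S" using s(1) by blast
  ultimately show ?thesis using inj_on_finite by blast
qed

lemma (in group) not_invariably_generates_imp_complement:
  assumes fin: "finite (carrier G)" and sol: "solvable G"
    and g: "g \<in> {..<k} \<rightarrow>\<^sub>E carrier G" and not: "\<not> invariably_generates G k g"
  obtains M X Y x where "chief_factor G X Y" "subgroup M G" "M <#> X = carrier G" "M \<inter> X = Y"
    "\<And>i. i < k \<Longrightarrow> x i \<in> carrier G" "\<And>i. i < k \<Longrightarrow> inv (x i) \<otimes> g i \<otimes> x i \<in> M"
proof -
  obtain x where x: "x \<in> {..<k} \<rightarrow> carrier G"
    and ne: "generate G ((\<lambda>i. inv (x i) \<otimes> g i \<otimes> x i) ` {..<k}) \<noteq> carrier G"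
    using not unfolding invariably_generates_def by blast
  let ?S = "(\<lambda>i. inv (x i) \<otimes> g i \<otimes> x i) ` {..<k}"
  have xc: "x i \<in> carrier G" "g i \<in> carrier G" if "i < k" for i using x g that by auto
  then have "?S \<subseteq> carrier G" by auto
  then have "subgroup (generate G ?S) G" by (rule generate_is_subgroup)
  from proper_subgroup_le_complement[OF fin sol this ne]
  obtain M X Y where M: "subgroup M G" "generate G ?S \<subseteq> M" "chief_factor G X Y" "M <#> X = carrier G" "M \<inter> X = Y" .
  have "inv (x i) \<otimes> g i \<otimes> x i \<in> M" if "i < k" for i
    using M(2) generate.incl[of "inv (x i) \<otimes> g i \<otimes> x i" ?S G] that by blast
  then show ?thesis using that[OF M(3,1,4,5)] xc by blast
qed

theorem theorem2:
  fixes G :: "('a, 'm) monoid_scheme"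
    and Ns :: "'a set list"
    and A :: "('v monoid \<times> ('a \<Rightarrow> 'v \<Rightarrow> 'v)) set"
    and B :: "('w monoid \<times> ('a \<Rightarrow> 'w \<Rightarrow> 'w)) set"
  assumes "group G" and "finite (carrier G)" and "solvable G"
    and "chief_series G Ns"
    and "module_representatives G (\<lambda>X Y. \<not> central_factor G X Y) A"
    and "module_representatives G (\<lambda>X Y. central_factor G X Y) B"
  shows "chebotarev_invariant G \<le> ennreal (
           (\<Sum>(V, \<phi>) \<in> A.
              min ((real (delta_mod G Ns V \<phi> * theta_mod G Ns V \<phi>) + c_mod G V \<phi>)
                     * real (Coset.order V))
                  ((real_of_int \<lceil>real (delta_mod G Ns V \<phi> * theta_mod G Ns V \<phi>)
                                  / real (n_mod G V \<phi>)\<rceil>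
                    + real (q_mod G V \<phi>) ^ n_mod G V \<phi>
                      / (real (q_mod G V \<phi>) ^ n_mod G V \<phi> - 1))
                     * real (Coset.order (H_mod G V \<phi>))))
           + real (Max (insert 0 ((\<lambda>(V, \<phi>). delta_mod G Ns V \<phi>) ` B)))
           + pomerance_sigma)
         \<and> (\<forall>(V, \<phi>) \<in> A. c_mod G V \<phi> \<le> 2)"
proof -
  interpret G: group G by fact
  have ab: "abelian_section G L N" if "chief_factor G L N" for L N
    by (rule G.solvable_abelian_section[OF assms(3) that])
  have finA: "finite A" by (rule G.finite_module_representatives[OF assms(2,5)])
  have finB: "finite B" by (rule G.finite_module_representatives[OF assms(2,6)])
  have A: "finite_irreducible_module G (fst a) (snd a)" if "a \<in> A" for a
  proof -
    show ?thesis using module_representativesD[OF assms(5) that] G.module_of_chief_factor(1)[OF assms(2)] by blast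
  qed
  have B: "finite_irreducible_module G (fst b) (snd b)"
    "finite_irreducible_module.Ker G (fst b) (snd b) = carrier G" if "b \<in> B" for b
  proof -
    show "finite_irreducible_module G (fst b) (snd b)"
      "finite_irreducible_module.Ker G (fst b) (snd b) = carrier G"
      using module_representativesD[OF assms(6) that] G.module_of_chief_factor[OF assms(2)] by blast+
  qed
  have B_inj: "b = c" if "b \<in> B" "c \<in> B" "G_isomorphic G (fst b) (snd b) (fst c) (snd c)" for b c
    using module_representatives_eq[OF assms(6) that] .
  define badA where "badA a k g = finite_irreducible_module.bad G (fst a) (snd a) k g"
    for a :: "'v monoid \<times> ('a \<Rightarrow> 'v \<Rightarrow> 'v)" and k and g :: "nat \<Rightarrow> 'a"
  define badB where "badB b k g = finite_irreducible_module.bad G (fst b) (snd b) k g"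
    for b :: "'w monoid \<times> ('a \<Rightarrow> 'w \<Rightarrow> 'w)" and k and g :: "nat \<Rightarrow> 'a"
  define \<beta> where "\<beta> a = min ((real (delta_mod G Ns (fst a) (snd a) * theta_mod G Ns (fst a) (snd a)) + c_mod G (fst a) (snd a))
                     * real (Coset.order (fst a)))
                  ((real_of_int \<lceil>real (delta_mod G Ns (fst a) (snd a) * theta_mod G Ns (fst a) (snd a))
                                  / real (n_mod G (fst a) (snd a))\<rceil>
                    + real (q_mod G (fst a) (snd a)) ^ n_mod G (fst a) (snd a)
                      / (real (q_mod G (fst a) (snd a)) ^ n_mod G (fst a) (snd a) - 1))
                     * real (Coset.order (H_mod G (fst a) (snd a))))" for a :: "'v monoid \<times> ('a \<Rightarrow> 'v \<Rightarrow> 'v)"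
  define D where "D = Max (insert 0 ((\<lambda>b. delta_mod G Ns (fst b) (snd b)) ` B))"
  \<comment> \<open>The complement that contains the conjugates belongs to a chief factor X / Y,
    which is represented in B or in A according to whether it is central.\<close>
  have cover: "(\<exists>a\<in>A. badA a k g) \<or> (\<exists>b\<in>B. badB b k g)"
    if g: "g \<in> {..<k} \<rightarrow>\<^sub>E carrier G" and not: "\<not> invariably_generates G k g" for k g
  proof -
    obtain M X Y x where ch: "chief_factor G X Y" and M: "subgroup M G" "M <#>\<^bsub>G\<^esub> X = carrier G" "M \<inter> X = Y"
      and x: "\<And>i. i < k \<Longrightarrow> x i \<in> carrier G" "\<And>i. i < k \<Longrightarrow> inv\<^bsub>G\<^esub> (x i) \<otimes>\<^bsub>G\<^esub> g i \<otimes>\<^bsub>G\<^esub> x i \<in> M" 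
      by (rule G.not_invariably_generates_imp_complement[OF assms(2,3) g not], rule that, assumption+)
    have comp: "complemented G X Y" using M unfolding complemented_def by blast
    show ?thesis
    proof (cases "central_factor G X Y")
      case True
      then have "\<exists>b\<in>B. G_isomorphic_to_section G (fst b) (snd b) X Y"
        using module_representatives_ex[OF assms(6) ch comp] by blast
      then obtain b where b: "b \<in> B" "G_isomorphic_to_section G (fst b) (snd b) X Y" by blast
      have "badB b k g" unfolding badB_def
        by (rule finite_irreducible_module.bad_of_conjugates_in_complement[OF B(1)[OF b(1)] ch ab[OF ch] M b(2) _ x])
          (use g in auto)
      then show ?thesis using b by blast
    next
      case False
      then have "\<exists>a\<in>A. G_isomorphic_to_section G (fst a) (snd a) X Y"
        using module_representatives_ex[OF assms(5) ch comp] by blast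
      then obtain a where a: "a \<in> A" "G_isomorphic_to_section G (fst a) (snd a) X Y" by blast
      have "badA a k g" unfolding badA_def
        by (rule finite_irreducible_module.bad_of_conjugates_in_complement[OF A[OF a(1)] ch ab[OF ch] M a(2) _ x])
          (use g in auto)
      then show ?thesis using a by blast
    qed
  qed
  have boundA: "(\<Sum>k<n. average k (carrier G) (\<lambda>g. of_bool (badA a k g))) \<le> \<beta> a"
    and c2: "c_mod G (fst a) (snd a) \<le> 2" if a: "a \<in> A" for a n
  proof -
    interpret M: finite_irreducible_module G "fst a" "snd a" by (rule A[OF a])
    let ?\<delta> = "delta_mod G Ns (fst a) (snd a)"
    have th: "theta_mod G Ns (fst a) (snd a) = (if ?\<delta> = 1 then 0 else 1)" by (simp add: theta_mod_def)
    note KI = M.Van_Ker_Inn[OF assms(4) ab] and D = M.card_Der_le[OF assms(4) ab]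
    have H: "real (Coset.order (H_mod G (fst a) (snd a))) = real (card (carrier G)) / real (card M.Ker)"
    proof -
      have sK: "subgroup M.Ker G" using M.Ker_normal normal_imp_subgroup by blast
      have "Coset.order (H_mod G (fst a) (snd a)) = card (rcosets\<^bsub>G\<^esub> M.Ker)"
        by (simp add: H_mod_def Coset.order_def FactGroup_def M.Ker_def)
      then have "card M.Ker * Coset.order (H_mod G (fst a) (snd a)) = card (carrier G)"
        using G.lagrange[OF sK] by (simp add: Coset.order_def mult.commute)
      then have "real (card M.Ker) * real (Coset.order (H_mod G (fst a) (snd a))) = real (card (carrier G))"
        by (metis of_nat_mult)
      moreover have "card M.Ker > 0" using M.one_Ker finite_subset[OF M.Ker_subset assms(2)] by (auto simp: card_gt_0_iff)
      ultimately show ?thesis by (simp add: field_simps)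
    qed
    show "(\<Sum>k<n. average k (carrier G) (\<lambda>g. of_bool (badA a k g))) \<le> \<beta> a"
      unfolding \<beta>_def badA_def
    proof (rule min.boundedI)
      show "(\<Sum>k<n. average k (carrier G) (\<lambda>g. of_bool (M.bad k g)))
        \<le> (real (?\<delta> * theta_mod G Ns (fst a) (snd a)) + c_mod G (fst a) (snd a)) * real (Coset.order (fst a))"
        using M.sum_average_bad_le_1[OF KI D, of n] unfolding th c_mod_def Coset.order_def .
      show "(\<Sum>k<n. average k (carrier G) (\<lambda>g. of_bool (M.bad k g)))
        \<le> (real_of_int \<lceil>real (?\<delta> * theta_mod G Ns (fst a) (snd a)) / real (n_mod G (fst a) (snd a))\<rceil>
            + real M.q ^ n_mod G (fst a) (snd a) / (real M.q ^ n_mod G (fst a) (snd a) - 1))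
          * real (Coset.order (H_mod G (fst a) (snd a)))"
        using M.sum_average_bad_le_2[OF KI D M.card_V_eq, of n] unfolding th H .
    qed
    have "real M.q \<ge> 2" using M.two_le_q by simp
    then show "c_mod G (fst a) (snd a) \<le> 2" by (simp add: c_mod_def field_simps)
  qed
  have boundB: "(\<Sum>k<n. average k (carrier G) (\<lambda>g. of_bool (\<exists>b\<in>B. badB b k g))) \<le> real D + pomerance_sigma" for n
  proof -
    define P where "P k = 1 - average k (carrier G) (\<lambda>g. of_bool (\<exists>b\<in>B. badB b k g))" for k
    have "(\<Sum>k<n. 1 - P k) \<le> real D + pomerance_sigma"
    proof (rule pomerance_bound[OF finB, where p = "\<lambda>b. card (carrier (fst b))"])
      show "inj_on (\<lambda>b. card (carrier (fst b))) B"
      proof (rule inj_onI)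
        fix b c assume bc: "b \<in> B" "c \<in> B" "card (carrier (fst b)) = card (carrier (fst c))"
        then show "b = c" using central_modules_isomorphic[OF B[OF bc(1)] B[OF bc(2)] bc(3)] B_inj by blast
      qed
      show "prime (card (carrier (fst b)))" if "b \<in> B" for b
        by (rule finite_irreducible_module.prime_card_central[OF B[OF that]])
      show \<delta>: "delta_mod G Ns (fst b) (snd b) \<le> D" if "b \<in> B" for b
        unfolding D_def using finB that by (intro Max_ge) auto
      show "0 \<le> P k" for k
        using average_mono[of k "carrier G" "\<lambda>g. of_bool (\<exists>b\<in>B. badB b k g)" "\<lambda>_. 1"]
          average_const[OF assms(2) G.carrier_not_empty, of k 1] by (simp add: P_def)
      show "P k \<le> 1" for k by (simp add: P_def average_def sum_nonneg)
      show "(\<Prod>b\<in>B. \<Prod>j<delta_mod G Ns (fst b) (snd b).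
          1 - real (card (carrier (fst b))) ^ j / real (card (carrier (fst b))) ^ k) \<le> P k" if k: "D \<le> k" for k
        unfolding P_def badB_def
        by (rule central_generation_probability[OF assms(1,2,4) ab finB B B_inj]) (use \<delta> k order_trans in blast)+
    qed
    then show ?thesis by (simp add: P_def)
  qed
  have "(\<Sum>k<n. average k (carrier G) (\<lambda>g. of_bool (\<not> invariably_generates G k g)))
      \<le> (\<Sum>a\<in>A. \<beta> a) + real D + pomerance_sigma" for n
  proof -
    \<comment> \<open>A union bound over the members of A gives one summand each, while the members
      of B remain a single event, so that only the maximum of their \<delta> is paid.\<close>
    have one: "average k (carrier G) (\<lambda>g. of_bool (\<not> invariably_generates G k g))
        \<le> (\<Sum>a\<in>A. average k (carrier G) (\<lambda>g. of_bool (badA a k g)))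
          + average k (carrier G) (\<lambda>g. of_bool (\<exists>b\<in>B. badB b k g))" for k
    proof -
      have "average k (carrier G) (\<lambda>g. of_bool (\<not> invariably_generates G k g))
          \<le> average k (carrier G) (\<lambda>g. (\<Sum>a\<in>A. of_bool (badA a k g)) + of_bool (\<exists>b\<in>B. badB b k g))"
      proof (rule average_mono)
        fix g assume g: "g \<in> {..<k} \<rightarrow>\<^sub>E carrier G"
        have s0: "0 \<le> (\<Sum>a\<in>A. of_bool (badA a k g) :: real)" by (intro sum_nonneg) simp
        have b0: "0 \<le> (of_bool Q :: real)" for Q by simp
        have s1: "1 \<le> (\<Sum>a\<in>A. of_bool (badA a k g) :: real)" if "a \<in> A" "badA a k g" for a
          using member_le_sum[of a A "\<lambda>a. of_bool (badA a k g) :: real"] that finA by simp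
        show "of_bool (\<not> invariably_generates G k g)
            \<le> (\<Sum>a\<in>A. of_bool (badA a k g)) + (of_bool (\<exists>b\<in>B. badB b k g) :: real)"
        proof (cases "invariably_generates G k g")
          case True
          then have "of_bool (\<not> invariably_generates G k g) = (0 :: real)" by simp
          then show ?thesis using s0 b0[of "\<exists>b\<in>B. badB b k g"] by linarith
        next
          case False
          then have eq: "of_bool (\<not> invariably_generates G k g) = (1 :: real)" by simp
          show ?thesis
          proof (cases "\<exists>b\<in>B. badB b k g")
            case True
            then have "of_bool (\<exists>b\<in>B. badB b k g) = (1 :: real)" by (simp only: of_bool_eq)
            then show ?thesis using s0 eq by linarith
          next
            case no: False
            then obtain a where "a \<in> A" "badA a k g" using cover[OF g False] by blast
            then show ?thesis using s1[of a] eq b0[of "\<exists>b\<in>B. badB b k g"] by linarith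
          qed
        qed
      qed
      also have "\<dots> = (\<Sum>a\<in>A. average k (carrier G) (\<lambda>g. of_bool (badA a k g)))
          + average k (carrier G) (\<lambda>g. of_bool (\<exists>b\<in>B. badB b k g))"
        unfolding average_def by (simp only: sum.distrib add_divide_distrib sum_divide_distrib sum.swap[of _ A])
      finally show ?thesis .
    qed
    have "(\<Sum>k<n. average k (carrier G) (\<lambda>g. of_bool (\<not> invariably_generates G k g)))
        \<le> (\<Sum>k<n. (\<Sum>a\<in>A. average k (carrier G) (\<lambda>g. of_bool (badA a k g)))
          + average k (carrier G) (\<lambda>g. of_bool (\<exists>b\<in>B. badB b k g)))"
      by (intro sum_mono one)
    also have "\<dots> = (\<Sum>a\<in>A. \<Sum>k<n. average k (carrier G) (\<lambda>g. of_bool (badA a k g)))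
        + (\<Sum>k<n. average k (carrier G) (\<lambda>g. of_bool (\<exists>b\<in>B. badB b k g)))"
      by (simp only: sum.distrib sum.swap[of _ A])
    also have "\<dots> \<le> (\<Sum>a\<in>A. \<beta> a) + (real D + pomerance_sigma)"
      by (intro add_mono sum_mono boundA boundB)
    finally show ?thesis by simp
  qed
  then have "chebotarev_invariant G \<le> ennreal ((\<Sum>a\<in>A. \<beta> a) + real D + pomerance_sigma)"
    by (rule chebotarev_invariant_le[OF assms(2) G.carrier_not_empty])
  moreover have "\<forall>(V, \<phi>)\<in>A. c_mod G V \<phi> \<le> 2" using c2 by auto
  ultimately show ?thesis unfolding \<beta>_def D_def case_prod_unfold by (rule conjI)
qed

end
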